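(* Let $(M,\nabla,g)$ be a simply connected Hessian manifold of dimension $n$, let $(I,g^{\mathrm r})$ be the corresponding Kähler structure on $TM\simeq M\times\mathbb{R}^n$, let $G$ be the group of affine isometries of $(M,\nabla,g)$, let $\theta$ be the induced affine action of $G$ on $\mathbb{R}^n$, and let $\psi$ be the action of $G\ltimes_\theta\mathbb{R}^n$ on $TM$ given by $\psi_{a\ltimes_\theta u}(m\times v)=\phi_a(m)\times(\theta_a(v)+u)$, where $\phi$ is the action of $G$ on $M$. Then the Kähler structure $(I,g^{\mathrm r})$ is invariant under the action $\psi$ of $G\ltimes_\theta\mathbb{R}^n$. In particular, if $(M,\nabla,g)$ is a homogeneous Hessian manifold for the group $G$, then $TM$ is a homogeneous Kähler manifold for the group $G\ltimes_\theta\mathbb{R}^n$.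
   Context: A flat affine manifold $(M,\nabla)$ is a smooth manifold with a flat torsion-free connection $\nabla$. A Hessian manifold $(M,\nabla,g)$ is a flat affine manifold with a Riemannian metric $g$ that in flat local coordinates is locally $g=\frac{\partial^2\varphi}{\partial x^i\partial x^j}dx^i dx^j$ for some local function $\varphi$. An affine isometry is a diffeomorphism of $M$ preserving $\nabla$ and $g$. Development map: for $(M,\nabla)$ simply connected of dimension $n$ there is a local affine diffeomorphism $\mathrm{dev}:M\to\mathbb{R}^n$; if $G$ acts on $M$ by affine automorphisms via $\phi$, there is an affine action $\theta$ of $G$ on $\mathbb{R}^n$ with $\mathrm{dev}\circ\phi_a=\theta_a\circ\mathrm{dev}$ for all $a\in G$. The connection gives the trivialization $TM\simeq M\times\mathbb{R}^n$, identifying $w\in T_mM$ with $(m,d\,\mathrm{dev}_m(w))$. Let $\pi:TM\simeq M\times\mathbb{R}^n\to M$ be the projection. The group $G\ltimes_\theta\mathbb{R}^n$ is the set $G\times\mathbb{R}^n$ with the product $(a,u)(b,w)=(ab,\,u+L_a w)$, where $L_a$ is the linear part of $\theta_a$, so that $\psi$ is an action. Structure on $TM$: a flat chart $x^1,\dots,x^n$ on $M$ gives coordinates $x^1,\dots,x^n,y^1,\dots,y^n$ on $TM$; $I$ is the complex structure with $I(\partial/\partial x^i)=\partial/\partial y^i$ (equivalently, writing tangent vectors of $M\times\mathbb{R}^n$ as $X\times Y\in\mathbb{R}^n\times\mathbb{R}^n$ via $d\,\mathrm{dev}$, $I(X\times Y)=(-Y)\times X$), and if $g=g_{ij}dx^idx^j$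 then $g^{\mathrm r}=\pi^*g_{ij}(dx^idx^j+dy^idy^j)$, i.e. $g^{\mathrm r}(X,Y)=(\pi^*g)(X,Y)+(\pi^*g)(IX,IY)$. It is known that $(I,g^{\mathrm r})$ is a Kähler structure when $g$ is Hessian. A homogeneous Hessian (resp. Kähler) manifold for a group is a Hessian (resp. Kähler) manifold with a transitive action of that group preserving $\nabla$ and $g$ (resp. the complex structure and the metric). *)

theory Defs
  imports "HOL-Analysis.Analysis" "HOL-Algebra.Group_Action"
begin

section \<open>Smooth manifolds\<close>

text \<open>The derivative conditions are meaningful for open \<open>S\<close>, which is the only use below.\<close>

fun Ck_on :: "nat \<Rightarrow> 'a::real_normed_vector set \<Rightarrow> ('a \<Rightarrow> 'b::real_normed_vector) \<Rightarrow> bool" where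
  "Ck_on 0 S f \<longleftrightarrow> continuous_on S f"
| "Ck_on (Suc k) S f \<longleftrightarrow> (\<forall>x\<in>S. f differentiable (at x)) \<and>
     (\<forall>v. Ck_on k S (\<lambda>x. frechet_derivative f (at x) v))"

definition smooth_on :: "'a::real_normed_vector set \<Rightarrow> ('a \<Rightarrow> 'b::real_normed_vector) \<Rightarrow> bool" where
  "smooth_on S f \<longleftrightarrow> (\<forall>k. Ck_on k S f)"

text \<open>The underlying space of a manifold is a whole type \<open>'a\<close>, with Hausdorff and second
  countable topology; the smooth structure is an atlas of charts \<open>(U, x)\<close> with values in the
  model space \<open>'e\<close>.  The map \<open>x\<close> is irrelevant outside \<open>U\<close>.\<close>

type_synonym ('a, 'e) chart = "'a set \<times> ('a \<Rightarrow> 'e)"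

abbreviation chart_inv :: "('a, 'e) chart \<Rightarrow> 'e \<Rightarrow> 'a" where
  "chart_inv c \<equiv> inv_into (fst c) (snd c)"

definition is_chart :: "('a::topological_space, 'e::euclidean_space) chart \<Rightarrow> bool" where
  "is_chart c \<longleftrightarrow> open (fst c) \<and> open (snd c ` fst c) \<and>
     homeomorphism (fst c) (snd c ` fst c) (snd c) (chart_inv c)"

definition compatible ::
  "('a::topological_space, 'e::euclidean_space) chart \<Rightarrow> ('a, 'e) chart \<Rightarrow> bool" where
  "compatible c d \<longleftrightarrow>
     smooth_on (snd c ` (fst c \<inter> fst d)) (snd d \<circ> chart_inv c) \<and>
     smooth_on (snd d ` (fst c \<inter> fst d)) (snd c \<circ> chart_inv d)"

definition smooth_manifold ::
  "('a::{t2_space,second_countable_topology}, 'e::euclidean_space) chart set \<Rightarrow> bool" where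
  "smooth_manifold A \<longleftrightarrow> (\<forall>c\<in>A. is_chart c) \<and> (\<Union>c\<in>A. fst c) = UNIV \<and>
     (\<forall>c\<in>A. \<forall>d\<in>A. compatible c d)"

text \<open>The charts of the maximal atlas.\<close>

definition smooth_chart ::
  "('a::topological_space, 'e::euclidean_space) chart set \<Rightarrow> ('a, 'e) chart \<Rightarrow> bool" where
  "smooth_chart A c \<longleftrightarrow> is_chart c \<and> (\<forall>d\<in>A. compatible c d)"

definition smooth_fun :: "('a::topological_space, 'e::euclidean_space) chart set \<Rightarrow> 'a set \<Rightarrow>
    ('a \<Rightarrow> 'b::real_normed_vector) \<Rightarrow> bool" where
  "smooth_fun A W f \<longleftrightarrow> (\<forall>c\<in>A. smooth_on (snd c ` (fst c \<inter> W)) (f \<circ> chart_inv c))"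

definition smooth_near :: "('a::topological_space, 'e::euclidean_space) chart set \<Rightarrow> 'a \<Rightarrow>
    ('a \<Rightarrow> 'b::real_normed_vector) \<Rightarrow> bool" where
  "smooth_near A p f \<longleftrightarrow> (\<exists>W. open W \<and> p \<in> W \<and> smooth_fun A W f)"

definition smooth_map :: "('a::topological_space, 'e::euclidean_space) chart set \<Rightarrow>
    ('b::topological_space, 'f::euclidean_space) chart set \<Rightarrow> ('a \<Rightarrow> 'b) \<Rightarrow> bool" where
  "smooth_map A B F \<longleftrightarrow> continuous_on UNIV F \<and>
     (\<forall>c\<in>A. \<forall>d\<in>B. smooth_on (snd c ` (fst c \<inter> F -` fst d)) (snd d \<circ> F \<circ> chart_inv c))"

definition diffeomorphism :: "('a::topological_space, 'e::euclidean_space) chart set \<Rightarrow>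
    ('a \<Rightarrow> 'a) \<Rightarrow> bool" where
  "diffeomorphism A F \<longleftrightarrow> bij F \<and> smooth_map A A F \<and> smooth_map A A (inv_into UNIV F)"


section \<open>Tangent vectors and vector fields\<close>

text \<open>A tangent vector at \<open>p\<close> is a directional derivative in a chart, acting on the functions
  that are smooth near \<open>p\<close> and extended by \<open>0\<close> to all other functions.\<close>

type_synonym 'a tvec = "('a \<Rightarrow> real) \<Rightarrow> real"
type_synonym 'a field = "'a \<Rightarrow> 'a tvec"

text \<open>\<open>coord_field A c u\<close> is the vector field on the domain of \<open>c\<close> that is constantly \<open>u\<close> in the
  coordinates \<open>c\<close>; for basis vectors \<open>u\<close> these are the fields \<open>\<partial>/\<partial>x\<^sup>i\<close>.\<close>

definition coord_field :: "('a::topological_space, 'e::euclidean_space) chart set \<Rightarrow>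
    ('a, 'e) chart \<Rightarrow> 'e \<Rightarrow> 'a field" where
  "coord_field A c u p = (\<lambda>f. if smooth_near A p f
     then frechet_derivative (f \<circ> chart_inv c) (at (snd c p)) u else 0)"

definition tangent_space :: "('a::topological_space, 'e::euclidean_space) chart set \<Rightarrow> 'a \<Rightarrow>
    'a tvec set" where
  "tangent_space A p = {coord_field A c u p |c u. c \<in> A \<and> p \<in> fst c}"

text \<open>The differential of a map between manifolds, and of a map into a vector space \<open>'f\<close>
  (whose tangent spaces are identified with \<open>'f\<close>).\<close>

definition pushforward :: "('b::topological_space, 'f::euclidean_space) chart set \<Rightarrow>
    ('a \<Rightarrow> 'b) \<Rightarrow> 'a \<Rightarrow> 'a tvec \<Rightarrow> 'b tvec" where
  "pushforward B F p v = (\<lambda>f. if smooth_near B (F p) f then v (f \<circ> F) else 0)"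

definition vderiv :: "'a tvec \<Rightarrow> ('a \<Rightarrow> 'f::euclidean_space) \<Rightarrow> 'f" where
  "vderiv v F = (\<Sum>b\<in>Basis. v (\<lambda>q. F q \<bullet> b) *\<^sub>R b)"

text \<open>Vector fields on an open set \<open>W\<close>; their values outside \<open>W\<close> are irrelevant.\<close>

definition vector_field :: "('a::topological_space, 'e::euclidean_space) chart set \<Rightarrow> 'a set \<Rightarrow>
    'a field \<Rightarrow> bool" where
  "vector_field A W X \<longleftrightarrow> (\<forall>p\<in>W. X p \<in> tangent_space A p) \<and>
     (\<forall>V f. open V \<and> V \<subseteq> W \<and> smooth_fun A V f \<longrightarrow> smooth_fun A V (\<lambda>p. X p f))"

definition lie_bracket :: "('a::topological_space, 'e::euclidean_space) chart set \<Rightarrow>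
    'a field \<Rightarrow> 'a field \<Rightarrow> 'a field" where
  "lie_bracket A X Y p = (\<lambda>f. if smooth_near A p f
     then X p (\<lambda>q. Y q f) - Y p (\<lambda>q. X q f) else 0)"

definition push_field :: "('a::topological_space, 'e::euclidean_space) chart set \<Rightarrow>
    ('a \<Rightarrow> 'a) \<Rightarrow> 'a field \<Rightarrow> 'a field" where
  "push_field A F X q =
     pushforward A F (inv_into UNIV F q) (X (inv_into UNIV F q))"


section \<open>Riemannian metrics and connections\<close>

type_synonym 'a metric = "'a \<Rightarrow> 'a tvec \<Rightarrow> 'a tvec \<Rightarrow> real"

definition riemannian_metric :: "('a::topological_space, 'e::euclidean_space) chart set \<Rightarrow>
    'a metric \<Rightarrow> bool" where
  "riemannian_metric A g \<longleftrightarrow>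
     (\<forall>p. \<forall>u\<in>tangent_space A p. \<forall>v\<in>tangent_space A p. \<forall>w\<in>tangent_space A p. \<forall>a b.
        g p (\<lambda>f. a * u f + b * v f) w = a * g p u w + b * g p v w) \<and>
     (\<forall>p. \<forall>u\<in>tangent_space A p. \<forall>v\<in>tangent_space A p. g p u v = g p v u) \<and>
     (\<forall>p. \<forall>u\<in>tangent_space A p. u \<noteq> (\<lambda>f. 0) \<longrightarrow> g p u u > 0) \<and>
     (\<forall>W X Y. open W \<and> vector_field A W X \<and> vector_field A W Y \<longrightarrow>
        smooth_fun A W (\<lambda>p. g p (X p) (Y p)))"

definition preserves_metric :: "('a::topological_space, 'e::euclidean_space) chart set \<Rightarrow>
    'a metric \<Rightarrow> ('a \<Rightarrow> 'a) \<Rightarrow> bool" where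
  "preserves_metric A g F \<longleftrightarrow>
     (\<forall>p. \<forall>u\<in>tangent_space A p. \<forall>v\<in>tangent_space A p.
        g (F p) (pushforward A F p u) (pushforward A F p v) = g p u v)"

text \<open>A connection acts on vector fields defined on open sets and is compatible with
  restriction (first clause).\<close>

definition connection :: "('a::topological_space, 'e::euclidean_space) chart set \<Rightarrow>
    ('a field \<Rightarrow> 'a field \<Rightarrow> 'a field) \<Rightarrow> bool" where
  "connection A nab \<longleftrightarrow>
     (\<forall>W X X' Y Y'. open W \<and> vector_field A W X \<and> vector_field A W Y \<and>
        (\<forall>p\<in>W. X' p = X p \<and> Y' p = Y p) \<longrightarrow> (\<forall>p\<in>W. nab X' Y' p = nab X Y p)) \<and>
     (\<forall>W X Y. open W \<and> vector_field A W X \<and> vector_field A W Y \<longrightarrow>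
        vector_field A W (nab X Y)) \<and>
     (\<forall>W X X' Y h. open W \<and> vector_field A W X \<and> vector_field A W X' \<and> vector_field A W Y \<and>
        smooth_fun A W h \<longrightarrow>
        (\<forall>p\<in>W. nab (\<lambda>q f. h q * X q f + X' q f) Y p = (\<lambda>f. h p * nab X Y p f + nab X' Y p f))) \<and>
     (\<forall>W X Y Y' h. open W \<and> vector_field A W X \<and> vector_field A W Y \<and> vector_field A W Y' \<and>
        smooth_fun A W h \<longrightarrow>
        (\<forall>p\<in>W. nab X (\<lambda>q f. h q * Y q f + Y' q f) p =
          (\<lambda>f. X p h * Y p f + h p * nab X Y p f + nab X Y' p f)))"

definition torsion_free :: "('a::topological_space, 'e::euclidean_space) chart set \<Rightarrow>
    ('a field \<Rightarrow> 'a field \<Rightarrow> 'a field) \<Rightarrow> bool" where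
  "torsion_free A nab \<longleftrightarrow>
     (\<forall>W X Y. open W \<and> vector_field A W X \<and> vector_field A W Y \<longrightarrow>
        (\<forall>p\<in>W. \<forall>f. nab X Y p f - nab Y X p f = lie_bracket A X Y p f))"

definition flat :: "('a::topological_space, 'e::euclidean_space) chart set \<Rightarrow>
    ('a field \<Rightarrow> 'a field \<Rightarrow> 'a field) \<Rightarrow> bool" where
  "flat A nab \<longleftrightarrow>
     (\<forall>W X Y Z. open W \<and> vector_field A W X \<and> vector_field A W Y \<and> vector_field A W Z \<longrightarrow>
        (\<forall>p\<in>W. \<forall>f. nab X (nab Y Z) p f - nab Y (nab X Z) p f
           - nab (lie_bracket A X Y) Z p f = 0))"

definition flat_affine_manifold ::
  "('a::{t2_space,second_countable_topology}, 'e::euclidean_space) chart set \<Rightarrow>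
    ('a field \<Rightarrow> 'a field \<Rightarrow> 'a field) \<Rightarrow> bool" where
  "flat_affine_manifold A nab \<longleftrightarrow>
     smooth_manifold A \<and> connection A nab \<and> torsion_free A nab \<and> flat A nab"

definition preserves_connection :: "('a::topological_space, 'e::euclidean_space) chart set \<Rightarrow>
    ('a field \<Rightarrow> 'a field \<Rightarrow> 'a field) \<Rightarrow> ('a \<Rightarrow> 'a) \<Rightarrow> bool" where
  "preserves_connection A nab F \<longleftrightarrow>
     (\<forall>W X Y. open W \<and> vector_field A W X \<and> vector_field A W Y \<longrightarrow>
        (\<forall>p\<in>W. pushforward A F p (nab X Y p) = nab (push_field A F X) (push_field A F Y) (F p)))"


section \<open>Hessian manifolds\<close>

text \<open>Flat coordinates: all Christoffel symbols vanish.\<close>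

definition flat_chart :: "('a::topological_space, 'e::euclidean_space) chart set \<Rightarrow>
    ('a field \<Rightarrow> 'a field \<Rightarrow> 'a field) \<Rightarrow> ('a, 'e) chart \<Rightarrow> bool" where
  "flat_chart A nab c \<longleftrightarrow> smooth_chart A c \<and>
     (\<forall>i\<in>Basis. \<forall>j\<in>Basis. \<forall>p\<in>fst c.
        nab (coord_field A c i) (coord_field A c j) p = (\<lambda>f. 0))"

definition hessian_manifold ::
  "('a::{t2_space,second_countable_topology}, 'e::euclidean_space) chart set \<Rightarrow>
    ('a field \<Rightarrow> 'a field \<Rightarrow> 'a field) \<Rightarrow> 'a metric \<Rightarrow> bool" where
  "hessian_manifold A nab g \<longleftrightarrow> flat_affine_manifold A nab \<and> riemannian_metric A g \<and>
     (\<forall>p. \<exists>c \<phi>. flat_chart A nab c \<and> p \<in> fst c \<and> smooth_fun A (fst c) \<phi> \<and>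
        (\<forall>q\<in>fst c. \<forall>i\<in>Basis. \<forall>j\<in>Basis.
           g q (coord_field A c i q) (coord_field A c j q) =
           coord_field A c i q (\<lambda>r. coord_field A c j r \<phi>)))"

definition affine_isometry :: "('a::topological_space, 'e::euclidean_space) chart set \<Rightarrow>
    ('a field \<Rightarrow> 'a field \<Rightarrow> 'a field) \<Rightarrow> 'a metric \<Rightarrow> ('a \<Rightarrow> 'a) \<Rightarrow> bool" where
  "affine_isometry A nab g F \<longleftrightarrow>
     diffeomorphism A F \<and> preserves_connection A nab F \<and> preserves_metric A g F"

definition affine_isometry_group :: "('a::topological_space, 'e::euclidean_space) chart set \<Rightarrow>
    ('a field \<Rightarrow> 'a field \<Rightarrow> 'a field) \<Rightarrow> 'a metric \<Rightarrow> ('a \<Rightarrow> 'a) monoid" where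
  "affine_isometry_group A nab g =
     \<lparr>carrier = {F. affine_isometry A nab g F}, mult = (\<circ>), one = id\<rparr>"

definition homogeneous_hessian_manifold ::
  "('a::{t2_space,second_countable_topology}, 'e::euclidean_space) chart set \<Rightarrow>
    ('a field \<Rightarrow> 'a field \<Rightarrow> 'a field) \<Rightarrow> 'a metric \<Rightarrow>
    ('h, 'm) monoid_scheme \<Rightarrow> ('h \<Rightarrow> 'a \<Rightarrow> 'a) \<Rightarrow> bool" where
  "homogeneous_hessian_manifold A nab g H \<phi> \<longleftrightarrow> hessian_manifold A nab g \<and>
     transitive_action H UNIV \<phi> \<and> (\<forall>a\<in>carrier H. affine_isometry A nab g (\<phi> a))"


section \<open>Kaehler manifolds\<close>

text \<open>The model space \<open>'e \<times> 'e\<close> stands for the complexification of \<open>'e\<close>, with \<open>(a, b)\<close> in the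
  role of \<open>a + \<i>b\<close>.  Integrability is expressed by holomorphic charts.\<close>

definition complex_structure ::
  "('a::topological_space, 'e::euclidean_space \<times> 'e) chart set \<Rightarrow>
    ('a \<Rightarrow> 'a tvec \<Rightarrow> 'a tvec) \<Rightarrow> bool" where
  "complex_structure A I \<longleftrightarrow>
     (\<forall>p. \<forall>u\<in>tangent_space A p. I p u \<in> tangent_space A p \<and> I p (I p u) = (\<lambda>f. - u f)) \<and>
     (\<forall>p. \<forall>u\<in>tangent_space A p. \<forall>v\<in>tangent_space A p. \<forall>a b.
        I p (\<lambda>f. a * u f + b * v f) = (\<lambda>f. a * I p u f + b * I p v f)) \<and>
     (\<forall>W X. open W \<and> vector_field A W X \<longrightarrow> vector_field A W (\<lambda>p. I p (X p))) \<and>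
     (\<forall>p. \<exists>c. smooth_chart A c \<and> p \<in> fst c \<and>
        (\<forall>q\<in>fst c. \<forall>a b. I q (coord_field A c (a, b) q) = coord_field A c (- b, a) q))"

definition closed_2form :: "('a::topological_space, 'e::euclidean_space) chart set \<Rightarrow>
    ('a \<Rightarrow> 'a tvec \<Rightarrow> 'a tvec \<Rightarrow> real) \<Rightarrow> bool" where
  "closed_2form A \<omega> \<longleftrightarrow>
     (\<forall>W X Y Z. open W \<and> vector_field A W X \<and> vector_field A W Y \<and> vector_field A W Z \<longrightarrow>
        (\<forall>p\<in>W. X p (\<lambda>q. \<omega> q (Y q) (Z q)) + Y p (\<lambda>q. \<omega> q (Z q) (X q))
           + Z p (\<lambda>q. \<omega> q (X q) (Y q))
           - \<omega> p (lie_bracket A X Y p) (Z p) - \<omega> p (lie_bracket A Y Z p) (X p)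
           - \<omega> p (lie_bracket A Z X p) (Y p) = 0))"

definition kaehler_manifold ::
  "('a::{t2_space,second_countable_topology}, 'e::euclidean_space \<times> 'e) chart set \<Rightarrow>
    ('a \<Rightarrow> 'a tvec \<Rightarrow> 'a tvec) \<Rightarrow> 'a metric \<Rightarrow> bool" where
  "kaehler_manifold A I h \<longleftrightarrow>
     smooth_manifold A \<and> complex_structure A I \<and> riemannian_metric A h \<and>
     (\<forall>p. \<forall>u\<in>tangent_space A p. \<forall>v\<in>tangent_space A p. h p (I p u) (I p v) = h p u v) \<and>
     closed_2form A (\<lambda>p u v. h p (I p u) v)"

definition preserves_complex_structure ::
  "('a::topological_space, 'e::euclidean_space) chart set \<Rightarrow>
    ('a \<Rightarrow> 'a tvec \<Rightarrow> 'a tvec) \<Rightarrow> ('a \<Rightarrow> 'a) \<Rightarrow> bool" where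
  "preserves_complex_structure A I F \<longleftrightarrow>
     (\<forall>p. \<forall>u\<in>tangent_space A p. pushforward A F p (I p u) = I (F p) (pushforward A F p u))"

definition kaehler_automorphism ::
  "('a::topological_space, 'e::euclidean_space) chart set \<Rightarrow>
    ('a \<Rightarrow> 'a tvec \<Rightarrow> 'a tvec) \<Rightarrow> 'a metric \<Rightarrow> ('a \<Rightarrow> 'a) \<Rightarrow> bool" where
  "kaehler_automorphism A I h F \<longleftrightarrow>
     diffeomorphism A F \<and> preserves_complex_structure A I F \<and> preserves_metric A h F"

definition homogeneous_kaehler_manifold ::
  "('a::{t2_space,second_countable_topology}, 'e::euclidean_space \<times> 'e) chart set \<Rightarrow>
    ('a \<Rightarrow> 'a tvec \<Rightarrow> 'a tvec) \<Rightarrow> 'a metric \<Rightarrow>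
    ('h, 'm) monoid_scheme \<Rightarrow> ('h \<Rightarrow> 'a \<Rightarrow> 'a) \<Rightarrow> bool" where
  "homogeneous_kaehler_manifold A I h H \<psi> \<longleftrightarrow> kaehler_manifold A I h \<and>
     transitive_action H UNIV \<psi> \<and> (\<forall>s\<in>carrier H. kaehler_automorphism A I h (\<psi> s))"


section \<open>The development map and the tangent bundle\<close>

text \<open>A local diffeomorphism to the model space that carries the connection to the standard
  one, \<open>d dev (\<nabla>\<^sub>X Y) = X (d dev Y)\<close>.\<close>

definition development_map :: "('a::topological_space, 'e::euclidean_space) chart set \<Rightarrow>
    ('a field \<Rightarrow> 'a field \<Rightarrow> 'a field) \<Rightarrow> ('a \<Rightarrow> 'e) \<Rightarrow> bool" where
  "development_map A nab dev \<longleftrightarrow>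
     (\<forall>p. \<exists>W. p \<in> W \<and> smooth_chart A (W, dev)) \<and>
     (\<forall>W X Y. open W \<and> vector_field A W X \<and> vector_field A W Y \<longrightarrow>
        (\<forall>p\<in>W. vderiv (nab X Y p) dev = vderiv (X p) (\<lambda>q. vderiv (Y q) dev)))"

definition affine_map :: "('e::real_vector \<Rightarrow> 'e) \<Rightarrow> bool" where
  "affine_map f \<longleftrightarrow> (\<exists>L t. linear L \<and> f = (\<lambda>v. L v + t))"

definition linear_part :: "('e::real_vector \<Rightarrow> 'e) \<Rightarrow> 'e \<Rightarrow> 'e" where
  "linear_part f = (\<lambda>w. f w - f 0)"

definition induced_affine_action ::
  "('a \<Rightarrow> 'e::real_vector) \<Rightarrow> ('h \<Rightarrow> 'a \<Rightarrow> 'a) \<Rightarrow> 'h \<Rightarrow> 'e \<Rightarrow> 'e" where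
  "induced_affine_action dev \<phi> a = (THE f. affine_map f \<and> dev \<circ> \<phi> a = f \<circ> dev)"

definition affine_semidirect :: "('h, 'm) monoid_scheme \<Rightarrow> ('h \<Rightarrow> 'e \<Rightarrow> 'e) \<Rightarrow>
    ('h \<times> 'e::real_vector) monoid" where
  "affine_semidirect H \<theta> =
     \<lparr>carrier = carrier H \<times> UNIV,
      mult = (\<lambda>(a, u) (b, w). (a \<otimes>\<^bsub>H\<^esub> b, u + linear_part (\<theta> a) w)),
      one = (\<one>\<^bsub>H\<^esub>, 0)\<rparr>"

definition tangent_bundle :: "('a::topological_space, 'e::euclidean_space) chart set \<Rightarrow>
    ('a \<times> 'a tvec) set" where
  "tangent_bundle A = (SIGMA m:UNIV. tangent_space A m)"

definition trivialization :: "('a \<Rightarrow> 'e::euclidean_space) \<Rightarrow> 'a \<times> 'a tvec \<Rightarrow> 'a \<times> 'e" where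
  "trivialization dev = (\<lambda>(m, w). (m, vderiv w dev))"

text \<open>The smooth structure of the tangent bundle, given by the coordinates \<open>(x, y)\<close> with
  \<open>y\<^sup>i = dx\<^sup>i\<close>, transported to \<open>M \<times> \<real>\<^sup>n\<close> by the trivialization.\<close>

definition TM_atlas :: "('a::topological_space, 'e::euclidean_space) chart set \<Rightarrow> ('a \<Rightarrow> 'e) \<Rightarrow>
    ('a \<times> 'e, 'e \<times> 'e) chart set" where
  "TM_atlas A dev = (\<lambda>(U, x). (U \<times> UNIV,
     (\<lambda>(m, w). (x m, vderiv w x)) \<circ> inv_into (tangent_bundle A) (trivialization dev))) ` A"

text \<open>A tangent vector \<open>\<xi>\<close> of \<open>M \<times> \<real>\<^sup>n\<close> is written as \<open>X \<times> Y\<close>, where \<open>X\<close> is \<open>d dev\<close> of its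
  first component, and \<open>I (X \<times> Y) = (- Y) \<times> X\<close>.\<close>

definition TM_components :: "('a \<Rightarrow> 'e::euclidean_space) \<Rightarrow> ('a \<times> 'e) tvec \<Rightarrow> 'e \<times> 'e" where
  "TM_components dev \<xi> = (vderiv \<xi> (dev \<circ> fst), vderiv \<xi> snd)"

definition TM_complex :: "('a::topological_space, 'e::euclidean_space) chart set \<Rightarrow> ('a \<Rightarrow> 'e) \<Rightarrow>
    'a \<times> 'e \<Rightarrow> ('a \<times> 'e) tvec \<Rightarrow> ('a \<times> 'e) tvec" where
  "TM_complex A dev q \<xi> = (THE \<eta>. \<eta> \<in> tangent_space (TM_atlas A dev) q \<and>
     (\<forall>X Y. TM_components dev \<xi> = (X, Y) \<longrightarrow> TM_components dev \<eta> = (- Y, X)))"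

text \<open>\<open>g\<^sup>r(\<xi>, \<eta>) = (\<pi>\<^sup>* g)(\<xi>, \<eta>) + (\<pi>\<^sup>* g)(I \<xi>, I \<eta>)\<close>\<close>

definition TM_metric :: "('a::topological_space, 'e::euclidean_space) chart set \<Rightarrow> ('a \<Rightarrow> 'e) \<Rightarrow>
    'a metric \<Rightarrow> ('a \<times> 'e) metric" where
  "TM_metric A dev g q \<xi> \<eta> =
     g (fst q) (pushforward A fst q \<xi>) (pushforward A fst q \<eta>) +
     g (fst q) (pushforward A fst q (TM_complex A dev q \<xi>))
               (pushforward A fst q (TM_complex A dev q \<eta>))"

definition TM_action :: "('h \<Rightarrow> 'a \<Rightarrow> 'a) \<Rightarrow> ('h \<Rightarrow> 'e \<Rightarrow> 'e::real_vector) \<Rightarrow>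
    'h \<times> 'e \<Rightarrow> 'a \<times> 'e \<Rightarrow> 'a \<times> 'e" where
  "TM_action \<phi> \<theta> = (\<lambda>(a, u) (m, v). (\<phi> a m, \<theta> a v + u))"

end

(*
  Since dev is a local diffeomorphism, d dev identifies vector fields on M with functions into the
  model space E, and it turns the connection into the ordinary derivative of such functions.  In
  this frame the transition from flat coordinates to dev is affine, so near each point
  g(a, b) = D_a D_b phi for constant a, b in E; as third derivatives commute, D_a g(b, c) is
  symmetric in a, b, c (Codazzi).  The map (m, v) |-> (dev m, v) plays the role of dev on M x E:
  it gives holomorphic charts for I, and in its frame
  g^r(a x b, a' x b') = g(a, a') + g(b, b') with coefficients depending on m only, so that the
  closedness of the Kaehler form is the Codazzi symmetry.

  For an affine isometry F the images of the parallel frame are again parallel; as M is connected,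
  dev o F = L o dev + t with a linear L, and uniqueness of this affine map makes theta an action.
  Conversely an affine F of this form is smooth as soon as it is a homeomorphism.  The lift
  (m, v) |-> (F m, L v + s) has differential L x L in the frame, which commutes with I and
  preserves g^r because L preserves the coefficients of g.
*)

theory Submission
  imports Defs
begin

section \<open>Smooth functions on open sets\<close>

text \<open>The main obstacle is the encoding of tangent vectors as functionals on all functions,
  set to 0 off the functions smooth near the point: no value can be computed before smoothness of
  the argument is known. Each identity is therefore reduced to \<open>der\<close>, a plain
  derivative of vector-valued functions in the chart \<open>dev\<close>, and \<open>tv\<close>
  translates back. Since \<open>dev\<close> need not give charts of the chosen atlas, the basic
  facts are stated for charts of the maximal atlas. The resulting calculus is developed in one
  abstract setting that both the manifold and its tangent bundle satisfy, so it is available for the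
  two without repetition.

  Isometries are replaced by \<open>affine_iso\<close>, which records a linear map, a translation
  and no vector fields. Composites and inverses are then explicit formulas, whereas the original
  definition would require following pushed-forward fields through them. On a connected manifold the
  two notions are equivalent, so the group laws, the action laws and transitivity become
  computations with linear maps.\<close>

lemma frechet_derivative_eq_on_open:
  assumes "open S" "x \<in> S" "\<And>y. y \<in> S \<Longrightarrow> f y = g y"
  shows "frechet_derivative f (at x) = frechet_derivative g (at x)"
proof -
  \<comment> \<open>The Frechet derivative is a choice among the maps \<open>L\<close> with this
    property, so equality of the properties gives equality of the choices even at points without a
    derivative.\<close>
  have "(f has_derivative L) (at x) \<longleftrightarrow> (g has_derivative L) (at x)" for L
    using assms by (metis has_derivative_transform_within_open)
  then show ?thesis by (simp add: frechet_derivative_def)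
qed

lemma differentiable_eq_on_open:
  assumes "open S" "x \<in> S" "\<And>y. y \<in> S \<Longrightarrow> f y = g y"
  shows "f differentiable (at x) \<longleftrightarrow> g differentiable (at x)"
  using assms unfolding differentiable_def by (metis has_derivative_transform_within_open)

lemma Ck_on_cong:
  assumes "open S" "\<And>y. y \<in> S \<Longrightarrow> f y = g y"
  shows "Ck_on k S f \<longleftrightarrow> Ck_on k S g"
  using assms(2)
proof (induction k arbitrary: f g)
  case 0
  then show ?case by (auto intro: continuous_on_eq)
next
  case (Suc k)
  have "Ck_on k S (\<lambda>x. frechet_derivative f (at x) v) \<longleftrightarrow>
      Ck_on k S (\<lambda>x. frechet_derivative g (at x) v)" for v
    using frechet_derivative_eq_on_open[OF assms(1) _ Suc.prems] by (intro Suc.IH) simp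
  then show ?case
    using differentiable_eq_on_open[OF assms(1) _ Suc.prems] by simp
qed

text \<open>\<open>Ck_on\<close> takes derivatives at points of the whole space, not within
  \<open>S\<close>, so each of its conditions can be checked in an open neighbourhood of a single
  point.\<close>

lemma Ck_on_local:
  assumes "\<And>x. x \<in> S \<Longrightarrow> \<exists>T. open T \<and> x \<in> T \<and> Ck_on k T f"
  shows "Ck_on k S f"
  using assms
proof (induction k arbitrary: f)
  case 0
  have "isCont f x" if "x \<in> S" for x
    using 0[OF that] by (auto simp: continuous_on_eq_continuous_at)
  then show ?case by (simp add: continuous_at_imp_continuous_on)
next
  case (Suc k)
  have "Ck_on k S (\<lambda>x. frechet_derivative f (at x) v)" for v
    by (rule Suc.IH) (use Suc.prems in fastforce)
  moreover have "\<forall>x\<in>S. f differentiable (at x)"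
    using Suc.prems by fastforce
  ultimately show ?case by simp
qed

lemma Ck_on_subset: "Ck_on k S f \<Longrightarrow> T \<subseteq> S \<Longrightarrow> Ck_on k T f"
  by (induction k arbitrary: f) (auto intro: continuous_on_subset)

lemma Ck_on_continuous: "Ck_on k S f \<Longrightarrow> continuous_on S f"
  by (cases k)
    (auto intro!: continuous_at_imp_continuous_on dest!: differentiable_imp_continuous_within)

lemma Ck_on_Suc_imp: "Ck_on (Suc k) S f \<Longrightarrow> Ck_on k S f"
  by (induction k arbitrary: f)
    (auto intro!: continuous_at_imp_continuous_on dest!: differentiable_imp_continuous_within)

lemma Ck_on_const: "Ck_on k S (\<lambda>x. c)"
  by (induction k arbitrary: c) auto

text \<open>The derivative is the same map at every point, so all directional derivatives are
  constant functions.\<close>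

lemma Ck_on_bounded_linear: "bounded_linear f \<Longrightarrow> Ck_on k S f"
proof (cases k)
  case (Suc j)
  assume f: "bounded_linear f"
  have "frechet_derivative f (at x) = f" for x
    using frechet_derivative_at[OF bounded_linear_imp_has_derivative[OF f, of "at x"]] by simp
  then show ?thesis
    using Suc f by (simp add: Ck_on_const bounded_linear_imp_differentiable)
qed (simp add: linear_continuous_on)

section \<open>Differentiation rules and the stability of C^k under them\<close>

lemma frechet_derivative_works_at:
  "f differentiable (at x) \<Longrightarrow> (f has_derivative frechet_derivative f (at x)) (at x)"
  by (simp add: frechet_derivative_works)

lemma frechet_derivative_add:
  assumes "f differentiable (at x)" "g differentiable (at x)"
  shows "frechet_derivative (\<lambda>x. f x + g x) (at x) v =
    frechet_derivative f (at x) v + frechet_derivative g (at x) v"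
  by (simp add: frechet_derivative_at[OF has_derivative_add[OF assms[THEN frechet_derivative_works_at]], symmetric])

lemma frechet_derivative_bilinear:
  assumes "bounded_bilinear mul" "f differentiable (at x)" "g differentiable (at x)"
  shows "frechet_derivative (\<lambda>x. mul (f x) (g x)) (at x) v =
    mul (f x) (frechet_derivative g (at x) v) + mul (frechet_derivative f (at x) v) (g x)"
  by (simp add: frechet_derivative_at[OF bounded_bilinear.FDERIV[OF assms(1) assms(2,3)[THEN frechet_derivative_works_at]], symmetric])

lemma frechet_derivative_linear_comp:
  assumes "bounded_linear L" "f differentiable (at x)"
  shows "frechet_derivative (\<lambda>x. L (f x)) (at x) v = L (frechet_derivative f (at x) v)"
  by (simp add: frechet_derivative_at[OF bounded_linear.has_derivative[OF assms(1) assms(2)[THEN frechet_derivative_works_at]], symmetric])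

lemma frechet_derivative_chain:
  assumes "f differentiable (at x)" "g differentiable (at (f x))"
  shows "frechet_derivative (\<lambda>x. g (f x)) (at x) v =
    frechet_derivative g (at (f x)) (frechet_derivative f (at x) v)"
  using frechet_derivative_compose[OF assms] by (simp add: o_def fun_eq_iff)

lemma Ck_on_add:
  assumes "open S" "Ck_on k S f" "Ck_on k S g"
  shows "Ck_on k S (\<lambda>x. f x + g x)"
  using assms(2,3)
proof (induction k arbitrary: f g)
  case (Suc k)
  have "Ck_on k S (\<lambda>x. frechet_derivative (\<lambda>x. f x + g x) (at x) v)" for v
    using Suc.prems
    by (subst Ck_on_cong[OF assms(1), where g = "\<lambda>x. frechet_derivative f (at x) v + frechet_derivative g (at x) v"])
      (auto intro!: Suc.IH simp: frechet_derivative_add)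
  then show ?case using Suc.prems by (auto intro: differentiable_add)
qed (auto intro: continuous_on_add)

text \<open>Each summand of the product rule leaves one factor undifferentiated; that factor is
  lowered by one order so that the induction hypothesis covers both summands.\<close>

lemma Ck_on_bilinear:
  assumes "open S" "bounded_bilinear mul" "Ck_on k S f" "Ck_on k S g"
  shows "Ck_on k S (\<lambda>x. mul (f x) (g x))"
  using assms(3,4)
proof (induction k arbitrary: f g)
  case 0
  then show ?case by (auto intro: bounded_bilinear.continuous_on[OF assms(2)])
next
  case (Suc k)
  have "Ck_on k S (\<lambda>x. frechet_derivative (\<lambda>x. mul (f x) (g x)) (at x) v)" for v
    using Suc.prems Ck_on_Suc_imp[OF Suc.prems(1)] Ck_on_Suc_imp[OF Suc.prems(2)]
    by (subst Ck_on_cong[OF assms(1), where g = "\<lambda>x. mul (f x) (frechet_derivative g (at x) v) + mul (frechet_derivative f (at x) v) (g x)"])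
      (auto intro!: Suc.IH Ck_on_add[OF assms(1)] simp: frechet_derivative_bilinear[OF assms(2)])
  moreover have "(\<lambda>x. mul (f x) (g x)) differentiable (at x)" if "x \<in> S" for x
  proof (rule differentiableI)
    show "((\<lambda>x. mul (f x) (g x)) has_derivative (\<lambda>h. mul (f x) (frechet_derivative g (at x) h) +
        mul (frechet_derivative f (at x) h) (g x))) (at x)"
      using Suc.prems that by (intro bounded_bilinear.FDERIV[OF assms(2)] frechet_derivative_works_at) auto
  qed
  ultimately show ?case by simp
qed

lemma Ck_on_linear_comp:
  assumes "open S" "bounded_linear L" "Ck_on k S f"
  shows "Ck_on k S (\<lambda>x. L (f x))"
  using assms(3)
proof (induction k arbitrary: f)
  case 0
  then show ?case by (auto intro: bounded_linear.continuous_on[OF assms(2)])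
next
  case (Suc k)
  have "Ck_on k S (\<lambda>x. frechet_derivative (\<lambda>x. L (f x)) (at x) v)" for v
    using Suc.prems
    by (subst Ck_on_cong[OF assms(1), where g = "\<lambda>x. L (frechet_derivative f (at x) v)"])
      (auto intro!: Suc.IH simp: frechet_derivative_linear_comp[OF assms(2)])
  moreover have "(\<lambda>x. L (f x)) differentiable (at x)" if "x \<in> S" for x
    by (rule differentiableI, rule bounded_linear.has_derivative[OF assms(2) frechet_derivative_works_at])
      (use Suc.prems that in auto)
  ultimately show ?case by simp
qed

lemma Ck_on_sum:
  assumes "open S" "\<And>i. i \<in> B \<Longrightarrow> Ck_on k S (f i)"
  shows "Ck_on k S (\<lambda>x. \<Sum>i\<in>B. f i x)"
proof (cases "finite B")
  case True
  then show ?thesis using assms(2)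
    by (induction B rule: finite_induct) (auto intro: Ck_on_const Ck_on_add[OF assms(1)])
qed (simp add: Ck_on_const)

lemma linear_Basis_expand:
  fixes f :: "'e::euclidean_space \<Rightarrow> 'b::real_vector"
  assumes "linear f"
  shows "f w = (\<Sum>b\<in>Basis. (w \<bullet> b) *\<^sub>R f b)"
proof -
  have "f w = f (\<Sum>b\<in>Basis. (w \<bullet> b) *\<^sub>R b)" by (simp add: euclidean_representation)
  then show ?thesis by (simp add: linear_sum[OF assms] linear_scale[OF assms])
qed

text \<open>\<open>Ck_on\<close> only speaks of derivatives in fixed directions, while the chain
  rule produces a direction that varies with the point. Expanding it in an orthonormal basis turns
  the derivative into a sum of products to which the induction hypothesis applies; hence the
  Euclidean intermediate space.\<close>

lemma Ck_on_compose:
  fixes f :: "'a::real_normed_vector \<Rightarrow> 'e::euclidean_space"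
  assumes "open S" "open T" "f ` S \<subseteq> T" "Ck_on k S f" "Ck_on k T g"
  shows "Ck_on k S (\<lambda>x. g (f x))"
  using assms(4,5)
proof (induction k arbitrary: g)
  case 0
  then show ?case using assms(3) by (auto intro: continuous_on_compose2)
next
  case (Suc k)
  have d: "f differentiable (at x)" "g differentiable (at (f x))" if "x \<in> S" for x
    using that Suc.prems assms(3) by auto
  have "Ck_on k S (\<lambda>x. \<Sum>b\<in>Basis. (frechet_derivative f (at x) v \<bullet> b) *\<^sub>R
      frechet_derivative g (at (f x)) b)" for v
  proof (intro Ck_on_sum[OF assms(1)] Ck_on_bilinear[OF assms(1) bounded_bilinear_scaleR])
    fix b
    show "Ck_on k S (\<lambda>x. frechet_derivative f (at x) v \<bullet> b)"
      using Suc.prems(1) by (intro Ck_on_linear_comp[OF assms(1) bounded_linear_inner_left]) simp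
    show "Ck_on k S (\<lambda>x. frechet_derivative g (at (f x)) b)"
      using Suc.prems Ck_on_Suc_imp by (intro Suc.IH) auto
  qed
  then have "Ck_on k S (\<lambda>x. frechet_derivative (\<lambda>x. g (f x)) (at x) v)" for v
    by (rule Ck_on_cong[OF assms(1), THEN iffD1, rotated])
      (simp add: frechet_derivative_chain[OF d] linear_Basis_expand[OF linear_frechet_derivative[OF d(2)], symmetric])
  moreover have "(\<lambda>x. g (f x)) differentiable (at x)" if "x \<in> S" for x
    using differentiable_chain_at[OF d[OF that]] by (simp add: o_def)
  ultimately show ?case by simp
qed

lemma smooth_on_cong:
  assumes "open S" "\<And>y. y \<in> S \<Longrightarrow> f y = g y"
  shows "smooth_on S f \<longleftrightarrow> smooth_on S g"
  unfolding smooth_on_def using Ck_on_cong[OF assms(1), of f g] assms(2) by simp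

lemma smooth_on_local:
  assumes "\<And>x. x \<in> S \<Longrightarrow> \<exists>T. open T \<and> x \<in> T \<and> smooth_on T f"
  shows "smooth_on S f"
  unfolding smooth_on_def
proof
  fix k
  show "Ck_on k S f"
    by (rule Ck_on_local) (use assms in \<open>auto simp: smooth_on_def\<close>)
qed

lemma smooth_on_subset: "smooth_on S f \<Longrightarrow> T \<subseteq> S \<Longrightarrow> smooth_on T f"
  unfolding smooth_on_def by (meson Ck_on_subset)

lemma smooth_on_continuous: "smooth_on S f \<Longrightarrow> continuous_on S f"
  unfolding smooth_on_def by (meson Ck_on_continuous)

lemma smooth_on_differentiable: "smooth_on S f \<Longrightarrow> x \<in> S \<Longrightarrow> f differentiable (at x)"
  unfolding smooth_on_def by (meson Ck_on.simps(2))

lemma smooth_on_frechet_derivative: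
  "smooth_on S f \<Longrightarrow> smooth_on S (\<lambda>x. frechet_derivative f (at x) v)"
  unfolding smooth_on_def by (metis Ck_on.simps(2))

lemma smooth_on_const: "smooth_on S (\<lambda>x. c)"
  by (simp add: smooth_on_def Ck_on_const)

lemma smooth_on_bounded_linear: "bounded_linear f \<Longrightarrow> smooth_on S f"
  by (simp add: smooth_on_def Ck_on_bounded_linear)

lemma smooth_on_add:
  "open S \<Longrightarrow> smooth_on S f \<Longrightarrow> smooth_on S g \<Longrightarrow> smooth_on S (\<lambda>x. f x + g x)"
  by (simp add: smooth_on_def Ck_on_add)

lemma smooth_on_bilinear:
  "open S \<Longrightarrow> bounded_bilinear mul \<Longrightarrow> smooth_on S f \<Longrightarrow> smooth_on S g \<Longrightarrow>
    smooth_on S (\<lambda>x. mul (f x) (g x))"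
  by (simp add: smooth_on_def Ck_on_bilinear)

lemma smooth_on_linear_comp:
  "open S \<Longrightarrow> bounded_linear L \<Longrightarrow> smooth_on S f \<Longrightarrow> smooth_on S (\<lambda>x. L (f x))"
  by (simp add: smooth_on_def Ck_on_linear_comp)

lemma smooth_on_sum:
  "open S \<Longrightarrow> (\<And>i. i \<in> B \<Longrightarrow> smooth_on S (f i)) \<Longrightarrow> smooth_on S (\<lambda>x. \<Sum>i\<in>B. f i x)"
  by (simp add: smooth_on_def Ck_on_sum)

lemma smooth_on_compose:
  fixes f :: "'a::real_normed_vector \<Rightarrow> 'e::euclidean_space"
  shows "open S \<Longrightarrow> open T \<Longrightarrow> f ` S \<subseteq> T \<Longrightarrow> smooth_on S f \<Longrightarrow> smooth_on T g \<Longrightarrow>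
    smooth_on S (\<lambda>x. g (f x))"
  by (simp add: smooth_on_def Ck_on_compose)

lemma smooth_on_Pair:
  assumes "open S" "smooth_on S f" "smooth_on S g"
  shows "smooth_on S (\<lambda>x. (f x, g x))"
proof -
  have "smooth_on S (\<lambda>x. (f x, 0) + (0, g x))"
    by (intro smooth_on_add assms(1)
        smooth_on_linear_comp[OF assms(1) bounded_linear_Pair[OF bounded_linear_ident bounded_linear_zero] assms(2)]
        smooth_on_linear_comp[OF assms(1) bounded_linear_Pair[OF bounded_linear_zero bounded_linear_ident] assms(3)])
  then show ?thesis by simp
qed

text \<open>Linearity in the second variable reduces joint smoothness to the finitely many basis
  directions. This is the fibre part of the transition maps of a tangent bundle.\<close>

lemma smooth_on_tangent_map:
  fixes f :: "'e::euclidean_space \<Rightarrow> 'b::real_normed_vector"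
  assumes "open S" "smooth_on S f"
  shows "smooth_on (S \<times> UNIV) (\<lambda>z. frechet_derivative f (at (fst z)) (snd z))"
proof -
  have o: "open (S \<times> (UNIV :: 'e set))" by (simp add: assms(1) open_Times)
  have "smooth_on (S \<times> UNIV) (\<lambda>z. \<Sum>b\<in>Basis. (snd z \<bullet> b) *\<^sub>R frechet_derivative f (at (fst z)) b)"
  proof (intro smooth_on_sum[OF o] smooth_on_bilinear[OF o bounded_bilinear_scaleR])
    fix b
    show "smooth_on (S \<times> UNIV) (\<lambda>z :: 'e \<times> 'e. snd z \<bullet> b)"
      by (intro smooth_on_bounded_linear bounded_linear_inner_left_comp bounded_linear_snd)
    show "smooth_on (S \<times> UNIV) (\<lambda>z :: 'e \<times> 'e. frechet_derivative f (at (fst z)) b)"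
      by (rule smooth_on_compose[OF o assms(1) _ smooth_on_bounded_linear[OF bounded_linear_fst]
            smooth_on_frechet_derivative[OF assms(2)]]) auto
  qed
  then show ?thesis
    by (rule smooth_on_cong[OF o, THEN iffD1, rotated])
      (auto intro!: linear_Basis_expand[symmetric] linear_frechet_derivative
        smooth_on_differentiable[OF assms(2)])
qed

section \<open>Symmetry of second derivatives\<close>

lemma has_derivative_along_line:
  assumes "f differentiable (at (x + t *\<^sub>R u))"
  shows "((\<lambda>t. f (x + t *\<^sub>R u)) has_vector_derivative frechet_derivative f (at (x + t *\<^sub>R u)) u) (at t)"
proof -
  have "((\<lambda>t. x + t *\<^sub>R u) has_derivative (\<lambda>h. h *\<^sub>R u)) (at t)"
    by (auto intro!: derivative_eq_intros)
  from diff_chain_at[OF this frechet_derivative_works_at[OF assms]]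
  show ?thesis
    using linear_scale[OF linear_frechet_derivative[OF assms]]
    by (simp add: o_def has_vector_derivative_def)
qed

text \<open>Two applications of the mean value theorem: along \<open>u\<close> to the increment of
  \<open>f\<close> in direction \<open>v\<close>, then along \<open>v\<close> to the derivative of
  \<open>f\<close> in direction \<open>u\<close>.\<close>

lemma second_difference:
  fixes f :: "'a::real_normed_vector \<Rightarrow> real"
  assumes "open S" "smooth_on S f" "h > 0"
    and sub: "\<And>s t. 0 \<le> s \<Longrightarrow> s \<le> h \<Longrightarrow> 0 \<le> t \<Longrightarrow> t \<le> h \<Longrightarrow> x + s *\<^sub>R u + t *\<^sub>R v \<in> S"
  shows "\<exists>s t. 0 \<le> s \<and> s \<le> h \<and> 0 \<le> t \<and> t \<le> h \<and>
    f (x + h *\<^sub>R u + h *\<^sub>R v) - f (x + h *\<^sub>R u) - f (x + h *\<^sub>R v) + f x =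
    h * h * frechet_derivative (\<lambda>y. frechet_derivative f (at y) u) (at (x + s *\<^sub>R u + t *\<^sub>R v)) v"
proof -
  let ?fu = "\<lambda>y. frechet_derivative f (at y) u"
  have sm: "smooth_on S ?fu" by (rule smooth_on_frechet_derivative[OF assms(2)])
  define \<phi> where "\<phi> s = f (x + h *\<^sub>R v + s *\<^sub>R u) - f (x + s *\<^sub>R u)" for s
  have "DERIV \<phi> s :> ?fu (x + h *\<^sub>R v + s *\<^sub>R u) - ?fu (x + s *\<^sub>R u)" if "0 \<le> s" "s \<le> h" for s
  proof -
    have "x + s *\<^sub>R u \<in> S" "x + h *\<^sub>R v + s *\<^sub>R u \<in> S"
      using sub[OF that, of 0] sub[OF that, of h] assms(3) by (auto simp: algebra_simps)
    then show ?thesis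
      unfolding \<phi>_def has_real_derivative_iff_has_vector_derivative
      by (intro has_vector_derivative_diff has_derivative_along_line smooth_on_differentiable[OF assms(2)])
  qed
  from MVT2[OF assms(3) this] obtain s where s: "0 < s" "s < h"
    "\<phi> h - \<phi> 0 = h * (?fu (x + h *\<^sub>R v + s *\<^sub>R u) - ?fu (x + s *\<^sub>R u))" by auto
  define \<eta> where "\<eta> t = ?fu (x + s *\<^sub>R u + t *\<^sub>R v)" for t
  have "DERIV \<eta> t :> frechet_derivative ?fu (at (x + s *\<^sub>R u + t *\<^sub>R v)) v" if "0 \<le> t" "t \<le> h" for t
    unfolding \<eta>_def has_real_derivative_iff_has_vector_derivative
    using s that by (intro has_derivative_along_line smooth_on_differentiable[OF sm] sub) auto
  from MVT2[OF assms(3) this] obtain t where t: "0 < t" "t < h"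
    "\<eta> h - \<eta> 0 = h * frechet_derivative ?fu (at (x + s *\<^sub>R u + t *\<^sub>R v)) v" by auto
  have "\<phi> h - \<phi> 0 = h * (\<eta> h - \<eta> 0)"
    using s(3) by (simp add: \<eta>_def algebra_simps)
  then show ?thesis
    using s(1,2) t by (intro exI[of _ s] exI[of _ t]) (simp add: \<phi>_def algebra_simps)
qed

text \<open>The second difference does not change when \<open>u\<close> and \<open>v\<close> are
  exchanged, so the two mixed derivatives agree at points of a small parallelogram at
  \<open>x\<close>, though at different ones. Their continuity brings both points to
  \<open>x\<close>.\<close>

lemma second_derivative_symmetric:
  fixes f :: "'a::real_normed_vector \<Rightarrow> real"
  assumes "open S" "smooth_on S f" "x \<in> S"
  shows "frechet_derivative (\<lambda>y. frechet_derivative f (at y) u) (at x) v =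
    frechet_derivative (\<lambda>y. frechet_derivative f (at y) v) (at x) u"
proof -
  define D where "D u v y = frechet_derivative (\<lambda>y. frechet_derivative f (at y) u) (at y) v" for u v y
  have "smooth_on S (D u v)" for u v
    unfolding D_def by (intro smooth_on_frechet_derivative assms(2))
  then have cont: "isCont (D u v) x" for u v
    using smooth_on_continuous assms(1,3) by (metis continuous_on_eq_continuous_at)
  have "\<bar>D u v x - D v u x\<bar> \<le> e" if "e > 0" for e
  proof -
    have "\<forall>\<^sub>F y in nhds x. \<bar>D u v y - D u v x\<bar> < e / 2 \<and> \<bar>D v u y - D v u x\<bar> < e / 2 \<and> y \<in> S"
      using tendstoD[OF cont[of u v, unfolded isCont_def tendsto_at_iff_tendsto_nhds], of "e / 2"]
        tendstoD[OF cont[of v u, unfolded isCont_def tendsto_at_iff_tendsto_nhds], of "e / 2"]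
        eventually_nhds_in_open[OF assms(1,3)] that
      by (simp add: dist_real_def eventually_conj_iff)
    then obtain r where r: "r > 0" "\<And>y. dist y x < r \<Longrightarrow>
        \<bar>D u v y - D u v x\<bar> < e / 2 \<and> \<bar>D v u y - D v u x\<bar> < e / 2 \<and> y \<in> S"
      by (auto simp: eventually_nhds_metric)
    \<comment> \<open>The parallelogram with sides \<open>h u\<close> and \<open>h v\<close> then
      lies in the ball of radius \<open>r\<close>; the summand 1 keeps the denominator positive and
      the inequality strict.\<close>
    define h where "h = r / (norm u + norm v + 1)"
    have h: "h > 0" using r(1) by (simp add: h_def add_nonneg_pos)
    have n: "h * (norm u + norm v + 1) = r"
      by (simp add: h_def) (metis add_nonneg_nonneg less_numeral_extra(3) norm_ge_zero add_nonneg_pos zero_less_one)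
    \<comment> \<open>The condition on the norms lets one estimate serve both orders of
      \<open>u\<close> and \<open>v\<close>.\<close>
    have near: "dist (x + s *\<^sub>R a + t *\<^sub>R b) x < r"
      if "0 \<le> s" "s \<le> h" "0 \<le> t" "t \<le> h" "norm a + norm b = norm u + norm v" for s t a b
    proof -
      have "norm (s *\<^sub>R a + t *\<^sub>R b) \<le> s * norm a + t * norm b"
        using that by (intro norm_triangle_le) simp
      also have "\<dots> \<le> h * norm a + h * norm b"
        using that by (intro add_mono mult_right_mono) auto
      also have "\<dots> = h * (norm u + norm v)" using that(5) by (simp flip: distrib_left)
      also have "\<dots> < r" using n h by (simp add: algebra_simps)
      finally show ?thesis by (simp add: dist_norm add.assoc)
    qed
    have nc: "norm v + norm u = norm u + norm v" by simp
    have "\<exists>s t. 0 \<le> s \<and> s \<le> h \<and> 0 \<le> t \<and> t \<le> h \<and>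
        f (x + h *\<^sub>R u + h *\<^sub>R v) - f (x + h *\<^sub>R u) - f (x + h *\<^sub>R v) + f x =
        h * h * D u v (x + s *\<^sub>R u + t *\<^sub>R v)"
      unfolding D_def
      by (rule second_difference[OF assms(1,2) h]) (use near[of _ _ u v] r(2) in blast)
    then obtain s t where st: "0 \<le> s" "s \<le> h" "0 \<le> t" "t \<le> h"
        "f (x + h *\<^sub>R u + h *\<^sub>R v) - f (x + h *\<^sub>R u) - f (x + h *\<^sub>R v) + f x =
        h * h * D u v (x + s *\<^sub>R u + t *\<^sub>R v)" by blast
    have "\<exists>s t. 0 \<le> s \<and> s \<le> h \<and> 0 \<le> t \<and> t \<le> h \<and>
        f (x + h *\<^sub>R v + h *\<^sub>R u) - f (x + h *\<^sub>R v) - f (x + h *\<^sub>R u) + f x =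
        h * h * D v u (x + s *\<^sub>R v + t *\<^sub>R u)"
      unfolding D_def
      by (rule second_difference[OF assms(1,2) h]) (use near[of _ _ v u] r(2) nc in blast)
    then obtain s' t' where st': "0 \<le> s'" "s' \<le> h" "0 \<le> t'" "t' \<le> h"
        "f (x + h *\<^sub>R v + h *\<^sub>R u) - f (x + h *\<^sub>R v) - f (x + h *\<^sub>R u) + f x =
        h * h * D v u (x + s' *\<^sub>R v + t' *\<^sub>R u)" by blast
    have comm: "x + h *\<^sub>R u + h *\<^sub>R v = x + h *\<^sub>R v + h *\<^sub>R u" by (simp add: algebra_simps)
    then have "h * h * D u v (x + s *\<^sub>R u + t *\<^sub>R v) = h * h * D v u (x + s' *\<^sub>R v + t' *\<^sub>R u)"
      using st(5) st'(5)[folded comm] by linarith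
    then have "D u v (x + s *\<^sub>R u + t *\<^sub>R v) = D v u (x + s' *\<^sub>R v + t' *\<^sub>R u)"
      using h by simp
    moreover have "\<bar>D u v (x + s *\<^sub>R u + t *\<^sub>R v) - D u v x\<bar> < e / 2"
      "\<bar>D v u (x + s' *\<^sub>R v + t' *\<^sub>R u) - D v u x\<bar> < e / 2"
      using r(2)[OF near[OF st(1-4)]] r(2)[OF near[OF st'(1-4) nc]] by auto
    ultimately show ?thesis by linarith
  qed
  then have "\<bar>D u v x - D v u x\<bar> \<le> 0" by (rule field_le_epsilon[where y = 0, simplified]) auto
  then show ?thesis by (simp add: D_def)
qed

lemma zero_derivative_imp_constant_on_ball:
  fixes f :: "'a::real_normed_vector \<Rightarrow> 'b::real_normed_vector"
  assumes "\<And>y. y \<in> ball x r \<Longrightarrow> f differentiable (at y)"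
    and "\<And>y v. y \<in> ball x r \<Longrightarrow> frechet_derivative f (at y) v = 0"
    and "y \<in> ball x r"
  shows "f y = f x"
proof (rule has_derivative_zero_unique[OF convex_ball _ assms(3)])
  show "x \<in> ball x r" using assms(3) by (auto intro: le_less_trans[OF zero_le_dist])
  fix z assume z: "z \<in> ball x r"
  then have "frechet_derivative f (at z) = (\<lambda>h. 0)" using assms(2) by auto
  then show "(f has_derivative (\<lambda>h. 0)) (at z within ball x r)"
    using frechet_derivative_works_at[OF assms(1)[OF z]] has_derivative_at_withinI by metis
qed

section \<open>Charts and smooth functions\<close>

lemma is_chartD:
  assumes "is_chart c"
  shows "open (fst c)" "continuous_on (fst c) (snd c)"
    "continuous_on (snd c ` fst c) (chart_inv c)" "inj_on (snd c) (fst c)"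
  using assms unfolding is_chart_def homeomorphism_def by (auto intro: inj_on_inverseI[of _ "chart_inv c"])

lemma chart_inv_chart: "is_chart c \<Longrightarrow> p \<in> fst c \<Longrightarrow> chart_inv c (snd c p) = p"
  by (simp add: is_chartD(4))

lemma chart_image_open:
  assumes "is_chart c" "open W"
  shows "open (snd c ` (fst c \<inter> W))"
proof -
  have "snd c ` (fst c \<inter> W) = snd c ` fst c \<inter> chart_inv c -` W"
    using chart_inv_chart[OF assms(1)] by auto
  moreover have "open (snd c ` fst c)" using assms(1) by (simp add: is_chart_def)
  ultimately show ?thesis
    using continuous_open_preimage[OF is_chartD(3)[OF assms(1)] _ assms(2)] by simp
qed

text \<open>Allows the inverse of a chart to be given by a formula \<open>h\<close> in place of
  \<open>inv_into\<close>, as is needed for charts of the tangent bundle.\<close>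

lemma is_chartI:
  assumes "open U" "open (x ` U)" "continuous_on U x" "continuous_on (x ` U) h"
    and "\<And>p. p \<in> U \<Longrightarrow> h (x p) = p"
  shows "is_chart (U, x)"
proof -
  have inj: "inj_on x U" using assms(5) by (rule inj_on_inverseI)
  have "continuous_on (x ` U) (inv_into U x)"
    using assms(5) inj by (intro continuous_on_eq[OF assms(4)]) auto
  then show ?thesis
    using assms inj by (auto simp: is_chart_def homeomorphism_def)
qed

lemma smooth_near_open:
  assumes "smooth_near A p f"
  obtains W where "open W" "p \<in> W" "\<forall>q\<in>W. smooth_near A q f"
  using assms unfolding smooth_near_def by blast

locale smooth_mfd =
  fixes A :: "('a::{t2_space,second_countable_topology}, 'e::euclidean_space) chart set"
  assumes mfd: "smooth_manifold A"
begin

lemma atlas_is_chart: "c \<in> A \<Longrightarrow> is_chart c"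
  using mfd by (simp add: smooth_manifold_def)

lemma atlas_cover: obtains c where "c \<in> A" "p \<in> fst c"
  using mfd unfolding smooth_manifold_def by blast

lemma atlas_smooth_chart: "c \<in> A \<Longrightarrow> smooth_chart A c"
  using mfd by (simp add: smooth_manifold_def smooth_chart_def)

lemma smooth_chart_is_chart: "smooth_chart A c \<Longrightarrow> is_chart c"
  by (simp add: smooth_chart_def)

lemma smooth_on_chart_change_atlas:
  assumes "smooth_chart A c" "d \<in> A"
  shows "smooth_on (snd c ` (fst c \<inter> fst d)) (snd d \<circ> chart_inv c)"
    "smooth_on (snd d ` (fst d \<inter> fst c)) (snd c \<circ> chart_inv d)"
  using assms by (auto simp: smooth_chart_def compatible_def Int_commute)

text \<open>Smoothness near a point refers to all charts of the atlas. One chart of the maximal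
  atlas suffices once the neighbourhood is cut down to its domain, where smooth transition maps lead
  to every other chart.\<close>

lemma smooth_near_chartI:
  assumes c: "smooth_chart A c" and "p \<in> fst c" "open W" "p \<in> W"
    and f: "smooth_on (snd c ` (fst c \<inter> W)) (f \<circ> chart_inv c)"
  shows "smooth_near A p f"
  unfolding smooth_near_def smooth_fun_def
proof (intro exI conjI ballI)
  note ic = smooth_chart_is_chart[OF c]
  show "open (fst c \<inter> W)" using is_chartD(1)[OF ic] assms(3) by blast
  show "p \<in> fst c \<inter> W" using assms by simp
  fix d assume d: "d \<in> A"
  note id = atlas_is_chart[OF d]
  have o: "open (snd d ` (fst d \<inter> (fst c \<inter> W)))"
    using chart_image_open[OF id] is_chartD(1)[OF ic] assms(3) by blast
  have "smooth_on (snd d ` (fst d \<inter> (fst c \<inter> W))) (\<lambda>y. (f \<circ> chart_inv c) ((snd c \<circ> chart_inv d) y))"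
  proof (rule smooth_on_compose[OF o chart_image_open[OF ic assms(3)] _ _ f])
    show "(snd c \<circ> chart_inv d) ` snd d ` (fst d \<inter> (fst c \<inter> W)) \<subseteq> snd c ` (fst c \<inter> W)"
      using chart_inv_chart[OF id] by auto
    show "smooth_on (snd d ` (fst d \<inter> (fst c \<inter> W))) (snd c \<circ> chart_inv d)"
      by (rule smooth_on_subset[OF smooth_on_chart_change_atlas(2)[OF c d]]) auto
  qed
  then show "smooth_on (snd d ` (fst d \<inter> (fst c \<inter> W))) (f \<circ> chart_inv d)"
    by (rule smooth_on_cong[OF o, THEN iffD1, rotated])
      (auto simp: chart_inv_chart[OF id] chart_inv_chart[OF ic])
qed

text \<open>The converse transfer, through an atlas chart \<open>d\<close> around \<open>p\<close>.
  Together they permit computing in any chart of the maximal atlas.\<close>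

lemma smooth_near_chartD:
  assumes f: "smooth_near A p f" and c: "smooth_chart A c" "p \<in> fst c"
  obtains W where "open W" "p \<in> W" "W \<subseteq> fst c" "smooth_on (snd c ` W) (f \<circ> chart_inv c)"
proof -
  obtain W where W: "open W" "p \<in> W" "smooth_fun A W f" using f unfolding smooth_near_def by blast
  obtain d where d: "d \<in> A" "p \<in> fst d" by (rule atlas_cover)
  note ic = smooth_chart_is_chart[OF c(1)] and id = atlas_is_chart[OF d(1)]
  let ?W = "fst c \<inter> (fst d \<inter> W)"
  have oW: "open (fst d \<inter> W)" "open ?W" using W(1) is_chartD(1)[OF ic] is_chartD(1)[OF id] by auto
  have o: "open (snd c ` ?W)" using chart_image_open[OF ic oW(1)] .
  have "smooth_on (snd c ` ?W) (\<lambda>y. (f \<circ> chart_inv d) ((snd d \<circ> chart_inv c) y))"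
  proof (rule smooth_on_compose[OF o chart_image_open[OF id W(1)]])
    show "(snd d \<circ> chart_inv c) ` snd c ` ?W \<subseteq> snd d ` (fst d \<inter> W)"
      using chart_inv_chart[OF ic] by auto
    show "smooth_on (snd c ` ?W) (snd d \<circ> chart_inv c)"
      by (rule smooth_on_subset[OF smooth_on_chart_change_atlas(1)[OF c(1) d(1)]]) auto
    show "smooth_on (snd d ` (fst d \<inter> W)) (f \<circ> chart_inv d)"
      using W(3) d(1) by (simp add: smooth_fun_def)
  qed
  then have "smooth_on (snd c ` ?W) (f \<circ> chart_inv c)"
    by (rule smooth_on_cong[OF o, THEN iffD1, rotated])
      (auto simp: chart_inv_chart[OF id] chart_inv_chart[OF ic])
  then show thesis using that[of ?W] oW W(2) c(2) d(2) by auto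
qed

lemma smooth_fun_near: "smooth_fun A W f \<Longrightarrow> open W \<Longrightarrow> p \<in> W \<Longrightarrow> smooth_near A p f"
  by (auto simp: smooth_near_def)

lemma smooth_near_imp_smooth_on:
  assumes "smooth_chart A c" "\<And>p. p \<in> fst c \<inter> W \<Longrightarrow> smooth_near A p f"
  shows "smooth_on (snd c ` (fst c \<inter> W)) (f \<circ> chart_inv c)"
proof (rule smooth_on_local)
  note ic = smooth_chart_is_chart[OF assms(1)]
  fix y assume "y \<in> snd c ` (fst c \<inter> W)"
  then obtain p where p: "p \<in> fst c" "p \<in> W" "y = snd c p" by auto
  obtain V where V: "open V" "p \<in> V" "V \<subseteq> fst c" "smooth_on (snd c ` V) (f \<circ> chart_inv c)"
    using smooth_near_chartD[OF assms(2) assms(1)] p by blast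
  have "open (snd c ` V)" using chart_image_open[OF ic V(1)] V(3) by (simp add: Int_absorb1)
  then show "\<exists>T. open T \<and> y \<in> T \<and> smooth_on T (f \<circ> chart_inv c)" using V p by blast
qed

lemma smooth_funI: "(\<And>p. p \<in> W \<Longrightarrow> smooth_near A p f) \<Longrightarrow> smooth_fun A W f"
  unfolding smooth_fun_def using smooth_near_imp_smooth_on atlas_smooth_chart by blast

lemma smooth_near_cong:
  assumes "smooth_near A p f" "open W" "p \<in> W" "\<And>q. q \<in> W \<Longrightarrow> f q = h q"
  shows "smooth_near A p h"
proof -
  obtain c where c: "c \<in> A" "p \<in> fst c" by (rule atlas_cover)
  note sc = atlas_smooth_chart[OF c(1)] and ic = atlas_is_chart[OF c(1)]
  obtain V where V: "open V" "p \<in> V" "V \<subseteq> fst c" "smooth_on (snd c ` V) (f \<circ> chart_inv c)"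
    by (rule smooth_near_chartD[OF assms(1) sc c(2)])
  have o: "open (V \<inter> W)" using V(1) assms(2) by blast
  have "smooth_on (snd c ` (fst c \<inter> (V \<inter> W))) (f \<circ> chart_inv c)"
    by (rule smooth_on_subset[OF V(4)]) auto
  then have "smooth_on (snd c ` (fst c \<inter> (V \<inter> W))) (h \<circ> chart_inv c)"
    by (rule smooth_on_cong[OF chart_image_open[OF ic o], THEN iffD1, rotated])
      (auto simp: chart_inv_chart[OF ic] assms(4))
  then show ?thesis using smooth_near_chartI[OF sc c(2) o] V(2) assms(3) by blast
qed

lemma smooth_near_chart:
  assumes "smooth_chart A c" "p \<in> fst c"
  shows "smooth_near A p (snd c)"
proof -
  note ic = smooth_chart_is_chart[OF assms(1)]
  have "smooth_on (snd c ` (fst c \<inter> UNIV)) (\<lambda>y. y)"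
    by (simp add: smooth_on_bounded_linear bounded_linear_ident)
  then have "smooth_on (snd c ` (fst c \<inter> UNIV)) (snd c \<circ> chart_inv c)"
    by (rule smooth_on_cong[OF chart_image_open[OF ic open_UNIV], THEN iffD1, rotated])
      (auto simp: chart_inv_chart[OF ic])
  then show ?thesis using smooth_near_chartI[OF assms open_UNIV] by simp
qed

lemma smooth_near_differentiable:
  assumes "smooth_near A p f" "smooth_chart A c" "p \<in> fst c"
  shows "(f \<circ> chart_inv c) differentiable (at (snd c p))"
  using smooth_near_chartD[OF assms] smooth_on_differentiable by (metis imageI)

section \<open>Tangent vectors under a change of chart\<close>

lemma chart_derivative_change:
  assumes f: "smooth_near A p f" and c: "smooth_chart A c" "p \<in> fst c"
    and d: "smooth_chart A d" "p \<in> fst d"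
  shows "frechet_derivative (f \<circ> chart_inv c) (at (snd c p)) u =
    frechet_derivative (f \<circ> chart_inv d) (at (snd d p))
      (frechet_derivative (snd d \<circ> chart_inv c) (at (snd c p)) u)"
proof -
  note ic = smooth_chart_is_chart[OF c(1)] and id = smooth_chart_is_chart[OF d(1)]
  have o: "open (snd c ` (fst c \<inter> fst d))" by (rule chart_image_open[OF ic is_chartD(1)[OF id]])
  have p: "snd c p \<in> snd c ` (fst c \<inter> fst d)" using c d by auto
  have "frechet_derivative (f \<circ> chart_inv c) (at (snd c p)) u =
      frechet_derivative (\<lambda>y. (f \<circ> chart_inv d) ((snd d \<circ> chart_inv c) y)) (at (snd c p)) u"
    by (rule fun_cong[OF frechet_derivative_eq_on_open[OF o p]])
      (auto simp: chart_inv_chart[OF ic] chart_inv_chart[OF id])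
  also have "\<dots> = frechet_derivative (f \<circ> chart_inv d) (at ((snd d \<circ> chart_inv c) (snd c p)))
      (frechet_derivative (snd d \<circ> chart_inv c) (at (snd c p)) u)"
    by (rule frechet_derivative_chain)
      (use smooth_near_differentiable[OF smooth_near_chart[OF d] c]
        smooth_near_differentiable[OF f d] in \<open>simp_all add: o_def chart_inv_chart[OF ic c(2)]\<close>)
  finally show ?thesis by (simp add: chart_inv_chart[OF ic c(2)])
qed

text \<open>The chain rule settles functions smooth near \<open>p\<close>; on all others both sides
  take the default value 0, so the functionals are equal without restriction.\<close>

lemma coord_field_change:
  assumes "smooth_chart A c" "p \<in> fst c" "smooth_chart A d" "p \<in> fst d"
  shows "coord_field A c u p =
    coord_field A d (frechet_derivative (snd d \<circ> chart_inv c) (at (snd c p)) u) p"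
  by (simp add: coord_field_def chart_derivative_change[OF _ assms] cong: if_cong)

lemma chart_derivative_self:
  assumes "smooth_chart A c" "p \<in> fst c"
  shows "frechet_derivative (snd c \<circ> chart_inv c) (at (snd c p)) u = u"
proof -
  note ic = smooth_chart_is_chart[OF assms(1)]
  have "frechet_derivative (snd c \<circ> chart_inv c) (at (snd c p)) u =
      frechet_derivative (\<lambda>y. y) (at (snd c p)) u"
    by (rule fun_cong[OF frechet_derivative_eq_on_open[OF chart_image_open[OF ic open_UNIV]]])
      (use assms(2) in \<open>auto simp: chart_inv_chart[OF ic]\<close>)
  then show ?thesis by simp
qed

text \<open>The definition uses only charts of the atlas; a change of chart in each direction
  extends it to the maximal atlas, and a single chart already yields the whole space.\<close>

lemma tangent_space_chart:
  assumes c: "smooth_chart A c" "p \<in> fst c"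
  shows "tangent_space A p = range (\<lambda>u. coord_field A c u p)"
proof
  show "tangent_space A p \<subseteq> range (\<lambda>u. coord_field A c u p)"
    unfolding tangent_space_def using coord_field_change[OF atlas_smooth_chart _ c] by auto
  obtain d where d: "d \<in> A" "p \<in> fst d" by (rule atlas_cover)
  show "range (\<lambda>u. coord_field A c u p) \<subseteq> tangent_space A p"
    unfolding tangent_space_def using coord_field_change[OF c atlas_smooth_chart d(2)] d by blast
qed

section \<open>Algebra of functions smooth near a point\<close>

lemma smooth_near_linear:
  assumes "bounded_linear L" "smooth_near A p f"
  shows "smooth_near A p (\<lambda>q. L (f q))"
proof -
  obtain c where c: "c \<in> A" "p \<in> fst c" by (rule atlas_cover)
  note sc = atlas_smooth_chart[OF c(1)] and ic = atlas_is_chart[OF c(1)]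
  obtain V where V: "open V" "p \<in> V" "V \<subseteq> fst c" "smooth_on (snd c ` V) (f \<circ> chart_inv c)"
    by (rule smooth_near_chartD[OF assms(2) sc c(2)])
  have e: "fst c \<inter> V = V" using V(3) by blast
  from smooth_on_linear_comp[OF chart_image_open[OF ic V(1), unfolded e] assms(1) V(4)]
  show ?thesis using smooth_near_chartI[OF sc c(2) V(1,2), of "\<lambda>q. L (f q)"] by (simp add: e o_def)
qed

lemma smooth_near_bilinear:
  assumes "bounded_bilinear mul" "smooth_near A p f" "smooth_near A p h"
  shows "smooth_near A p (\<lambda>q. mul (f q) (h q))"
proof -
  obtain c where c: "c \<in> A" "p \<in> fst c" by (rule atlas_cover)
  note sc = atlas_smooth_chart[OF c(1)] and ic = atlas_is_chart[OF c(1)]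
  obtain V where V: "open V" "p \<in> V" "V \<subseteq> fst c" "smooth_on (snd c ` V) (f \<circ> chart_inv c)"
    by (rule smooth_near_chartD[OF assms(2) sc c(2)])
  obtain W where W: "open W" "p \<in> W" "W \<subseteq> fst c" "smooth_on (snd c ` W) (h \<circ> chart_inv c)"
    by (rule smooth_near_chartD[OF assms(3) sc c(2)])
  have o: "open (V \<inter> W)" using V(1) W(1) by blast
  have e: "fst c \<inter> (V \<inter> W) = V \<inter> W" using V(3) by blast
  have "smooth_on (snd c ` (V \<inter> W)) (f \<circ> chart_inv c)" "smooth_on (snd c ` (V \<inter> W)) (h \<circ> chart_inv c)"
    by (auto intro: smooth_on_subset[OF V(4)] smooth_on_subset[OF W(4)])
  from smooth_on_bilinear[OF chart_image_open[OF ic o, unfolded e] assms(1) this]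
  show ?thesis
    using smooth_near_chartI[OF sc c(2) o, of "\<lambda>q. mul (f q) (h q)"] V(2) W(2) by (simp add: e o_def)
qed

lemma smooth_near_add:
  assumes "smooth_near A p f" "smooth_near A p h"
  shows "smooth_near A p (\<lambda>q. f q + h q)"
proof -
  obtain c where c: "c \<in> A" "p \<in> fst c" by (rule atlas_cover)
  note sc = atlas_smooth_chart[OF c(1)] and ic = atlas_is_chart[OF c(1)]
  obtain V where V: "open V" "p \<in> V" "V \<subseteq> fst c" "smooth_on (snd c ` V) (f \<circ> chart_inv c)"
    by (rule smooth_near_chartD[OF assms(1) sc c(2)])
  obtain W where W: "open W" "p \<in> W" "W \<subseteq> fst c" "smooth_on (snd c ` W) (h \<circ> chart_inv c)"
    by (rule smooth_near_chartD[OF assms(2) sc c(2)])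
  have o: "open (V \<inter> W)" using V(1) W(1) by blast
  have e: "fst c \<inter> (V \<inter> W) = V \<inter> W" using V(3) by blast
  have "smooth_on (snd c ` (V \<inter> W)) (f \<circ> chart_inv c)" "smooth_on (snd c ` (V \<inter> W)) (h \<circ> chart_inv c)"
    by (auto intro: smooth_on_subset[OF V(4)] smooth_on_subset[OF W(4)])
  from smooth_on_add[OF chart_image_open[OF ic o, unfolded e] this]
  show ?thesis
    using smooth_near_chartI[OF sc c(2) o, of "\<lambda>q. f q + h q"] V(2) W(2) by (simp add: e o_def)
qed

lemma smooth_near_const: "smooth_near A p (\<lambda>q. k)"
proof -
  have "smooth_fun A UNIV (\<lambda>q. k)" by (simp add: smooth_fun_def o_def smooth_on_const)
  then show ?thesis by (auto simp: smooth_near_def)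
qed

lemma smooth_near_sum:
  "(\<And>i. i \<in> B \<Longrightarrow> smooth_near A p (f i)) \<Longrightarrow> smooth_near A p (\<lambda>q. \<Sum>i\<in>B. f i q)"
proof (induction B rule: infinite_finite_induct)
  case (insert b B)
  then show ?case using smooth_near_add[of p "f b"] by simp
qed (auto intro: smooth_near_const)

lemmas smooth_near_mult = smooth_near_bilinear[OF bounded_bilinear_mult]
lemmas smooth_near_scaleR = smooth_near_bilinear[OF bounded_bilinear_scaleR]
lemmas smooth_near_inner_left = smooth_near_linear[OF bounded_linear_inner_left]

lemma smooth_near_diff:
  assumes "smooth_near A p f" "smooth_near A p h"
  shows "smooth_near A p (\<lambda>q. f q - h q)"
  using smooth_near_add[OF assms(1) smooth_near_linear[OF bounded_linear_minus[OF bounded_linear_ident] assms(2)]]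
  by simp

lemma smooth_near_continuous:
  assumes "smooth_near A p f"
  shows "isCont f p"
proof -
  obtain c where c: "c \<in> A" "p \<in> fst c" by (rule atlas_cover)
  note sc = atlas_smooth_chart[OF c(1)] and ic = atlas_is_chart[OF c(1)]
  obtain V where V: "open V" "p \<in> V" "V \<subseteq> fst c" "smooth_on (snd c ` V) (f \<circ> chart_inv c)"
    by (rule smooth_near_chartD[OF assms sc c(2)])
  have "continuous_on V (\<lambda>q. (f \<circ> chart_inv c) (snd c q))"
    by (rule continuous_on_compose2[OF smooth_on_continuous[OF V(4)]
          continuous_on_subset[OF is_chartD(2)[OF ic] V(3)]]) auto
  then have "continuous_on V f"
    by (rule continuous_on_eq) (use V(3) in \<open>auto simp: chart_inv_chart[OF ic]\<close>)
  then show ?thesis using V by (simp add: continuous_on_eq_continuous_at)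
qed

lemma vderiv_coord_field:
  assumes "smooth_near A p F" "smooth_chart A c" "p \<in> fst c"
  shows "vderiv (coord_field A c u p) F = frechet_derivative (F \<circ> chart_inv c) (at (snd c p)) u"
proof -
  have "frechet_derivative ((\<lambda>q. F q \<bullet> b) \<circ> chart_inv c) (at (snd c p)) u =
      frechet_derivative (F \<circ> chart_inv c) (at (snd c p)) u \<bullet> b" for b
    using frechet_derivative_linear_comp[OF bounded_linear_inner_left smooth_near_differentiable[OF assms]]
    by (simp add: o_def)
  then show ?thesis
    by (simp add: vderiv_def coord_field_def smooth_near_inner_left[OF assms(1)] euclidean_representation)
qed

end

text \<open>Smoothness of \<open>F\<close> is demanded only near \<open>p\<close> and only in the
  one chart \<open>d\<close>. With \<open>d\<close> a restriction of a development, a map is thus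
  controlled by its composite with the development.\<close>

lemma smooth_near_pullback:
  fixes A :: "('a::{t2_space,second_countable_topology}, 'e::euclidean_space) chart set"
    and B :: "('b::{t2_space,second_countable_topology}, 'f::euclidean_space) chart set"
  assumes A: "smooth_manifold A" and B: "smooth_manifold B" and F: "continuous_on UNIV F"
    and c: "smooth_chart A c" "p \<in> fst c" and d: "smooth_chart B d" "F p \<in> fst d"
    and dF: "smooth_near A p (snd d \<circ> F)" and f: "smooth_near B (F p) f"
  shows "smooth_near A p (f \<circ> F)"
    "frechet_derivative (f \<circ> F \<circ> chart_inv c) (at (snd c p)) u =
      frechet_derivative (f \<circ> chart_inv d) (at (snd d (F p)))
        (frechet_derivative (snd d \<circ> F \<circ> chart_inv c) (at (snd c p)) u)"
proof -
  interpret A: smooth_mfd A using A by unfold_locales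
  interpret B: smooth_mfd B using B by unfold_locales
  note ic = A.smooth_chart_is_chart[OF c(1)] and id = B.smooth_chart_is_chart[OF d(1)]
  obtain V where V: "open V" "F p \<in> V" "V \<subseteq> fst d" "smooth_on (snd d ` V) (f \<circ> chart_inv d)"
    by (rule B.smooth_near_chartD[OF f d])
  obtain W where W: "open W" "p \<in> W" "W \<subseteq> fst c" "smooth_on (snd c ` W) (snd d \<circ> F \<circ> chart_inv c)"
    by (rule A.smooth_near_chartD[OF dF c])
  let ?W = "W \<inter> F -` V"
  have oW: "open ?W" using W(1) V(1) F by (simp add: open_Int open_vimage)
  have e: "fst c \<inter> ?W = ?W" "fst d \<inter> V = V" using W(3) V(3) by auto
  have o: "open (snd c ` ?W)" "open (snd d ` V)"
    using chart_image_open[OF ic oW] chart_image_open[OF id V(1)] by (simp_all add: e)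
  have eq: "(f \<circ> F \<circ> chart_inv c) y = (f \<circ> chart_inv d) ((snd d \<circ> F \<circ> chart_inv c) y)"
    if "y \<in> snd c ` ?W" for y
  proof -
    obtain q where q: "q \<in> ?W" "y = snd c q" using \<open>y \<in> snd c ` ?W\<close> by blast
    then have "chart_inv c y = q" "F q \<in> fst d"
      using W(3) V(3) chart_inv_chart[OF ic] by auto
    then show ?thesis by (simp add: chart_inv_chart[OF id])
  qed
  have img: "(snd d \<circ> F \<circ> chart_inv c) ` snd c ` ?W \<subseteq> snd d ` V"
  proof (intro subsetI)
    fix z assume "z \<in> (snd d \<circ> F \<circ> chart_inv c) ` snd c ` ?W"
    then obtain q where q: "q \<in> ?W" "z = snd d (F (chart_inv c (snd c q)))" by auto
    then have "chart_inv c (snd c q) = q" using W(3) chart_inv_chart[OF ic] by auto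
    then show "z \<in> snd d ` V" using q by auto
  qed
  have "smooth_on (snd c ` ?W) (\<lambda>y. (f \<circ> chart_inv d) ((snd d \<circ> F \<circ> chart_inv c) y))"
    by (rule smooth_on_compose[OF o img smooth_on_subset[OF W(4)] V(4)]) auto
  then have "smooth_on (snd c ` (fst c \<inter> ?W)) (f \<circ> F \<circ> chart_inv c)"
    unfolding e by (rule smooth_on_cong[OF o(1), THEN iffD2, rotated]) (rule eq)
  then show "smooth_near A p (f \<circ> F)"
    using A.smooth_near_chartI[OF c oW] V(2) W(2) by simp
  have "frechet_derivative (f \<circ> F \<circ> chart_inv c) (at (snd c p)) u =
      frechet_derivative (\<lambda>y. (f \<circ> chart_inv d) ((snd d \<circ> F \<circ> chart_inv c) y)) (at (snd c p)) u"
    by (rule fun_cong[OF frechet_derivative_eq_on_open[OF o(1) _ eq]]) (use W(2) V(2) in auto)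
  also have "\<dots> = frechet_derivative (f \<circ> chart_inv d) (at ((snd d \<circ> F \<circ> chart_inv c) (snd c p)))
      (frechet_derivative (snd d \<circ> F \<circ> chart_inv c) (at (snd c p)) u)"
    by (rule frechet_derivative_chain)
      (use A.smooth_near_differentiable[OF dF c] B.smooth_near_differentiable[OF f d]
        in \<open>simp_all add: o_def chart_inv_chart[OF ic c(2)]\<close>)
  finally show "frechet_derivative (f \<circ> F \<circ> chart_inv c) (at (snd c p)) u =
      frechet_derivative (f \<circ> chart_inv d) (at (snd d (F p)))
        (frechet_derivative (snd d \<circ> F \<circ> chart_inv c) (at (snd c p)) u)"
    by (simp add: chart_inv_chart[OF ic c(2)])
qed

section \<open>Manifolds with a global local diffeomorphism to the model space\<close>

text \<open>Such a map \<open>D\<close> trivializes the tangent bundle: \<open>tv p u\<close> is the tangent vector at \<open>p\<close> that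
  \<open>D\<close> maps to \<open>u\<close>, and \<open>der p u f\<close> is the derivative of \<open>f\<close> in its direction, also for
  vector-valued \<open>f\<close>.\<close>

locale etale_mfd = smooth_mfd A
  for A :: "('a::{t2_space,second_countable_topology}, 'e::euclidean_space) chart set" +
  fixes D :: "'a \<Rightarrow> 'e"
  assumes etale: "\<exists>W. p \<in> W \<and> smooth_chart A (W, D)"
begin

definition frame_dom :: "'a \<Rightarrow> 'a set" where
  "frame_dom p = (SOME W. p \<in> W \<and> smooth_chart A (W, D))"

definition der :: "'a \<Rightarrow> 'e \<Rightarrow> ('a \<Rightarrow> 'b::real_normed_vector) \<Rightarrow> 'b" where
  "der p u f = frechet_derivative (f \<circ> inv_into (frame_dom p) D) (at (D p)) u"

definition tv :: "'a \<Rightarrow> 'e \<Rightarrow> 'a tvec" where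
  "tv p u = coord_field A (frame_dom p, D) u p"

lemma frame_dom: "p \<in> frame_dom p" "smooth_chart A (frame_dom p, D)"
  using someI_ex[OF etale[of p]] unfolding frame_dom_def by auto

text \<open>Two local inverses of \<open>D\<close> around \<open>p\<close> coincide near
  \<open>D p\<close>, so the chosen domain does not matter. In particular \<open>der q\<close> for
  all \<open>q\<close> near \<open>p\<close> can be computed with the one inverse belonging to
  \<open>p\<close>.\<close>

lemma der_chart:
  assumes W: "smooth_chart A (W, D)" "p \<in> W"
  shows "der p u f = frechet_derivative (f \<circ> inv_into W D) (at (D p)) u"
  unfolding der_def
proof (rule fun_cong[OF frechet_derivative_eq_on_open])
  note iW = smooth_chart_is_chart[OF W(1)] and iF = smooth_chart_is_chart[OF frame_dom(2)[of p]]
  have oW: "open W" using is_chartD(1)[OF iW] by simp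
  show "open (D ` (frame_dom p \<inter> W))" using chart_image_open[OF iF oW] by simp
  show "D p \<in> D ` (frame_dom p \<inter> W)" using W(2) frame_dom(1) by blast
  fix y assume "y \<in> D ` (frame_dom p \<inter> W)"
  then show "(f \<circ> inv_into (frame_dom p) D) y = (f \<circ> inv_into W D) y"
    using chart_inv_chart[OF iW] chart_inv_chart[OF iF] by auto
qed

lemma tv_apply: "tv p u f = (if smooth_near A p f then der p u f else 0)"
  by (simp add: tv_def coord_field_def der_def)

lemma tangent_space_eq: "tangent_space A p = range (tv p)"
  using tangent_space_chart[OF frame_dom(2)[of p]] frame_dom(1)[of p]
  by (auto simp: tv_def fun_eq_iff image_def)

lemma smooth_near_frameD:
  assumes "smooth_near A p f"
  obtains V where "open V" "p \<in> V" "V \<subseteq> frame_dom p"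
    "smooth_on (D ` V) (f \<circ> inv_into (frame_dom p) D)"
proof -
  have "p \<in> fst (frame_dom p, D)" by (simp add: frame_dom(1))
  from smooth_near_chartD[OF assms frame_dom(2) this] obtain V where
    "open V" "p \<in> V" "V \<subseteq> fst (frame_dom p, D)"
    "smooth_on (snd (frame_dom p, D) ` V) (f \<circ> chart_inv (frame_dom p, D))" .
  then show thesis by (intro that[of V]) simp_all
qed

lemma smooth_near_der_differentiable:
  "smooth_near A p f \<Longrightarrow> (f \<circ> inv_into (frame_dom p) D) differentiable (at (D p))"
  by (rule smooth_near_differentiable[OF _ frame_dom(2)[of p], simplified]) (simp_all add: frame_dom(1))

lemma linear_der: "smooth_near A p f \<Longrightarrow> linear (\<lambda>u. der p u f)"
  unfolding der_def by (rule linear_frechet_derivative[OF smooth_near_der_differentiable])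

section \<open>Differentiation along the frame\<close>

lemma der_const [simp]: "der p u (\<lambda>q. k) = 0"
  by (simp add: der_def o_def)

lemma der_add: "smooth_near A p f \<Longrightarrow> smooth_near A p h \<Longrightarrow>
    der p u (\<lambda>q. f q + h q) = der p u f + der p u h"
  by (simp add: der_def o_def frechet_derivative_add smooth_near_der_differentiable[unfolded o_def])

lemma der_bilinear: "bounded_bilinear mul \<Longrightarrow> smooth_near A p f \<Longrightarrow> smooth_near A p h \<Longrightarrow>
    der p u (\<lambda>q. mul (f q) (h q)) = mul (f p) (der p u h) + mul (der p u f) (h p)"
  using chart_inv_chart[OF smooth_chart_is_chart[OF frame_dom(2)[of p]]] frame_dom(1)[of p]
  by (simp add: der_def o_def frechet_derivative_bilinear[where mul = mul]
      smooth_near_der_differentiable[unfolded o_def])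

lemmas der_mult = der_bilinear[OF bounded_bilinear_mult]
lemmas der_scaleR = der_bilinear[OF bounded_bilinear_scaleR]

lemma der_linear_comp: "bounded_linear L \<Longrightarrow> smooth_near A p f \<Longrightarrow>
    der p u (\<lambda>q. L (f q)) = L (der p u f)"
  by (simp add: der_def o_def frechet_derivative_linear_comp[where L = L]
      smooth_near_der_differentiable[unfolded o_def])

lemma der_diff:
  assumes "smooth_near A p f" "smooth_near A p h"
  shows "der p u (\<lambda>q. f q - h q) = der p u f - der p u h"
  using der_add[OF assms(1) smooth_near_linear[OF bounded_linear_minus[OF bounded_linear_ident] assms(2)]]
    der_linear_comp[OF bounded_linear_minus[OF bounded_linear_ident] assms(2)] by simp

lemma der_sum: "(\<And>i. i \<in> B \<Longrightarrow> smooth_near A p (f i)) \<Longrightarrow>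
    der p u (\<lambda>q. \<Sum>i\<in>B. f i q) = (\<Sum>i\<in>B. der p u (f i))"
proof (induction B rule: infinite_finite_induct)
  case (insert b B)
  then show ?case using smooth_near_sum[of B p f] by (simp add: der_add)
qed auto

lemma smooth_near_D: "smooth_near A p D"
  using smooth_near_chart[OF frame_dom(2)[of p]] frame_dom(1)[of p] by simp

lemma der_D [simp]: "der p u D = u"
  using chart_derivative_self[OF frame_dom(2)[of p]] frame_dom(1)[of p] by (simp add: der_def)

lemma der_cong:
  assumes "open W" "p \<in> W" "\<And>q. q \<in> W \<Longrightarrow> f q = h q"
  shows "der p u f = der p u h"
  unfolding der_def
proof (rule fun_cong[OF frechet_derivative_eq_on_open])
  note iF = smooth_chart_is_chart[OF frame_dom(2)[of p]]
  show "open (D ` (frame_dom p \<inter> W))" using chart_image_open[OF iF assms(1)] by simp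
  show "D p \<in> D ` (frame_dom p \<inter> W)" using assms(2) frame_dom(1) by blast
  fix y assume "y \<in> D ` (frame_dom p \<inter> W)"
  then show "(f \<circ> inv_into (frame_dom p) D) y = (h \<circ> inv_into (frame_dom p) D) y"
    using chart_inv_chart[OF iF] assms(3) by auto
qed

lemma smooth_near_der:
  assumes "smooth_near A p f"
  shows "smooth_near A p (\<lambda>q. der q u f)"
proof -
  note sF = frame_dom(2)[of p] and pF = frame_dom(1)[of p]
  note iF = smooth_chart_is_chart[OF sF]
  obtain V where V: "open V" "p \<in> V" "V \<subseteq> frame_dom p"
      "smooth_on (D ` V) (f \<circ> inv_into (frame_dom p) D)"
    by (rule smooth_near_frameD[OF assms])
  have e: "frame_dom p \<inter> V = V" using V(3) by blast
  have o: "open (D ` V)" using chart_image_open[OF iF V(1)] by (simp add: e)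
  have "smooth_on (D ` V) ((\<lambda>q. der q u f) \<circ> inv_into (frame_dom p) D)"
  proof (rule smooth_on_cong[OF o, THEN iffD2, OF _ smooth_on_frechet_derivative[OF V(4)]])
    fix y assume "y \<in> D ` V"
    then obtain q where q: "q \<in> V" "y = D q" by blast
    moreover have "inv_into (frame_dom p) D (D q) = q" using chart_inv_chart[OF iF] q(1) V(3) by auto
    ultimately show "((\<lambda>q. der q u f) \<circ> inv_into (frame_dom p) D) y =
        frechet_derivative (f \<circ> inv_into (frame_dom p) D) (at y) u"
      using der_chart[OF sF, of q] V(3) by auto
  qed
  then show ?thesis using smooth_near_chartI[OF sF _ V(1,2)] pF by (simp add: e)
qed

lemma der_expand: "smooth_near A p f \<Longrightarrow> der p u f = (\<Sum>b\<in>Basis. (u \<bullet> b) *\<^sub>R der p b f)"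
  by (rule linear_Basis_expand[OF linear_der])

lemma smooth_near_der_field:
  assumes "smooth_near A p x" "smooth_near A p f"
  shows "smooth_near A p (\<lambda>q. der q (x q) f)"
proof -
  obtain W where W: "open W" "p \<in> W" "\<forall>q\<in>W. smooth_near A q f"
    by (rule smooth_near_open[OF assms(2)])
  have "smooth_near A p (\<lambda>q. \<Sum>b\<in>Basis. (x q \<bullet> b) *\<^sub>R der q b f)"
    by (intro smooth_near_sum smooth_near_scaleR smooth_near_inner_left assms smooth_near_der)
  then show ?thesis
    by (rule smooth_near_cong[OF _ W(1,2)]) (simp add: der_expand[OF bspec[OF W(3)], symmetric])
qed

text \<open>The Leibniz rule for a derivative along a varying direction: one term differentiates the
  direction, the other freezes it at \<open>p\<close>. This separates first-order from second-order
  terms in brackets and Hessians.\<close>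

lemma der_der_field:
  assumes "smooth_near A p x" "smooth_near A p f"
  shows "der p u (\<lambda>q. der q (x q) f) = der p (der p u x) f + der p u (\<lambda>q. der q (x p) f)"
proof -
  obtain W where W: "open W" "p \<in> W" "\<forall>q\<in>W. smooth_near A q f"
    by (rule smooth_near_open[OF assms(2)])
  \<comment> \<open>Stated for an arbitrary coefficient \<open>z\<close>: it is used for
    \<open>x\<close> and for the constant \<open>x p\<close>, and the two expansions differ exactly
    by the term containing the derivative of \<open>x\<close>.\<close>
  have e: "der p u (\<lambda>q. der q (z q) f) = (\<Sum>b\<in>Basis. (z p \<bullet> b) *\<^sub>R der p u (\<lambda>q. der q b f) +
      (der p u z \<bullet> b) *\<^sub>R der p b f)" if z: "smooth_near A p z" for z
  proof -
    have "der p u (\<lambda>q. der q (z q) f) = der p u (\<lambda>q. \<Sum>b\<in>Basis. (z q \<bullet> b) *\<^sub>R der q b f)"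
      by (rule der_cong[OF W(1,2)]) (rule der_expand[OF bspec[OF W(3)]])
    also have "\<dots> = (\<Sum>b\<in>Basis. der p u (\<lambda>q. (z q \<bullet> b) *\<^sub>R der q b f))"
      by (intro der_sum smooth_near_scaleR smooth_near_inner_left z smooth_near_der assms)
    finally show ?thesis
      by (simp add: der_scaleR smooth_near_inner_left[OF z] smooth_near_der[OF assms(2)]
          der_linear_comp[OF bounded_linear_inner_left z])
  qed
  show ?thesis
    using e[OF assms(1)] e[OF smooth_near_const[of p "x p"]]
    by (simp add: sum.distrib der_expand[OF assms(2), of "der p u x", symmetric])
qed

text \<open>Constant directions in the frame are coordinate fields of one chart around
  \<open>p\<close>, so this is the symmetry of second derivatives in that chart.\<close>

lemma der_commute:
  fixes f :: "'a \<Rightarrow> real"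
  assumes "smooth_near A p f"
  shows "der p u (\<lambda>q. der q v f) = der p v (\<lambda>q. der q u f)"
proof -
  note sF = frame_dom(2)[of p] and pF = frame_dom(1)[of p]
  note iF = smooth_chart_is_chart[OF sF]
  obtain V where V: "open V" "p \<in> V" "V \<subseteq> frame_dom p"
      "smooth_on (D ` V) (f \<circ> inv_into (frame_dom p) D)"
    by (rule smooth_near_frameD[OF assms])
  have o: "open (D ` V)" using chart_image_open[OF iF V(1)] V(3) by (simp add: Int_absorb1)
  have e: "der p u (\<lambda>q. der q v f) =
      frechet_derivative (\<lambda>y. frechet_derivative (f \<circ> inv_into (frame_dom p) D) (at y) v) (at (D p)) u"
    for u v
    unfolding der_def[of p u]
  proof (rule fun_cong[OF frechet_derivative_eq_on_open[OF o]])
    show "D p \<in> D ` V" using V(2) by blast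
    fix y assume "y \<in> D ` V"
    then obtain q where q: "q \<in> V" "y = D q" by blast
    moreover have "inv_into (frame_dom p) D (D q) = q" using chart_inv_chart[OF iF] q(1) V(3) by auto
    ultimately show "((\<lambda>q. der q v f) \<circ> inv_into (frame_dom p) D) y =
        frechet_derivative (f \<circ> inv_into (frame_dom p) D) (at y) v"
      using der_chart[OF sF, of q] V(3) by auto
  qed
  show ?thesis
    unfolding e by (rule second_derivative_symmetric[OF o V(4)]) (use V(2) in blast)
qed

lemma vderiv_tv: "smooth_near A p F \<Longrightarrow> vderiv (tv p u) F = der p u F"
  unfolding tv_def using vderiv_coord_field[OF _ frame_dom(2)[of p]] frame_dom(1)[of p]
  by (simp add: der_def)

lemma vderiv_tv_D [simp]: "vderiv (tv p u) D = u"
  by (simp add: vderiv_tv smooth_near_D)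

lemma tv_vderiv: "\<xi> \<in> tangent_space A p \<Longrightarrow> tv p (vderiv \<xi> D) = \<xi>"
  by (auto simp: tangent_space_eq)

lemma tv_eq_iff: "tv p u = tv p v \<longleftrightarrow> u = v"
  by (metis vderiv_tv_D)

lemma tv_lincomb: "tv p (a *\<^sub>R u + b *\<^sub>R v) = (\<lambda>f. a * tv p u f + b * tv p v f)"
proof
  fix f
  show "tv p (a *\<^sub>R u + b *\<^sub>R v) f = a * tv p u f + b * tv p v f"
    by (simp add: tv_apply linear_add[OF linear_der] linear_scale[OF linear_der])
qed

lemma tv_zero: "tv p 0 = (\<lambda>f. 0)"
  using tv_lincomb[of p 0 0 0 0] by simp

lemma tv_minus: "tv p (- u) = (\<lambda>f. - tv p u f)"
  using tv_lincomb[of p "-1" u 0 u] by simp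

lemma coord_field_tv:
  assumes "smooth_chart A c" "p \<in> fst c"
  shows "coord_field A c u p = tv p (frechet_derivative (D \<circ> chart_inv c) (at (snd c p)) u)"
  using coord_field_change[OF assms frame_dom(2)[of p]] frame_dom(1)[of p] by (simp add: tv_def)

section \<open>Vector fields and Lie brackets in the frame\<close>

lemma vector_fieldI:
  assumes "\<And>p. p \<in> W \<Longrightarrow> X p = tv p (x p)" "\<And>p. p \<in> W \<Longrightarrow> smooth_near A p x"
  shows "vector_field A W X"
  unfolding vector_field_def
proof (intro conjI ballI allI impI)
  show "X p \<in> tangent_space A p" if "p \<in> W" for p
    using assms(1)[OF that] by (simp add: tangent_space_eq)
  fix V and f :: "'a \<Rightarrow> real"
  assume V: "open V \<and> V \<subseteq> W \<and> smooth_fun A V f"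
  show "smooth_fun A V (\<lambda>p. X p f)"
  proof (rule smooth_funI)
    fix p assume p: "p \<in> V"
    have f: "smooth_near A q f" if "q \<in> V" for q using V that smooth_fun_near by blast
    have "smooth_near A p (\<lambda>q. der q (x q) f)"
      using p V by (intro smooth_near_der_field assms(2) f) auto
    then show "smooth_near A p (\<lambda>q. X q f)"
      by (rule smooth_near_cong[of _ _ V]) (use V p f assms(1) in \<open>auto simp: tv_apply\<close>)
  qed
qed

text \<open>The coefficients of a field are its values on the components of \<open>D\<close>. These
  are smooth on all of \<open>W\<close>, so the smoothness condition for fields applies to
  them.\<close>

lemma vector_fieldD:
  assumes X: "vector_field A W X" and "open W" "p \<in> W"
  shows "X p = tv p (vderiv (X p) D)" "smooth_near A p (\<lambda>q. vderiv (X q) D)"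
proof -
  show "X p = tv p (vderiv (X p) D)"
    using assms tv_vderiv unfolding vector_field_def by simp
  have D: "smooth_fun A W (\<lambda>q. D q \<bullet> b)" for b
    by (intro smooth_funI smooth_near_inner_left smooth_near_D)
  have "smooth_near A p (\<lambda>q. X q (\<lambda>q. D q \<bullet> b))" for b
    using X assms(2,3) D[of b] smooth_fun_near[OF _ assms(2,3)] unfolding vector_field_def by blast
  then show "smooth_near A p (\<lambda>q. vderiv (X q) D)"
    unfolding vderiv_def
    by (intro smooth_near_sum smooth_near_linear[OF bounded_linear_scaleR_left])
qed

lemma lie_bracket_tv:
  assumes X: "vector_field A W X" and Y: "vector_field A W Y" and W: "open W" "p \<in> W"
  shows "lie_bracket A X Y p = tv p (der p (vderiv (X p) D) (\<lambda>q. vderiv (Y q) D) -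
      der p (vderiv (Y p) D) (\<lambda>q. vderiv (X q) D))"
proof
  fix f
  let ?x = "\<lambda>q. vderiv (X q) D" and ?y = "\<lambda>q. vderiv (Y q) D"
  show "lie_bracket A X Y p f = tv p (der p (?x p) ?y - der p (?y p) ?x) f"
  proof (cases "smooth_near A p f")
    case True
    obtain V where V: "open V" "p \<in> V" "\<forall>q\<in>V. smooth_near A q f"
      by (rule smooth_near_open[OF True])
    have VW: "open (V \<inter> W)" "p \<in> V \<inter> W" using V W by auto
    have main: "Z p (\<lambda>q. Z' q f) = der p (der p (vderiv (Z p) D) (\<lambda>q. vderiv (Z' q) D)) f +
        der p (vderiv (Z p) D) (\<lambda>q. der q (vderiv (Z' p) D) f)"
      if Z: "vector_field A W Z" and Z': "vector_field A W Z'" for Z Z'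
    proof -
      let ?z = "\<lambda>q. vderiv (Z' q) D"
      have e: "Z' q f = der q (?z q) f" if "q \<in> V \<inter> W" for q
        using vector_fieldD(1)[OF Z' W(1), of q] that V(3) by (metis IntE tv_apply)
      have s: "smooth_near A p (\<lambda>q. der q (?z q) f)"
        by (rule smooth_near_der_field[OF vector_fieldD(2)[OF Z' W] True])
      have "smooth_near A p (\<lambda>q. Z' q f)"
        by (rule smooth_near_cong[OF s VW]) (simp add: e)
      then have "Z p (\<lambda>q. Z' q f) = der p (vderiv (Z p) D) (\<lambda>q. Z' q f)"
        using vector_fieldD(1)[OF Z W] by (metis tv_apply)
      also have "\<dots> = der p (vderiv (Z p) D) (\<lambda>q. der q (?z q) f)"
        by (rule der_cong[OF VW e])
      finally show ?thesis by (simp add: der_der_field[OF vector_fieldD(2)[OF Z' W] True])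
    qed
    show ?thesis
      using main[OF X Y] main[OF Y X] der_commute[OF True, of "?x p" "?y p"] True
        linear_diff[OF linear_der[OF True]]
      by (simp add: lie_bracket_def tv_apply)
  qed (simp add: lie_bracket_def tv_apply)
qed

text \<open>By connectedness local constancy is enough, and it is visible in the chart
  \<open>D\<close> around each point.\<close>

lemma der_zero_constant:
  assumes "connected (UNIV :: 'a set)" "\<And>p. smooth_near A p f" "\<And>p u. der p u f = 0"
  shows "f p = f q"
proof (rule connected_local_const[OF assms(1)])
  show "\<forall>a\<in>UNIV. \<forall>\<^sub>F b in at a within UNIV. f a = f b"
  proof
    fix p
    note sF = frame_dom(2)[of p] and pF = frame_dom(1)[of p]
    note iF = smooth_chart_is_chart[OF sF]
    obtain V where V: "open V" "p \<in> V" "V \<subseteq> frame_dom p"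
        "smooth_on (D ` V) (f \<circ> inv_into (frame_dom p) D)"
      by (rule smooth_near_frameD[OF assms(2)])
    have o: "open (D ` V)" using chart_image_open[OF iF V(1)] V(3) by (simp add: Int_absorb1)
    then obtain r where r: "r > 0" "ball (D p) r \<subseteq> D ` V"
      using V(2) by (meson imageI openE)
    have inv: "inv_into (frame_dom p) D (D q) = q" if "q \<in> V" for q
      using chart_inv_chart[OF iF] that V(3) by auto
    \<comment> \<open>A ball is used for its convexity: there a vanishing derivative forces
      constancy.\<close>
    have const: "(f \<circ> inv_into (frame_dom p) D) y = (f \<circ> inv_into (frame_dom p) D) (D p)"
      if y: "y \<in> ball (D p) r" for y
    proof (rule zero_derivative_imp_constant_on_ball[OF _ _ y])
      fix z assume "z \<in> ball (D p) r"
      then obtain q where q: "q \<in> V" "z = D q" using r(2) by blast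
      show "(f \<circ> inv_into (frame_dom p) D) differentiable (at z)"
        using smooth_on_differentiable[OF V(4)] q by blast
      show "frechet_derivative (f \<circ> inv_into (frame_dom p) D) (at z) v = 0" for v
        using der_chart[OF sF, of q v f] assms(3)[of q v] q V(3) by auto
    qed
    have "continuous_on (frame_dom p) D" "open (frame_dom p)" using is_chartD[OF iF] by simp_all
    then have "open (V \<inter> D -` ball (D p) r)"
      using continuous_open_preimage[of V D "ball (D p) r"] V(1,3) continuous_on_subset by blast
    moreover have "p \<in> V \<inter> D -` ball (D p) r" using V(2) r(1) by simp
    moreover have "f p = f q" if "q \<in> V \<inter> D -` ball (D p) r" for q
      using const[of "D q"] inv[of q] inv[of p] that V(2) by auto
    ultimately show "\<forall>\<^sub>F b in at p within UNIV. f p = f b"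
      by (auto simp: eventually_at_topological)
  qed
qed auto

end

text \<open>The name refers to the two manifolds; \<open>F\<close> itself is just a smooth map,
  measured through \<open>E o F\<close>. Continuity is a separate condition because \<open>E\<close>
  is only locally injective: \<open>F\<close> could jump between sheets of \<open>E\<close> while
  \<open>E o F\<close> stays smooth.\<close>

locale etale_map = src: etale_mfd A D + tgt: etale_mfd B E
  for A :: "('a::{t2_space,second_countable_topology}, 'e::euclidean_space) chart set" and D
    and B :: "('b::{t2_space,second_countable_topology}, 'f::euclidean_space) chart set" and E +
  fixes F :: "'a \<Rightarrow> 'b"
  assumes continuous: "continuous_on UNIV F"
    and smooth: "smooth_near A p (E \<circ> F)"
begin

lemma smooth_near_comp:
  assumes "smooth_near B (F p) f"
  shows "smooth_near A p (f \<circ> F)"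
  by (rule smooth_near_pullback(1)[OF src.mfd tgt.mfd continuous src.frame_dom(2)[of p] _ tgt.frame_dom(2)[of "F p"]])
    (simp_all add: src.frame_dom(1) tgt.frame_dom(1) smooth assms)

lemma der_comp:
  assumes "smooth_near B (F p) f"
  shows "src.der p u (f \<circ> F) = tgt.der (F p) (src.der p u (E \<circ> F)) f"
  using smooth_near_pullback(2)[OF src.mfd tgt.mfd continuous src.frame_dom(2)[of p] _
      tgt.frame_dom(2)[of "F p"], of p f u]
  by (simp add: src.frame_dom(1) tgt.frame_dom(1) smooth assms src.der_def tgt.der_def)

lemma pushforward_tv: "pushforward B F p (src.tv p u) = tgt.tv (F p) (src.der p u (E \<circ> F))"
  by (auto simp: pushforward_def src.tv_apply tgt.tv_apply smooth_near_comp der_comp)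

lemma smooth_map: "smooth_map A B F"
  unfolding smooth_map_def
proof (intro conjI ballI)
  fix c d assume cd: "c \<in> A" "d \<in> B"
  show "smooth_on (snd c ` (fst c \<inter> F -` fst d)) (snd d \<circ> F \<circ> chart_inv c)"
    by (rule src.smooth_near_imp_smooth_on[OF src.atlas_smooth_chart[OF cd(1)]])
      (auto intro!: smooth_near_comp tgt.smooth_near_chart tgt.atlas_smooth_chart[OF cd(2)])
qed (rule continuous)

end

lemma smooth_map_imp_etale_map:
  assumes "etale_mfd A D" "etale_mfd B E" "smooth_map A B F"
  shows "etale_map A D B E F"
proof -
  interpret src: etale_mfd A D by fact
  interpret tgt: etale_mfd B E by fact
  have cont: "continuous_on UNIV F" using assms(3) by (simp add: smooth_map_def)
  show ?thesis
  proof
    fix p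
    obtain c where c: "c \<in> A" "p \<in> fst c" by (rule src.atlas_cover)
    obtain d where d: "d \<in> B" "F p \<in> fst d" by (rule tgt.atlas_cover)
    note sc = src.atlas_smooth_chart[OF c(1)] and sd = tgt.atlas_smooth_chart[OF d(1)]
    have "open (F -` fst d)"
      using is_chartD(1)[OF tgt.atlas_is_chart[OF d(1)]] cont by (simp add: open_vimage)
    then have "smooth_near A p (snd d \<circ> F)"
      using src.smooth_near_chartI[OF sc c(2), of "F -` fst d" "snd d \<circ> F"] d(2) assms(3) c(1) d(1)
      by (simp add: smooth_map_def)
    from smooth_near_pullback(1)[OF src.mfd tgt.mfd cont sc c(2) sd d(2) this tgt.smooth_near_D]
    show "smooth_near A p (E \<circ> F)" .
  qed (rule cont)
qed

section \<open>Bilinear forms in the parallel frame\<close>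

lemma bilinear_expand:
  fixes S :: "'e::euclidean_space \<Rightarrow> 'e \<Rightarrow> real"
  assumes "bilinear S"
  shows "S x y = (\<Sum>i\<in>Basis. \<Sum>j\<in>Basis. (x \<bullet> i) * (y \<bullet> j) * S i j)"
proof -
  have "S x y = (\<Sum>i\<in>Basis. (x \<bullet> i) *\<^sub>R S i y)"
    using assms by (intro linear_Basis_expand) (simp add: bilinear_def)
  also have "\<dots> = (\<Sum>i\<in>Basis. (x \<bullet> i) *\<^sub>R (\<Sum>j\<in>Basis. (y \<bullet> j) *\<^sub>R S i j))"
    using assms linear_Basis_expand[of "S _" y] by (simp add: bilinear_def)
  finally show ?thesis by (simp add: sum_distrib_left mult.assoc)
qed

context etale_mfd
begin

text \<open>The Leibniz rule for three varying factors, the form and its two arguments. The first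
  term freezes both arguments at \<open>p\<close>; it is isolated by comparing with the expansion
  for constant arguments.\<close>

lemma
  fixes S :: "'a \<Rightarrow> 'e \<Rightarrow> 'e \<Rightarrow> real"
  assumes bil: "\<And>q. bilinear (S q)" and S: "\<And>a b. smooth_near A p (\<lambda>q. S q a b)"
    and x: "smooth_near A p x" and y: "smooth_near A p y"
  shows smooth_near_bilinear_form: "smooth_near A p (\<lambda>q. S q (x q) (y q))"
    and der_bilinear_form: "der p u (\<lambda>q. S q (x q) (y q)) =
      der p u (\<lambda>q. S q (x p) (y p)) + S p (der p u x) (y p) + S p (x p) (der p u y)"
proof -
  have s: "smooth_near A p (\<lambda>q. (x q \<bullet> i) * (y q \<bullet> j) * S q i j)"
      "smooth_near A p (\<lambda>q. (x q \<bullet> i) * (y q \<bullet> j))"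
      "smooth_near A p (\<lambda>q. x q \<bullet> i)" "smooth_near A p (\<lambda>q. y q \<bullet> j)"
    if "smooth_near A p x" "smooth_near A p y" for i j x y
    by (intro smooth_near_mult smooth_near_inner_left that S)+
  have "smooth_near A p (\<lambda>q. \<Sum>i\<in>Basis. \<Sum>j\<in>Basis. (x q \<bullet> i) * (y q \<bullet> j) * S q i j)"
    by (intro smooth_near_sum s x y)
  then show "smooth_near A p (\<lambda>q. S q (x q) (y q))"
    by (simp flip: bilinear_expand[OF bil])
  have e: "der p u (\<lambda>q. S q (x q) (y q)) = (\<Sum>i\<in>Basis. \<Sum>j\<in>Basis.
      (x p \<bullet> i) * (y p \<bullet> j) * der p u (\<lambda>q. S q i j) + (der p u x \<bullet> i) * (y p \<bullet> j) * S p i j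
        + (x p \<bullet> i) * (der p u y \<bullet> j) * S p i j)"
    if "smooth_near A p x" "smooth_near A p y" for x y
  proof -
    have "der p u (\<lambda>q. (x q \<bullet> i) * (y q \<bullet> j) * S q i j) =
      (x p \<bullet> i) * (y p \<bullet> j) * der p u (\<lambda>q. S q i j) + (der p u x \<bullet> i) * (y p \<bullet> j) * S p i j
        + (x p \<bullet> i) * (der p u y \<bullet> j) * S p i j" for i j
      unfolding der_mult[OF s(2)[OF that] S] der_mult[OF s(3,4)[OF that]]
        der_linear_comp[OF bounded_linear_inner_left that(1)]
        der_linear_comp[OF bounded_linear_inner_left that(2)]
      by (simp add: algebra_simps)
    then show ?thesis
      by (subst bilinear_expand[OF bil]) (simp add: der_sum smooth_near_sum s[OF that])
  qed
  show "der p u (\<lambda>q. S q (x q) (y q)) =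
      der p u (\<lambda>q. S q (x p) (y p)) + S p (der p u x) (y p) + S p (x p) (der p u y)"
    using e[OF x y] e[OF smooth_near_const[of p "x p"] smooth_near_const[of p "y p"]]
    by (simp add: sum.distrib bilinear_expand[OF bil, of p "der p u x"]
        bilinear_expand[OF bil, of p "x p" "der p u y"])
qed

text \<open>Constant fields of the frame have vanishing brackets, so for them the exterior
  derivative is the cyclic sum of derivatives of coefficients. For general fields the derivatives of
  the field coefficients cancel against the bracket terms.\<close>

lemma closed_2formI:
  fixes \<omega> :: "'a \<Rightarrow> 'a tvec \<Rightarrow> 'a tvec \<Rightarrow> real"
  defines "S \<equiv> \<lambda>q u v. \<omega> q (tv q u) (tv q v)"
  assumes bil: "\<And>q. bilinear (S q)" and alt: "\<And>q u v. S q u v = - S q v u"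
    and smooth: "\<And>p u v. smooth_near A p (\<lambda>q. S q u v)"
    and closed: "\<And>p u v w. der p u (\<lambda>q. S q v w) + der p v (\<lambda>q. S q w u) + der p w (\<lambda>q. S q u v) = 0"
  shows "closed_2form A \<omega>"
  unfolding closed_2form_def
proof (intro allI impI ballI, elim conjE)
  fix W X Y Z p
  assume W: "open W" "p \<in> W" and X: "vector_field A W X" and Y: "vector_field A W Y"
    and Z: "vector_field A W Z"
  let ?d = "\<lambda>X Y. der p (vderiv (X p) D) (\<lambda>q. vderiv (Y q) D)"
  have form: "\<omega> q (V q) (V' q) = S q (vderiv (V q) D) (vderiv (V' q) D)"
    if "vector_field A W V" "vector_field A W V'" "q \<in> W" for V V' q
    using vector_fieldD(1)[OF that(1) W(1) that(3)] vector_fieldD(1)[OF that(2) W(1) that(3)]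
    by (simp add: S_def)
  have d: "U p (\<lambda>q. \<omega> q (V q) (V' q)) =
      der p (vderiv (U p) D) (\<lambda>q. S q (vderiv (V p) D) (vderiv (V' p) D))
      + S p (?d U V) (vderiv (V' p) D) + S p (vderiv (V p) D) (?d U V')"
    if U: "vector_field A W U" and V: "vector_field A W V" and V': "vector_field A W V'" for U V V'
  proof -
    note sV = vector_fieldD(2)[OF V W] and sV' = vector_fieldD(2)[OF V' W]
    have s: "smooth_near A p (\<lambda>q. S q (vderiv (V q) D) (vderiv (V' q) D))"
      by (rule smooth_near_bilinear_form[OF bil smooth sV sV'])
    have s': "smooth_near A p (\<lambda>q. \<omega> q (V q) (V' q))"
      by (rule smooth_near_cong[OF s W]) (simp add: form[OF V V'])
    have "U p (\<lambda>q. \<omega> q (V q) (V' q)) = tv p (vderiv (U p) D) (\<lambda>q. \<omega> q (V q) (V' q))"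
      using vector_fieldD(1)[OF U W] by simp
    also have "\<dots> = der p (vderiv (U p) D) (\<lambda>q. \<omega> q (V q) (V' q))"
      by (simp add: tv_apply s')
    also have "\<dots> = der p (vderiv (U p) D) (\<lambda>q. S q (vderiv (V q) D) (vderiv (V' q) D))"
      by (rule der_cong[OF W form[OF V V']])
    finally show ?thesis by (simp add: der_bilinear_form[OF bil smooth sV sV'])
  qed
  have l: "\<omega> p (lie_bracket A U V p) (V' p) = S p (?d U V) (vderiv (V' p) D) - S p (?d V U) (vderiv (V' p) D)"
    if U: "vector_field A W U" and V: "vector_field A W V" and V': "vector_field A W V'" for U V V'
  proof -
    have "\<omega> p (lie_bracket A U V p) (V' p) = S p (?d U V - ?d V U) (vderiv (V' p) D)"
      unfolding lie_bracket_tv[OF U V W] S_def using vector_fieldD(1)[OF V' W] by simp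
    then show ?thesis by (simp add: bilinear_lsub[OF bil])
  qed
  \<comment> \<open>The instances of \<open>alt\<close> move every differentiated coefficient into
    the first slot, where the terms match those coming from the brackets.\<close>
  show "X p (\<lambda>q. \<omega> q (Y q) (Z q)) + Y p (\<lambda>q. \<omega> q (Z q) (X q)) + Z p (\<lambda>q. \<omega> q (X q) (Y q))
      - \<omega> p (lie_bracket A X Y p) (Z p) - \<omega> p (lie_bracket A Y Z p) (X p)
      - \<omega> p (lie_bracket A Z X p) (Y p) = 0"
    using closed[of p "vderiv (X p) D" "vderiv (Y p) D" "vderiv (Z p) D"]
      alt[of p "vderiv (X p) D"] alt[of p "vderiv (Y p) D"] alt[of p "vderiv (Z p) D"]
    by (simp add: d X Y Z l)
qed

section \<open>The tangent bundle\<close>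

text \<open>The induced coordinates \<open>(x, dx)\<close>, with \<open>(m, v)\<close> standing for
  the tangent vector whose image under the differential of \<open>D\<close> is
  \<open>v\<close>.\<close>

definition lift :: "('a, 'e) chart \<Rightarrow> ('a \<times> 'e, 'e \<times> 'e) chart" where
  "lift c = (fst c \<times> UNIV, \<lambda>(m, v). (snd c m, vderiv (tv m v) (snd c)))"

definition lift_inv :: "('a, 'e) chart \<Rightarrow> 'e \<times> 'e \<Rightarrow> 'a \<times> 'e" where
  "lift_inv c = (\<lambda>(b, w). (chart_inv c b, frechet_derivative (D \<circ> chart_inv c) (at b) w))"

lemma trivialization_inv:
  "inv_into (tangent_bundle A) (trivialization D) (m, v) = (m, tv m v)"
proof (rule inv_into_f_eq)
  show "inj_on (trivialization D) (tangent_bundle A)"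
    by (rule inj_on_inverseI[of _ "\<lambda>(m, v). (m, tv m v)"])
      (auto simp: tangent_bundle_def trivialization_def tv_vderiv)
qed (auto simp: tangent_bundle_def trivialization_def tangent_space_eq)

lemma TM_atlas_eq: "TM_atlas A D = lift ` A"
proof -
  have "(\<lambda>(m, w). (x m, vderiv w x)) \<circ> inv_into (tangent_bundle A) (trivialization D) =
      (\<lambda>(m, v). (x m, vderiv (tv m v) x))" for x :: "'a \<Rightarrow> 'e"
    by (auto simp: fun_eq_iff trivialization_inv)
  then show ?thesis
    unfolding TM_atlas_def lift_def by (simp add: case_prod_beta' image_def)
qed

text \<open>This and \<open>der_via_chart\<close> exchange the components of a tangent vector in
  \<open>c\<close> with those in the frame. Applied to the chart map and to \<open>D\<close>, they
  make \<open>lift\<close> and \<open>lift_inv\<close> inverse to each other.\<close>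

lemma frechet_derivative_chart:
  assumes "smooth_near A m f" "smooth_chart A c" "m \<in> fst c"
  shows "frechet_derivative (f \<circ> chart_inv c) (at (snd c m)) w =
    der m (frechet_derivative (D \<circ> chart_inv c) (at (snd c m)) w) f"
  using chart_derivative_change[OF assms frame_dom(2)[of m], of w] frame_dom(1)[of m]
  by (simp add: der_def)

lemma der_via_chart:
  assumes "smooth_near A m f" "smooth_chart A c" "m \<in> fst c"
  shows "der m v f = frechet_derivative (f \<circ> chart_inv c) (at (snd c m)) (der m v (snd c))"
  using chart_derivative_change[OF assms(1) frame_dom(2)[of m] _ assms(2,3), of v] frame_dom(1)[of m]
  by (simp add: der_def)

lemma lift_apply:
  assumes "smooth_chart A c" "m \<in> fst c"
  shows "snd (lift c) (m, v) = (snd c m, der m v (snd c))"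
  using vderiv_tv[OF smooth_near_chart[OF assms]] by (simp add: lift_def)

lemma lift_inv_lift:
  assumes "smooth_chart A c" "m \<in> fst c"
  shows "lift_inv c (snd (lift c) (m, v)) = (m, v)"
  using der_via_chart[OF smooth_near_D assms, of v] chart_inv_chart[OF smooth_chart_is_chart[OF assms(1)] assms(2)]
  by (simp add: lift_apply[OF assms] lift_inv_def)

lemma lift_lift_inv:
  assumes "smooth_chart A c" "m \<in> fst c"
  shows "snd (lift c) (lift_inv c (snd c m, w)) = (snd c m, w)"
  using frechet_derivative_chart[OF smooth_near_chart[OF assms] assms, of w] chart_derivative_self[OF assms, of w]
    chart_inv_chart[OF smooth_chart_is_chart[OF assms(1)] assms(2)]
  by (simp add: lift_inv_def lift_apply[OF assms])

lemma lift_image: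
  assumes "smooth_chart A c" "W \<subseteq> fst c"
  shows "snd (lift c) ` (W \<times> UNIV) = snd c ` W \<times> UNIV"
proof
  show "snd (lift c) ` (W \<times> UNIV) \<subseteq> snd c ` W \<times> UNIV" by (auto simp: lift_def)
  show "snd c ` W \<times> UNIV \<subseteq> snd (lift c) ` (W \<times> UNIV)"
  proof clarify
    fix m w assume m: "m \<in> W"
    have mc: "m \<in> fst c" using m assms(2) by blast
    have "fst (lift_inv c (snd c m, w)) = m"
      using chart_inv_chart[OF smooth_chart_is_chart[OF assms(1)] mc] by (simp add: lift_inv_def)
    then have "lift_inv c (snd c m, w) \<in> W \<times> UNIV" using m by (simp add: mem_Times_iff)
    then show "(snd c m, w) \<in> snd (lift c) ` (W \<times> UNIV)"
      by (rule image_eqI[rotated]) (rule lift_lift_inv[OF assms(1) mc, symmetric])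
  qed
qed

text \<open>In both directions the fibre part is linear with coefficients depending continuously on
  the base point, hence jointly continuous by a finite basis expansion.\<close>

lemma is_chart_lift:
  assumes "smooth_chart A c"
  shows "is_chart (lift c)"
proof -
  note ic = smooth_chart_is_chart[OF assms]
  have img: "snd (lift c) ` (fst c \<times> UNIV) = snd c ` fst c \<times> UNIV"
    by (rule lift_image[OF assms]) simp
  have oi: "open (snd c ` fst c)" using chart_image_open[OF ic open_UNIV] by simp
  have "is_chart (fst c \<times> UNIV, snd (lift c))"
  proof (rule is_chartI[where h = "lift_inv c"])
    show "open (fst c \<times> (UNIV :: 'e set))" by (simp add: open_Times is_chartD(1)[OF ic])
    show "open (snd (lift c) ` (fst c \<times> UNIV))" by (simp add: img open_Times oi)
    have "continuous_on (fst c \<times> UNIV) (\<lambda>z. der (fst z) (snd z) (snd c))"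
    proof -
      have c1: "continuous_on (fst c) (\<lambda>m. der m b (snd c))" for b
        by (intro continuous_at_imp_continuous_on ballI smooth_near_continuous smooth_near_der
            smooth_near_chart[OF assms])
      have "continuous_on (fst c \<times> UNIV) (\<lambda>z :: 'a \<times> 'e. \<Sum>b\<in>Basis. (snd z \<bullet> b) *\<^sub>R der (fst z) b (snd c))"
        by (intro continuous_intros continuous_on_compose2[OF c1 continuous_on_fst[OF continuous_on_id]]) auto
      then show ?thesis
        by (rule continuous_on_eq) (auto simp: der_expand[OF smooth_near_chart[OF assms], symmetric])
    qed
    then have "continuous_on (fst c \<times> UNIV) (\<lambda>z. (snd c (fst z), der (fst z) (snd z) (snd c)))"
      by (intro continuous_on_Pair continuous_on_compose2[OF is_chartD(2)[OF ic]
            continuous_on_fst[OF continuous_on_id]]) auto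
    then show "continuous_on (fst c \<times> UNIV) (snd (lift c))"
      by (rule continuous_on_eq) (auto simp: lift_apply[OF assms])
    have "smooth_on (snd c ` (fst c \<inter> UNIV)) (D \<circ> chart_inv c)"
      by (rule smooth_near_imp_smooth_on[OF assms]) (rule smooth_near_D)
    then have "smooth_on (snd c ` fst c) (D \<circ> chart_inv c)" by simp
    from smooth_on_continuous[OF smooth_on_tangent_map[OF oi this]]
    have "continuous_on (snd c ` fst c \<times> UNIV)
        (\<lambda>z. (chart_inv c (fst z), frechet_derivative (D \<circ> chart_inv c) (at (fst z)) (snd z)))"
      by (intro continuous_on_Pair continuous_on_compose2[OF is_chartD(3)[OF ic]
            continuous_on_fst[OF continuous_on_id]]) auto
    then show "continuous_on (snd (lift c) ` (fst c \<times> UNIV)) (lift_inv c)"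
      by (simp add: img lift_inv_def case_prod_beta')
    show "lift_inv c (snd (lift c) z) = z" if "z \<in> fst c \<times> UNIV" for z
      using that lift_inv_lift[OF assms] by auto
  qed
  then show ?thesis by (simp add: lift_def)
qed

lemma chart_inv_lift:
  assumes "smooth_chart A c" "m \<in> fst c"
  shows "chart_inv (lift c) (snd c m, w) = lift_inv c (snd c m, w)"
proof (rule inv_into_f_eq)
  show "inj_on (snd (lift c)) (fst (lift c))" by (rule is_chartD(4)[OF is_chart_lift[OF assms(1)]])
  show "lift_inv c (snd c m, w) \<in> fst (lift c)"
    using chart_inv_chart[OF smooth_chart_is_chart[OF assms(1)] assms(2)] assms(2)
    by (simp add: lift_inv_def lift_def)
qed (rule lift_lift_inv[OF assms])

text \<open>The trivialization cancels between two lifted charts, leaving the tangent map of the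
  transition map from \<open>c\<close> to \<open>d\<close>.\<close>

lemma smooth_on_lift_change:
  assumes c: "smooth_chart A c" and d: "smooth_chart A d"
  shows "smooth_on (snd (lift c) ` (fst (lift c) \<inter> fst (lift d))) (snd (lift d) \<circ> chart_inv (lift c))"
proof -
  note ic = smooth_chart_is_chart[OF c] and id = smooth_chart_is_chart[OF d]
  let ?W = "snd c ` (fst c \<inter> fst d)"
  have o: "open ?W" by (rule chart_image_open[OF ic is_chartD(1)[OF id]])
  have oT: "open (?W \<times> (UNIV :: 'e set))" by (simp add: open_Times o)
  have "fst (lift c) \<inter> fst (lift d) = (fst c \<inter> fst d) \<times> UNIV" by (auto simp: lift_def)
  then have img: "snd (lift c) ` (fst (lift c) \<inter> fst (lift d)) = ?W \<times> UNIV"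
    using lift_image[OF c, of "fst c \<inter> fst d"] by simp
  have s: "smooth_on ?W (snd d \<circ> chart_inv c)"
    by (rule smooth_near_imp_smooth_on[OF c]) (auto intro: smooth_near_chart[OF d])
  have "smooth_on (?W \<times> UNIV) (\<lambda>z. ((snd d \<circ> chart_inv c) (fst z),
      frechet_derivative (snd d \<circ> chart_inv c) (at (fst z)) (snd z)))"
    by (intro smooth_on_Pair[OF oT] smooth_on_tangent_map[OF o s]
        smooth_on_compose[OF oT o _ smooth_on_bounded_linear[OF bounded_linear_fst] s]) auto
  then show ?thesis
    unfolding img
  proof (rule smooth_on_cong[OF oT, THEN iffD2, rotated])
    fix z assume "z \<in> ?W \<times> (UNIV :: 'e set)"
    then obtain m w where m: "m \<in> fst c" "m \<in> fst d" and z: "z = (snd c m, w)" by auto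
    have "chart_inv (lift c) z = (m, frechet_derivative (D \<circ> chart_inv c) (at (snd c m)) w)"
      using chart_inv_lift[OF c m(1)] chart_inv_chart[OF ic m(1)] by (simp add: z lift_inv_def)
    then show "(snd (lift d) \<circ> chart_inv (lift c)) z = ((snd d \<circ> chart_inv c) (fst z),
        frechet_derivative (snd d \<circ> chart_inv c) (at (fst z)) (snd z))"
      using chart_inv_chart[OF ic m(1)] frechet_derivative_chart[OF smooth_near_chart[OF d m(2)] c m(1), of w]
      by (simp add: lift_apply[OF d m(2)] z)
  qed
qed

lemma compatible_lift: "smooth_chart A c \<Longrightarrow> smooth_chart A d \<Longrightarrow> compatible (lift c) (lift d)"
  using smooth_on_lift_change[of c d] smooth_on_lift_change[of d c]
  by (simp add: compatible_def Int_commute)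

lemma smooth_manifold_TM: "smooth_manifold (TM_atlas A D)"
  unfolding smooth_manifold_def TM_atlas_eq
proof (intro conjI ballI)
  show "is_chart c" if "c \<in> lift ` A" for c
    using that is_chart_lift[OF atlas_smooth_chart] by auto
  show "compatible c d" if "c \<in> lift ` A" "d \<in> lift ` A" for c d
    using that compatible_lift[OF atlas_smooth_chart atlas_smooth_chart] by auto
  have "\<exists>c\<in>A. fst z \<in> fst c" for z :: "'a \<times> 'e" using atlas_cover by metis
  then show "(\<Union>c\<in>lift ` A. fst c) = UNIV" by (auto simp: lift_def)
qed

lemma smooth_chart_lift: "smooth_chart A c \<Longrightarrow> smooth_chart (TM_atlas A D) (lift c)"
  unfolding TM_atlas_eq smooth_chart_def[of "lift ` A"]
  using is_chart_lift compatible_lift atlas_smooth_chart by auto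

text \<open>For the chart \<open>D\<close> itself the fibre coordinate of \<open>(m, v)\<close> is
  \<open>v\<close>, so lifting restrictions of \<open>D\<close> yields restrictions of this
  map.\<close>

lemma etale_mfd_TM: "etale_mfd (TM_atlas A D) (\<lambda>z. (D (fst z), snd z))"
proof
  show "smooth_manifold (TM_atlas A D)" by (rule smooth_manifold_TM)
  fix z :: "'a \<times> 'e"
  have "lift (frame_dom (fst z), D) = (frame_dom (fst z) \<times> UNIV, \<lambda>z. (D (fst z), snd z))"
    by (auto simp: lift_def)
  from smooth_chart_lift[OF frame_dom(2)[of "fst z"], unfolded this]
  show "\<exists>W. z \<in> W \<and> smooth_chart (TM_atlas A D) (W, \<lambda>z. (D (fst z), snd z))"
    by (intro exI[of _ "frame_dom (fst z) \<times> UNIV"] conjI) (simp_all add: mem_Times_iff frame_dom(1))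
qed

end

section \<open>The Kaehler structure on the tangent bundle\<close>

locale developed_hessian_mfd =
  fixes A :: "('a::{t2_space,second_countable_topology}, 'e::euclidean_space) chart set"
    and nab :: "'a field \<Rightarrow> 'a field \<Rightarrow> 'a field"
    and g :: "'a metric"
    and dev :: "'a \<Rightarrow> 'e"
  assumes hess: "hessian_manifold A nab g" and dev: "development_map A nab dev"

sublocale developed_hessian_mfd \<subseteq> etale_mfd A dev
proof
  show "smooth_manifold A" using hess by (simp add: hessian_manifold_def flat_affine_manifold_def)
  show "\<exists>W. p \<in> W \<and> smooth_chart A (W, dev)" for p using dev by (simp add: development_map_def)
qed

sublocale developed_hessian_mfd \<subseteq> TM: etale_mfd "TM_atlas A dev" "\<lambda>z. (dev (fst z), snd z)"
  by (rule etale_mfd_TM)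

context developed_hessian_mfd
begin

definition gram :: "'a \<Rightarrow> 'e \<Rightarrow> 'e \<Rightarrow> real" where
  "gram p u v = g p (tv p u) (tv p v)"

lemma riemannian: "riemannian_metric A g"
  using hess by (simp add: hessian_manifold_def)

lemma tv_in_tangent_space [simp]: "tv p u \<in> tangent_space A p"
  by (simp add: tangent_space_eq)

lemma gram_commute: "gram p u v = gram p v u"
  using riemannian by (simp add: riemannian_metric_def gram_def)

lemma gram_lincomb: "gram p (a *\<^sub>R u + b *\<^sub>R v) w = a * gram p u w + b * gram p v w"
  using riemannian by (simp add: riemannian_metric_def gram_def tv_lincomb)

lemma bilinear_gram: "bilinear (gram p)"
proof -
  have lin: "linear (\<lambda>u. gram p u w)" for w
    using gram_lincomb[of p 1 _ 1 _ w] gram_lincomb[of p _ _ 0 0 w] by (intro linearI) simp_all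
  \<comment> \<open>Linearity is given in the first argument only; symmetry carries it to the
    second.\<close>
  have "gram p w = (\<lambda>u. gram p u w)" for w by (rule ext) (rule gram_commute)
  from ssubst[OF this, of linear, OF lin] show ?thesis
    unfolding bilinear_def using lin by blast
qed

lemma gram_pos: "u \<noteq> 0 \<Longrightarrow> gram p u u > 0"
  using riemannian tv_eq_iff[of p u 0] by (simp add: riemannian_metric_def gram_def tv_zero)

lemma smooth_near_gram: "smooth_near A p (\<lambda>q. gram q u v)"
proof -
  have v: "vector_field A UNIV (\<lambda>q. tv q u)" for u
    by (rule vector_fieldI[where x = "\<lambda>q. u"]) (simp_all add: smooth_near_const)
  have "smooth_fun A W (\<lambda>p. g p (X p) (Y p))"
    if "open W" "vector_field A W X" "vector_field A W Y" for W X Y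
    using riemannian that unfolding riemannian_metric_def by (elim conjE) simp
  from this[OF open_UNIV v v] have "smooth_fun A UNIV (\<lambda>q. gram q u v)"
    unfolding gram_def .
  then show ?thesis by (rule smooth_fun_near) simp_all
qed

text \<open>Flatness and the Hessian condition concern coordinate vectors of \<open>c\<close>,
  whereas the frame uses arbitrary constant vectors. The coordinate vectors suffice because their
  images span: \<open>u\<close> is the image of its components
  \<open>der q u (snd c)\<close>.\<close>

lemma linear_eq_on_chart_frame:
  fixes f h :: "'e \<Rightarrow> 'b::real_vector"
  assumes c: "smooth_chart A c" "q \<in> fst c" and "linear f" "linear h"
    and "\<And>j. j \<in> Basis \<Longrightarrow> f (frechet_derivative (dev \<circ> chart_inv c) (at (snd c q)) j) =
      h (frechet_derivative (dev \<circ> chart_inv c) (at (snd c q)) j)"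
  shows "f u = h u"
proof -
  let ?l = "frechet_derivative (dev \<circ> chart_inv c) (at (snd c q))"
  have lin: "linear ?l"
    by (intro linear_frechet_derivative smooth_near_differentiable smooth_near_D c)
  define w where "w = der q u (snd c)"
  have "u = ?l w"
    using der_via_chart[OF smooth_near_D c, of u] by (simp add: w_def)
  also have "?l w = (\<Sum>j\<in>Basis. (w \<bullet> j) *\<^sub>R ?l j)" by (rule linear_Basis_expand[OF lin])
  finally have u: "u = (\<Sum>j\<in>Basis. (w \<bullet> j) *\<^sub>R ?l j)" .
  have e: "k u = (\<Sum>j\<in>Basis. (w \<bullet> j) *\<^sub>R k (?l j))" if "linear k" for k :: "'e \<Rightarrow> 'b"
    using arg_cong[OF u, of k] by (simp add: linear_sum[OF that] linear_scale[OF that])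
  show ?thesis using e[OF assms(3)] e[OF assms(4)] assms(5) by simp
qed

text \<open>The transition map between flat coordinates and \<open>dev\<close> is affine.\<close>

lemma der_flat_frame_zero:
  assumes c: "flat_chart A nab c" and q: "q \<in> fst c" and i: "i \<in> Basis"
  defines "l \<equiv> \<lambda>i r. frechet_derivative (dev \<circ> chart_inv c) (at (snd c r)) i"
  shows "smooth_near A q (l i)" "der q u (l i) = 0"
proof -
  have sc: "smooth_chart A c" using c by (simp add: flat_chart_def)
  note ic = smooth_chart_is_chart[OF sc]
  have U: "open (fst c)" by (rule is_chartD(1)[OF ic])
  have s: "smooth_near A r (l i)" if "r \<in> fst c" for r i
  proof (rule smooth_near_chartI[OF sc that open_UNIV])
    have "smooth_on (snd c ` (fst c \<inter> UNIV)) (dev \<circ> chart_inv c)"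
      by (rule smooth_near_imp_smooth_on[OF sc]) (rule smooth_near_D)
    from smooth_on_frechet_derivative[OF this, of i]
    show "smooth_on (snd c ` (fst c \<inter> UNIV)) (l i \<circ> chart_inv c)"
      by (rule smooth_on_cong[OF chart_image_open[OF ic open_UNIV], THEN iffD1, rotated])
        (auto simp: l_def chart_inv_chart[OF ic])
  qed simp
  then show "smooth_near A q (l i)" using q .
  have cf: "coord_field A c i r = tv r (l i r)" if "r \<in> fst c" for r i
    unfolding l_def by (rule coord_field_tv[OF sc that])
  have vf: "vector_field A (fst c) (coord_field A c i)" for i
    by (rule vector_fieldI[OF cf s])
  \<comment> \<open>The connection is differentiation of frame coefficients, and between coordinate
    fields of a flat chart it vanishes.\<close>
  have z: "der q (l j q) (l i) = 0" if "j \<in> Basis" for j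
  proof -
    have e: "vderiv (coord_field A c i r) dev = l i r" if "r \<in> fst c" for r
      by (simp add: cf[OF that])
    have s': "smooth_near A q (\<lambda>r. vderiv (coord_field A c i r) dev)"
      by (rule smooth_near_cong[OF s[OF q] U q]) (simp add: e)
    have "der q (l j q) (l i) = der q (l j q) (\<lambda>r. vderiv (coord_field A c i r) dev)"
      by (rule der_cong[OF U q]) (simp add: e)
    also have "\<dots> = vderiv (coord_field A c j q) (\<lambda>r. vderiv (coord_field A c i r) dev)"
      by (simp add: cf[OF q] vderiv_tv[OF s'])
    also have "\<dots> = vderiv (nab (coord_field A c j) (coord_field A c i) q) dev"
      using conjunct2[OF dev[unfolded development_map_def], rule_format,
          of "fst c" "coord_field A c j" "coord_field A c i" q] U vf[of i] vf[of j] q by simp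
    also have "nab (coord_field A c j) (coord_field A c i) q = (\<lambda>f. 0)"
      using c i that q by (simp add: flat_chart_def)
    also have "vderiv (\<lambda>f. 0) dev = 0" by (simp add: vderiv_def)
    finally show ?thesis .
  qed
  show "der q u (l i) = 0"
    using linear_eq_on_chart_frame[OF sc q linear_der[OF s[OF q]] linear_zero, of i u] z
    by (simp add: l_def)
qed

text \<open>The potential of a flat chart \<open>c\<close> also serves for \<open>dev\<close>: the
  coordinate fields of \<open>c\<close> have locally constant coefficients in the frame, so a second
  derivative of the potential along them produces no first-order correction.\<close>

lemma gram_hessian:
  obtains U \<phi> where "open U" "p \<in> U" "\<forall>q\<in>U. smooth_near A q (\<phi> :: 'a \<Rightarrow> real)"
    "\<forall>q\<in>U. \<forall>a b. gram q a b = der q a (\<lambda>r. der r b \<phi>)"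
proof -
  obtain c \<phi> where c: "flat_chart A nab c" "p \<in> fst c" "smooth_fun A (fst c) \<phi>"
    and g: "\<And>q i j. q \<in> fst c \<Longrightarrow> i \<in> Basis \<Longrightarrow> j \<in> Basis \<Longrightarrow>
      g q (coord_field A c i q) (coord_field A c j q) =
      coord_field A c i q (\<lambda>r. coord_field A c j r \<phi>)"
    using hess unfolding hessian_manifold_def by meson
  have sc: "smooth_chart A c" using c by (simp add: flat_chart_def)
  note ic = smooth_chart_is_chart[OF sc]
  have U: "open (fst c)" by (rule is_chartD(1)[OF ic])
  have s: "smooth_near A q \<phi>" if "q \<in> fst c" for q
    by (rule smooth_fun_near[OF c(3) U that])
  define l where "l i r = frechet_derivative (dev \<circ> chart_inv c) (at (snd c r)) i" for i r
  note l = der_flat_frame_zero[OF c(1), folded l_def]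
  have cf: "coord_field A c i r = tv r (l i r)" if "r \<in> fst c" for r i
    unfolding l_def by (rule coord_field_tv[OF sc that])
  have "gram q a b = der q a (\<lambda>r. der r b \<phi>)" if q: "q \<in> fst c" for q a b
  proof -
    have lin: "linear (\<lambda>b. der q a (\<lambda>r. der r b \<phi>))" for a
    proof (rule linearI)
      have "der q a (\<lambda>r. der r (x + y) \<phi>) = der q a (\<lambda>r. der r x \<phi> + der r y \<phi>)" for x y
        by (rule der_cong[OF U q]) (rule linear_add[OF linear_der[OF s]])
      then show "der q a (\<lambda>r. der r (x + y) \<phi>) = der q a (\<lambda>r. der r x \<phi>) + der q a (\<lambda>r. der r y \<phi>)" for x y
        by (simp add: der_add smooth_near_der s q)
      have "der q a (\<lambda>r. der r (k *\<^sub>R x) \<phi>) = der q a (\<lambda>r. k *\<^sub>R der r x \<phi>)" for x k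
        by (rule der_cong[OF U q]) (rule linear_scale[OF linear_der[OF s]])
      then show "der q a (\<lambda>r. der r (k *\<^sub>R x) \<phi>) = k *\<^sub>R der q a (\<lambda>r. der r x \<phi>)" for x k
        by (simp add: der_linear_comp[OF bounded_linear_scaleR_right] smooth_near_der s q del: real_scaleR_def)
    qed
    have basis: "gram q (l i q) (l j q) = der q (l i q) (\<lambda>r. der r (l j q) \<phi>)"
      if ij: "i \<in> Basis" "j \<in> Basis" for i j
    proof -
      have e: "coord_field A c j r \<phi> = der r (l j r) \<phi>" if "r \<in> fst c" for r
        by (simp add: cf[OF that] tv_apply s[OF that])
      have sm: "smooth_near A q (\<lambda>r. der r (l j r) \<phi>)"
        by (rule smooth_near_der_field[OF l(1)[OF q ij(2)] s[OF q]])
      have sm': "smooth_near A q (\<lambda>r. coord_field A c j r \<phi>)"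
        by (rule smooth_near_cong[OF sm U q]) (simp add: e)
      have "gram q (l i q) (l j q) = der q (l i q) (\<lambda>r. coord_field A c j r \<phi>)"
        unfolding gram_def using g[OF q ij] by (simp add: cf[OF q] tv_apply sm')
      also have "\<dots> = der q (l i q) (\<lambda>r. der r (l j r) \<phi>)"
        by (rule der_cong[OF U q e])
      \<comment> \<open>Freezing the inner direction at \<open>q\<close> costs only a derivative of
        \<open>l j\<close>, which is zero.\<close>
      also have "\<dots> = der q (l i q) (\<lambda>r. der r (l j q) \<phi>)"
        using linear_0[OF linear_der[OF s[OF q]]]
        by (simp add: der_der_field[OF l(1)[OF q ij(2)] s[OF q]] l(2)[OF q ij(2)])
      finally show ?thesis .
    qed
    \<comment> \<open>The identity is extended from coordinate vectors to all vectors, one argument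
      at a time.\<close>
    have "gram q a (l j q) = der q a (\<lambda>r. der r (l j q) \<phi>)" if "j \<in> Basis" for j
      using linear_eq_on_chart_frame[OF sc q, of "\<lambda>a. gram q a (l j q)"
          "\<lambda>a. der q a (\<lambda>r. der r (l j q) \<phi>)"] basis[OF _ that] bilinear_gram[of q]
        linear_der[OF smooth_near_der[OF s[OF q]]]
      by (simp add: l_def bilinear_def)
    then show ?thesis
      using linear_eq_on_chart_frame[OF sc q, of "gram q a" "\<lambda>b. der q a (\<lambda>r. der r b \<phi>)"]
        bilinear_gram[of q] lin
      by (simp add: l_def bilinear_def)
  qed
  then show thesis using that[OF U c(2)] s by blast
qed

lemma codazzi: "der p a (\<lambda>q. gram q b k) = der p b (\<lambda>q. gram q a k)"
proof -
  obtain U \<phi> where U: "open U" "p \<in> U" and s: "\<forall>q\<in>U. smooth_near A q (\<phi> :: 'a \<Rightarrow> real)"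
    and h: "\<forall>q\<in>U. \<forall>a b. gram q a b = der q a (\<lambda>r. der r b \<phi>)"
    by (rule gram_hessian)
  have "der p a (\<lambda>q. gram q b k) = der p a (\<lambda>q. der q b (\<lambda>r. der r k \<phi>))" for a b
    by (rule der_cong[OF U]) (simp add: h)
  then show ?thesis using der_commute[OF smooth_near_der[OF bspec[OF s U(2)]], of a b k] by simp
qed

section \<open>The complex structure and the metric in the frame of the tangent bundle\<close>

abbreviation J :: "'e \<times> 'e \<Rightarrow> 'e \<times> 'e" where
  "J z \<equiv> (- snd z, fst z)"

lemma smooth_near_dev_fst: "smooth_near (TM_atlas A dev) q (dev \<circ> fst)"
  using TM.smooth_near_linear[OF bounded_linear_fst TM.smooth_near_D] by (simp add: o_def)

lemma smooth_near_snd: "smooth_near (TM_atlas A dev) q snd"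
  using TM.smooth_near_linear[OF bounded_linear_snd TM.smooth_near_D] by simp

lemma TM_der_dev_fst: "TM.der q w (dev \<circ> fst) = fst w"
  using TM.der_linear_comp[OF bounded_linear_fst TM.smooth_near_D] by (simp add: o_def)

lemma TM_der_snd: "TM.der q w snd = snd w"
  using TM.der_linear_comp[OF bounded_linear_snd TM.smooth_near_D] by simp

text \<open>In the two frames the differential of the bundle projection is \<open>fst\<close>; this
  transports the derivatives of \<open>gram\<close> from the base to the bundle.\<close>

sublocale proj: etale_map "TM_atlas A dev" "\<lambda>z. (dev (fst z), snd z)" A dev fst
  by unfold_locales (auto intro: continuous_on_fst smooth_near_dev_fst)

lemma pushforward_fst: "pushforward A fst q (TM.tv q w) = tv (fst q) (fst w)"
  by (simp add: proj.pushforward_tv TM_der_dev_fst)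

lemma TM_components_tv: "TM_components dev (TM.tv q w) = w"
  by (simp add: TM_components_def TM.vderiv_tv smooth_near_dev_fst smooth_near_snd TM_der_dev_fst TM_der_snd)

text \<open>\<open>TM_components\<close> inverts the frame at \<open>q\<close>, so exactly one
  tangent vector has the prescribed components and the definite description is resolved.\<close>

lemma TM_complex_tv: "TM_complex A dev q (TM.tv q w) = TM.tv q (J w)"
  unfolding TM_complex_def
proof (rule the_equality)
  fix \<eta> assume \<eta>: "\<eta> \<in> tangent_space (TM_atlas A dev) q \<and>
    (\<forall>X Y. TM_components dev (TM.tv q w) = (X, Y) \<longrightarrow> TM_components dev \<eta> = (- Y, X))"
  then obtain z where "\<eta> = TM.tv q z" by (auto simp: TM.tangent_space_eq)
  then show "\<eta> = TM.tv q (J w)" using \<eta> by (cases w) (simp add: TM_components_tv)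
qed (auto simp: TM_components_tv TM.tangent_space_eq)

lemma TM_metric_tv: "TM_metric A dev g q (TM.tv q w) (TM.tv q z) =
    gram (fst q) (fst w) (fst z) + gram (fst q) (snd w) (snd z)"
  by (simp add: TM_metric_def TM_complex_tv pushforward_fst flip: gram_def)
    (simp add: bilinear_lneg[OF bilinear_gram] bilinear_rneg[OF bilinear_gram])

lemma smooth_near_TM_gram: "smooth_near (TM_atlas A dev) q (\<lambda>r. gram (fst r) a b)"
  using proj.smooth_near_comp[OF smooth_near_gram, of q a b] by (simp add: o_def)

lemma der_TM_gram: "TM.der q w (\<lambda>r. gram (fst r) a b) = der (fst q) (fst w) (\<lambda>m. gram m a b)"
  using proj.der_comp[OF smooth_near_gram, of q w a b] by (simp add: o_def TM_der_dev_fst[unfolded o_def])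

lemma bounded_linear_J: "bounded_linear J"
  by (intro bounded_linear_Pair bounded_linear_minus bounded_linear_fst bounded_linear_snd)

lemma complex_structure_TM: "complex_structure (TM_atlas A dev) (TM_complex A dev)"
  unfolding complex_structure_def
proof (intro conjI allI ballI impI; (elim conjE)?)
  fix p u assume "u \<in> tangent_space (TM_atlas A dev) p"
  then obtain w where w: "u = TM.tv p w" by (auto simp: TM.tangent_space_eq)
  show "TM_complex A dev p u \<in> tangent_space (TM_atlas A dev) p"
    by (simp add: w TM_complex_tv TM.tangent_space_eq)
  show "TM_complex A dev p (TM_complex A dev p u) = (\<lambda>f. - u f)"
    using TM.tv_minus[of p w] by (simp add: w TM_complex_tv uminus_prod_def)
  fix v a b assume "v \<in> tangent_space (TM_atlas A dev) p"
  then obtain z where z: "v = TM.tv p z" by (auto simp: TM.tangent_space_eq)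
  show "TM_complex A dev p (\<lambda>f. a * u f + b * v f) =
      (\<lambda>f. a * TM_complex A dev p u f + b * TM_complex A dev p v f)"
    by (simp add: w z TM_complex_tv flip: TM.tv_lincomb)
next
  fix W X assume W: "open W" and X: "vector_field (TM_atlas A dev) W X"
  let ?x = "\<lambda>q. vderiv (X q) (\<lambda>z. (dev (fst z), snd z))"
  show "vector_field (TM_atlas A dev) W (\<lambda>p. TM_complex A dev p (X p))"
  proof (rule TM.vector_fieldI[where x = "\<lambda>q. J (?x q)"])
    fix p assume p: "p \<in> W"
    show "TM_complex A dev p (X p) = TM.tv p (J (?x p))"
      using TM.vector_fieldD(1)[OF X W p] TM_complex_tv by metis
    show "smooth_near (TM_atlas A dev) p (\<lambda>q. J (?x q))"
      by (rule TM.smooth_near_linear[OF bounded_linear_J TM.vector_fieldD(2)[OF X W p]])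
  qed
next
  fix p
  let ?c = "(TM.frame_dom p, \<lambda>z :: 'a \<times> 'e. (dev (fst z), snd z))"
  \<comment> \<open>In this chart the coordinate fields are the constant frame fields, on which the
    complex structure acts by the fixed map \<open>J\<close>.\<close>
  have "coord_field (TM_atlas A dev) ?c u q = TM.tv q u" if "q \<in> fst ?c" for q u
    using TM.coord_field_tv[OF TM.frame_dom(2)[of p] that]
      TM.chart_derivative_self[OF TM.frame_dom(2)[of p] that] by simp
  then show "\<exists>c. smooth_chart (TM_atlas A dev) c \<and> p \<in> fst c \<and>
      (\<forall>q\<in>fst c. \<forall>a b. TM_complex A dev q (coord_field (TM_atlas A dev) c (a, b) q) =
        coord_field (TM_atlas A dev) c (- b, a) q)"
    using TM.frame_dom[of p] by (intro exI[of _ ?c]) (simp add: TM_complex_tv)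
qed

lemma riemannian_metric_TM: "riemannian_metric (TM_atlas A dev) (TM_metric A dev g)"
  unfolding riemannian_metric_def
proof (intro conjI allI ballI impI; (elim conjE)?)
  fix p u v
  assume "u \<in> tangent_space (TM_atlas A dev) p" "v \<in> tangent_space (TM_atlas A dev) p"
  then obtain x y where u: "u = TM.tv p x" and v: "v = TM.tv p y" by (auto simp: TM.tangent_space_eq)
  show "TM_metric A dev g p u v = TM_metric A dev g p v u"
    by (simp add: u v TM_metric_tv gram_commute)
  fix w a b assume "w \<in> tangent_space (TM_atlas A dev) p"
  then obtain z where w: "w = TM.tv p z" by (auto simp: TM.tangent_space_eq)
  show "TM_metric A dev g p (\<lambda>f. a * u f + b * v f) w =
      a * TM_metric A dev g p u w + b * TM_metric A dev g p v w"
    by (simp add: u v w flip: TM.tv_lincomb) (simp add: TM_metric_tv gram_lincomb algebra_simps)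
next
  fix p u assume "u \<in> tangent_space (TM_atlas A dev) p" "u \<noteq> (\<lambda>f. 0)"
  then obtain x where u: "u = TM.tv p x" and "TM.tv p x \<noteq> (\<lambda>f. 0)"
    unfolding TM.tangent_space_eq by blast
  then have x: "x \<noteq> 0" using TM.tv_zero[of p] by blast
  have nonneg: "gram (fst p) y y \<ge> 0" for y
    using gram_pos[of y "fst p"] bilinear_lzero[OF bilinear_gram] by (cases "y = 0") auto
  have "fst x \<noteq> 0 \<or> snd x \<noteq> 0" using x by (auto simp: prod_eq_iff)
  then show "TM_metric A dev g p u u > 0"
    using gram_pos nonneg by (auto simp: u TM_metric_tv intro: add_pos_nonneg add_nonneg_pos)
next
  fix W X Y
  assume W: "open W" and X: "vector_field (TM_atlas A dev) W X" and Y: "vector_field (TM_atlas A dev) W Y"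
  let ?x = "\<lambda>X q. vderiv (X q) (\<lambda>z. (dev (fst z), snd z))"
  show "smooth_fun (TM_atlas A dev) W (\<lambda>p. TM_metric A dev g p (X p) (Y p))"
  proof (rule TM.smooth_funI)
    fix p assume p: "p \<in> W"
    define S where "S q w z = gram (fst q) (fst w) (fst z) + gram (fst q) (snd w) (snd z)"
      for q :: "'a \<times> 'e" and w z :: "'e \<times> 'e"
    have bil: "bilinear (S q)" for q
      unfolding S_def bilinear_def
      by (auto intro!: linearI simp: bilinear_ladd[OF bilinear_gram] bilinear_radd[OF bilinear_gram]
          bilinear_lmul[OF bilinear_gram] bilinear_rmul[OF bilinear_gram] algebra_simps)
    have "smooth_near (TM_atlas A dev) p (\<lambda>q. S q a b)" for a b
      unfolding S_def by (intro TM.smooth_near_add smooth_near_TM_gram)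
    from TM.smooth_near_bilinear_form[OF bil this TM.vector_fieldD(2)[OF X W p] TM.vector_fieldD(2)[OF Y W p]]
    show "smooth_near (TM_atlas A dev) p (\<lambda>q. TM_metric A dev g q (X q) (Y q))"
    proof (rule TM.smooth_near_cong[OF _ W p])
      fix q assume q: "q \<in> W"
      show "S q (?x X q) (?x Y q) = TM_metric A dev g q (X q) (Y q)"
        using TM_metric_tv[of q "?x X q" "?x Y q"]
          TM.vector_fieldD(1)[OF X W q] TM.vector_fieldD(1)[OF Y W q] by (simp add: S_def)
    qed
  qed
qed

text \<open>The coefficients of the Kaehler form are those of \<open>g\<close> pulled back from \<open>M\<close>, so that the form is
  closed by the Codazzi equation.\<close>

lemma closed_kaehler_form_TM:
  "closed_2form (TM_atlas A dev) (\<lambda>p u v. TM_metric A dev g p (TM_complex A dev p u) v)"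
proof (rule TM.closed_2formI)
  fix q u v w
  \<comment> \<open>The complex structure exchanges horizontal and vertical components up to sign,
    so only mixed terms occur.\<close>
  have e: "TM_metric A dev g q (TM_complex A dev q (TM.tv q u)) (TM.tv q v) =
      gram (fst q) (fst u) (snd v) - gram (fst q) (snd u) (fst v)" for q u v
    by (simp add: TM_complex_tv TM_metric_tv bilinear_lneg[OF bilinear_gram])
  show "bilinear (\<lambda>u v. TM_metric A dev g q (TM_complex A dev q (TM.tv q u)) (TM.tv q v))"
    unfolding e bilinear_def
    by (auto intro!: linearI simp: bilinear_ladd[OF bilinear_gram] bilinear_radd[OF bilinear_gram]
        bilinear_lmul[OF bilinear_gram] bilinear_rmul[OF bilinear_gram] algebra_simps)
  show "TM_metric A dev g q (TM_complex A dev q (TM.tv q u)) (TM.tv q v) =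
      - TM_metric A dev g q (TM_complex A dev q (TM.tv q v)) (TM.tv q u)"
    unfolding e by (simp add: gram_commute)
  show "smooth_near (TM_atlas A dev) q (\<lambda>q. TM_metric A dev g q (TM_complex A dev q (TM.tv q u)) (TM.tv q v))"
    unfolding e by (intro TM.smooth_near_diff smooth_near_TM_gram)
  \<comment> \<open>Only the horizontal part of the direction differentiates coefficients that come
    from the base. By symmetry of \<open>gram\<close> the vertical component is placed last, as
    \<open>codazzi\<close> expects.\<close>
  have d: "TM.der q u (\<lambda>q. TM_metric A dev g q (TM_complex A dev q (TM.tv q v)) (TM.tv q w)) =
      der (fst q) (fst u) (\<lambda>m. gram m (fst v) (snd w)) - der (fst q) (fst u) (\<lambda>m. gram m (fst w) (snd v))"
    for u v w
    unfolding e by (simp add: TM.der_diff smooth_near_TM_gram der_TM_gram gram_commute[of _ "snd v"])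
  \<comment> \<open>The six terms pair off according to which vector contributes its vertical
    component; each pair cancels by one instance of \<open>codazzi\<close>.\<close>
  show "TM.der q u (\<lambda>q. TM_metric A dev g q (TM_complex A dev q (TM.tv q v)) (TM.tv q w)) +
      TM.der q v (\<lambda>q. TM_metric A dev g q (TM_complex A dev q (TM.tv q w)) (TM.tv q u)) +
      TM.der q w (\<lambda>q. TM_metric A dev g q (TM_complex A dev q (TM.tv q u)) (TM.tv q v)) = 0"
    unfolding d
    using codazzi[of "fst q" "fst u" "fst v" "snd w"] codazzi[of "fst q" "fst v" "fst w" "snd u"]
      codazzi[of "fst q" "fst w" "fst u" "snd v"] by simp
qed

lemma kaehler_TM: "kaehler_manifold (TM_atlas A dev) (TM_complex A dev) (TM_metric A dev g)"
  unfolding kaehler_manifold_def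
proof (intro conjI allI ballI)
  fix p u v
  assume "u \<in> tangent_space (TM_atlas A dev) p" "v \<in> tangent_space (TM_atlas A dev) p"
  then obtain x y where "u = TM.tv p x" "v = TM.tv p y" by (auto simp: TM.tangent_space_eq)
  then show "TM_metric A dev g p (TM_complex A dev p u) (TM_complex A dev p v) = TM_metric A dev g p u v"
    by (simp add: TM_complex_tv TM_metric_tv bilinear_lneg[OF bilinear_gram] bilinear_rneg[OF bilinear_gram])
qed (auto intro: TM.mfd complex_structure_TM riemannian_metric_TM closed_kaehler_form_TM)

end

section \<open>Affine isometries and the induced affine action\<close>

text \<open>Any two loops are freely homotopic, in particular the constant loops at \<open>a\<close>
  and \<open>b\<close>; the base point then runs along a path from \<open>a\<close> to
  \<open>b\<close>.\<close>

lemma simply_connected_imp_connected_space: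
  assumes "simply_connected (UNIV :: 'a::topological_space set)"
  shows "connected (UNIV :: 'a set)"
  unfolding connected_iff_connected_component
proof (intro ballI)
  fix a b :: 'a
  have p: "path (\<lambda>_. x)" "path_image (\<lambda>_. x) \<subseteq> UNIV" "pathfinish (\<lambda>_. x) = pathstart (\<lambda>_. x)" for x :: 'a
    by (auto simp: path_def pathfinish_def pathstart_def)
  have "homotopic_loops UNIV (\<lambda>_. a) (\<lambda>_. b)"
    using assms p[of a] p[of b] unfolding simply_connected_def by blast
  then obtain h :: "real \<times> real \<Rightarrow> 'a" where h: "continuous_on ({0..1} \<times> {0..1}) h"
      "\<forall>x\<in>{0..1}. h (0, x) = a" "\<forall>x\<in>{0..1}. h (1, x) = b"
    unfolding homotopic_loops by blast
  have "continuous_on {0..1} (\<lambda>t. h (t, 0))"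
    by (rule continuous_on_compose2[OF h(1)]) (auto intro: continuous_intros)
  then have "connected ((\<lambda>t. h (t, 0)) ` {0..1})"
    by (rule connected_continuous_image) simp
  moreover have "a \<in> (\<lambda>t. h (t, 0)) ` {0..1}" "b \<in> (\<lambda>t. h (t, 0)) ` {0..1}"
    using h(2,3) by (auto intro: rev_image_eqI[of 0] rev_image_eqI[of 1])
  ultimately show "connected_component UNIV a b" by (auto simp: connected_component_def)
qed

lemma affine_map_eq_on_open:
  fixes f h :: "'e::euclidean_space \<Rightarrow> 'e"
  assumes "affine_map f" "affine_map h" "open S" "x \<in> S" "\<And>y. y \<in> S \<Longrightarrow> f y = h y"
  shows "f = h"
proof
  obtain L t M s where L: "linear L" "f = (\<lambda>v. L v + t)" and M: "linear M" "h = (\<lambda>v. M v + s)"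
    using assms(1,2) by (auto simp: affine_map_def)
  obtain r where r: "r > 0" "ball x r \<subseteq> S" using assms(3,4) openE by blast
  have lin: "L v = M v" for v
  proof -
    \<comment> \<open>Any vector is scaled until \<open>x + k v\<close> stays in the ball; the
      summand 1 covers \<open>v = 0\<close>.\<close>
    define k where "k = r / (2 * (norm v + 1))"
    have k: "k > 0" using r(1) by (simp add: k_def add_nonneg_pos)
    have "k * norm v < r"
    proof -
      have "k * norm v \<le> k * (norm v + 1)" using k by simp
      also have "\<dots> = r / 2"
        using norm_ge_zero[of v] by (simp add: k_def field_simps add_nonneg_eq_0_iff)
      finally show ?thesis using r(1) by linarith
    qed
    then have "x + k *\<^sub>R v \<in> S" using r(2) k by (auto simp: dist_norm)
    then have "f (x + k *\<^sub>R v) - f x = h (x + k *\<^sub>R v) - h x" using assms(4,5) by simp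
    then have "k *\<^sub>R L v = k *\<^sub>R M v" by (simp add: L M linear_add linear_scale)
    then show ?thesis using k by simp
  qed
  then show "f v = h v" for v using assms(5)[OF assms(4)] by (simp add: L M)
qed

context developed_hessian_mfd
begin

text \<open>The development condition only gives the image of \<open>nab X Y p\<close> under the
  differential of \<open>dev\<close>. Since \<open>nab X Y\<close> is a vector field, that image
  determines it.\<close>

lemma nab_tv:
  assumes X: "vector_field A W X" and Y: "vector_field A W Y" and W: "open W" "p \<in> W"
  shows "nab X Y p = tv p (der p (vderiv (X p) dev) (\<lambda>q. vderiv (Y q) dev))"
proof -
  have "\<forall>W X Y. open W \<and> vector_field A W X \<and> vector_field A W Y \<longrightarrow> vector_field A W (nab X Y)"
    using hess unfolding hessian_manifold_def flat_affine_manifold_def connection_def by (elim conjE)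
  then have "vector_field A W (nab X Y)" using X Y W(1) by blast
  then have "nab X Y p = tv p (vderiv (nab X Y p) dev)" by (rule vector_fieldD(1)[OF _ W])
  also have "vderiv (nab X Y p) dev = vderiv (X p) (\<lambda>q. vderiv (Y q) dev)"
    using conjunct2[OF dev[unfolded development_map_def], rule_format, of W X Y p] X Y W by simp
  also have "X p = tv p (vderiv (X p) dev)" by (rule vector_fieldD(1)[OF X W])
  finally show ?thesis by (simp add: vderiv_tv[OF vector_fieldD(2)[OF Y W]])
qed

text \<open>Affine isometries in finite-dimensional terms, with the linear part and translation as
  explicit data. Being a homeomorphism is enough, since smoothness follows from the affine formula
  for \<open>dev o F\<close>.\<close>

definition affine_iso :: "('a \<Rightarrow> 'a) \<Rightarrow> ('e \<Rightarrow> 'e) \<Rightarrow> 'e \<Rightarrow> bool" where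
  "affine_iso F L t \<longleftrightarrow> bij F \<and> continuous_on UNIV F \<and> continuous_on UNIV (inv_into UNIV F) \<and>
     linear L \<and> bij L \<and> (\<forall>p. dev (F p) = L (dev p) + t) \<and>
     (\<forall>p u v. gram (F p) (L u) (L v) = gram p u v)"

lemma affine_iso_id: "affine_iso id id 0"
  by (simp add: affine_iso_def linear_id)

lemma affine_iso_comp:
  assumes "affine_iso F L t" "affine_iso H M s"
  shows "affine_iso (F \<circ> H) (L \<circ> M) (L s + t)"
proof -
  have "continuous_on UNIV (F \<circ> H)" "continuous_on UNIV (inv_into UNIV H \<circ> inv_into UNIV F)"
    using assms unfolding affine_iso_def o_def by (auto intro: continuous_on_compose2)
  then show ?thesis
    using assms by (simp add: affine_iso_def bij_comp linear_compose o_inv_distrib linear_add)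
qed

lemma affine_iso_inv:
  assumes "affine_iso F L t"
  shows "affine_iso (inv_into UNIV F) (inv_into UNIV L) (- inv_into UNIV L t)"
proof -
  have b: "bij F" "bij L" "linear L" and c: "continuous_on UNIV F" "continuous_on UNIV (inv_into UNIV F)"
    and d: "\<And>p. dev (F p) = L (dev p) + t" and g: "\<And>p u v. gram (F p) (L u) (L v) = gram p u v"
    using assms by (auto simp: affine_iso_def)
  have L: "linear (inv_into UNIV L)"
    using b by (intro inj_linear_imp_inv_linear bij_is_inj)
  have s: "F (inv_into UNIV F p) = p" "L (inv_into UNIV L u) = u" "inv_into UNIV L (L u) = u" for p u
    using b by (simp_all add: bij_is_surj surj_f_inv_f bij_is_inj)
  have "dev (inv_into UNIV F p) = inv_into UNIV L (dev p) + (- inv_into UNIV L t)" for p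
    using arg_cong[OF d[of "inv_into UNIV F p"], of "inv_into UNIV L"] by (simp add: s linear_add[OF L])
  moreover have "gram (inv_into UNIV F p) (inv_into UNIV L u) (inv_into UNIV L v) = gram p u v" for p u v
    using g[of "inv_into UNIV F p" "inv_into UNIV L u" "inv_into UNIV L v"] by (simp add: s)
  ultimately show ?thesis
    using b c L by (simp add: affine_iso_def bij_imp_bij_inv inv_inv_eq)
qed

lemma affine_iso_etale_map:
  assumes F: "affine_iso F L t"
  shows "etale_map A dev A dev F" "der p u (dev \<circ> F) = L u"
proof -
  have L: "bounded_linear L" using F by (simp add: affine_iso_def linear_conv_bounded_linear)
  have e: "dev \<circ> F = (\<lambda>q. L (dev q) + t)" using F by (auto simp: affine_iso_def)
  show "etale_map A dev A dev F"
    using F by unfold_locales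
      (auto simp: affine_iso_def e intro!: smooth_near_add smooth_near_const smooth_near_linear[OF L] smooth_near_D)
  show "der p u (dev \<circ> F) = L u"
    unfolding e by (simp add: der_add smooth_near_linear[OF L] smooth_near_D smooth_near_const
        der_linear_comp[OF L])
qed

text \<open>Pushing a field forward replaces its coefficient \<open>x\<close> by
  \<open>L o x o inv F\<close>. The constant \<open>L\<close> passes through the derivative, and the
  chain rule removes \<open>inv F\<close>.\<close>

lemma affine_iso_preserves_connection:
  assumes F: "affine_iso F L t"
  shows "preserves_connection A nab F"
  unfolding preserves_connection_def
proof (intro allI impI ballI, elim conjE)
  fix W X Y p
  assume W: "open W" "p \<in> W" and X: "vector_field A W X" and Y: "vector_field A W Y"
  note iF = affine_iso_etale_map[OF F] and iI = affine_iso_etale_map[OF affine_iso_inv[OF F]]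
  have b: "bij F" "bij L" "linear L" and ci: "continuous_on UNIV (inv_into UNIV F)"
    using F by (auto simp: affine_iso_def)
  have L: "bounded_linear L" using b by (simp add: linear_conv_bounded_linear)
  have s: "F (inv_into UNIV F p) = p" "inv_into UNIV F (F p) = p" "inv_into UNIV L (L u) = u" for p u
    using b by (simp_all add: bij_is_surj surj_f_inv_f bij_is_inj)
  \<comment> \<open>The image of \<open>W\<close> under \<open>F\<close>, written as a preimage
    under the continuous inverse so that it is open.\<close>
  define V where "V = inv_into UNIV F -` W"
  have V: "open V" "F p \<in> V" using W ci by (simp_all add: V_def open_vimage s)
  have push: "pushforward A F q (tv q w) = tv (F q) (L w)" for q w
    by (simp add: etale_map.pushforward_tv[OF iF(1)] iF(2))
  have pf: "push_field A F Z q = tv q (L (vderiv (Z (inv_into UNIV F q)) dev))"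
    if Z: "vector_field A W Z" and q: "q \<in> V" for Z q
    using vector_fieldD(1)[OF Z W(1), of "inv_into UNIV F q"] q push[of "inv_into UNIV F q" "vderiv (Z (inv_into UNIV F q)) dev"]
    by (simp add: push_field_def V_def s)
  have sm: "smooth_near A q (\<lambda>q. vderiv (Z (inv_into UNIV F q)) dev)"
    if Z: "vector_field A W Z" and q: "q \<in> V" for Z q
    using etale_map.smooth_near_comp[OF iI(1) vector_fieldD(2)[OF Z W(1), of "inv_into UNIV F q"]] q
    by (simp add: V_def o_def)
  have vf: "vector_field A V (push_field A F Z)" if Z: "vector_field A W Z" for Z
    by (rule vector_fieldI[OF pf[OF Z]]) (auto intro: smooth_near_linear[OF L] sm[OF Z])
  let ?x = "vderiv (X p) dev" and ?y = "\<lambda>q. vderiv (Y q) dev"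
  have "der (F p) (L ?x) (\<lambda>q. vderiv (push_field A F Y q) dev) = der (F p) (L ?x) (\<lambda>q. L (?y (inv_into UNIV F q)))"
    by (rule der_cong[OF V]) (simp add: pf[OF Y])
  also have "\<dots> = L (der (F p) (L ?x) (?y \<circ> inv_into UNIV F))"
    by (simp add: der_linear_comp[OF L sm[OF Y V(2)]] o_def)
  \<comment> \<open>The differential of \<open>inv F\<close> sends the direction \<open>L ?x\<close>
    back to \<open>?x\<close>.\<close>
  also have "der (F p) (L ?x) (?y \<circ> inv_into UNIV F) = der p ?x ?y"
    using etale_map.der_comp[OF iI(1), of "F p" ?y "L ?x"] vector_fieldD(2)[OF Y W] by (simp add: s iI(2))
  finally show "pushforward A F p (nab X Y p) = nab (push_field A F X) (push_field A F Y) (F p)"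
    by (simp add: nab_tv[OF X Y W] nab_tv[OF vf[OF X] vf[OF Y] V] push pf[OF X V(2)] s)
qed

lemma affine_iso_imp_affine_isometry:
  assumes F: "affine_iso F L t"
  shows "affine_isometry A nab g F"
  unfolding affine_isometry_def
proof (intro conjI)
  show "diffeomorphism A F"
    using F etale_map.smooth_map[OF affine_iso_etale_map(1)[OF F]]
      etale_map.smooth_map[OF affine_iso_etale_map(1)[OF affine_iso_inv[OF F]]]
    by (simp add: diffeomorphism_def affine_iso_def)
  show "preserves_connection A nab F" by (rule affine_iso_preserves_connection[OF F])
  have "pushforward A F q (tv q w) = tv (F q) (L w)" for q w
    using affine_iso_etale_map[OF F] by (simp add: etale_map.pushforward_tv)
  then show "preserves_metric A g F"
    using F by (auto simp: preserves_metric_def tangent_space_eq affine_iso_def gram_def)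
qed

lemma affine_isometry_imp_affine_iso:
  assumes conn: "connected (UNIV :: 'a set)" and F: "affine_isometry A nab g F"
  obtains L t where "affine_iso F L t"
proof -
  have b: "bij F" and sF: "smooth_map A A F" and sI: "smooth_map A A (inv_into UNIV F)"
    using F by (simp_all add: affine_isometry_def diffeomorphism_def)
  have em: "etale_mfd A dev" by unfold_locales
  interpret F: etale_map A dev A dev F by (rule smooth_map_imp_etale_map[OF em em sF])
  interpret I: etale_map A dev A dev "inv_into UNIV F" by (rule smooth_map_imp_etale_map[OF em em sI])
  have s: "F (inv_into UNIV F p) = p" "inv_into UNIV F (F p) = p" for p
    using b by (simp_all add: bij_is_surj surj_f_inv_f bij_is_inj)
  \<comment> \<open>The coefficient at \<open>r\<close> of the image under \<open>F\<close> of the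
    parallel field with coefficient \<open>u\<close>; the differential is taken at the source point
    of \<open>r\<close>.\<close>
  define K where "K u r = der (inv_into UNIV F r) u (dev \<circ> F)" for u r
  have smK: "smooth_near A r (K u)" for u r
    using I.smooth_near_comp[OF smooth_near_der[OF F.smooth], of r u] by (simp add: K_def[abs_def] o_def)
  have pf: "push_field A F (\<lambda>q. tv q u) r = tv r (K u r)" for u r
    by (simp add: push_field_def F.pushforward_tv s K_def)
  have vt: "vector_field A UNIV (\<lambda>q. tv q u)" for u
    by (rule vector_fieldI[where x = "\<lambda>q. u"]) (simp_all add: smooth_near_const)
  have vp: "vector_field A UNIV (push_field A F (\<lambda>q. tv q u))" for u
    by (rule vector_fieldI[where x = "K u"]) (simp_all add: pf smK)
  \<comment> \<open>From \<open>F o inv F = id\<close>: the vectors \<open>K u r\<close> exhaust all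
    directions at \<open>r\<close>, so a derivative that vanishes along them vanishes
    altogether.\<close>
  have surj: "K (der r w (dev \<circ> inv_into UNIV F)) r = w" for r w
  proof -
    have "K (der r w (dev \<circ> inv_into UNIV F)) r = der r w ((dev \<circ> F) \<circ> inv_into UNIV F)"
      unfolding K_def by (rule I.der_comp[OF F.smooth, symmetric])
    also have "(dev \<circ> F) \<circ> inv_into UNIV F = dev" by (auto simp: s)
    also have "der r w dev = w" by (rule der_D)
    finally show ?thesis .
  qed
  \<comment> \<open>The covariant derivative of parallel fields is 0, and so is its image, hence
    that of the image fields. The direction 0 below is the derivative of the constant coefficient
    \<open>v\<close>.\<close>
  have zero: "der r (K u r) (K v) = 0" for u v r
  proof -
    have "tv r (der (inv_into UNIV F r) 0 (dev \<circ> F)) = pushforward A F (inv_into UNIV F r) (nab (\<lambda>q. tv q u) (\<lambda>q. tv q v) (inv_into UNIV F r))"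
      using nab_tv[OF vt[of u] vt[of v], of "inv_into UNIV F r"] by (simp add: F.pushforward_tv s)
    also have "\<dots> = nab (push_field A F (\<lambda>q. tv q u)) (push_field A F (\<lambda>q. tv q v)) (F (inv_into UNIV F r))"
      using F vt[of u] vt[of v] open_UNIV unfolding affine_isometry_def preserves_connection_def by blast
    also have "\<dots> = tv r (der r (K u r) (K v))"
      using nab_tv[OF vp[of u] vp[of v] open_UNIV, of r] by (simp add: s pf)
    finally show ?thesis
      using linear_0[OF linear_der[OF F.smooth]] by (simp add: tv_eq_iff)
  qed
  then have "der r w (K v) = 0" for r w v using zero[of r "der r w (dev \<circ> inv_into UNIV F)" v] by (simp add: surj)
  then have const: "K v r = K v r'" for v r r' by (rule der_zero_constant[OF conn smK])
  \<comment> \<open>\<open>undefined\<close> is an arbitrary base point, whose choice is immaterial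
    by \<open>const\<close>.\<close>
  define L where "L v = K v (F undefined)" for v
  have dL: "der p u (dev \<circ> F) = L u" for p u
    using const[of u "F p" "F undefined"] by (simp add: L_def K_def s)
  have L: "linear L"
    using linear_der[OF F.smooth, of undefined] by (simp add: L_def[abs_def] K_def s)
  then have bL: "bounded_linear L" by (simp add: linear_conv_bounded_linear)
  have "surj L"
    using surj[of "F undefined"] unfolding L_def surj_def by metis
  then have "bij L" using L linear_surj_imp_inj unfolding bij_def by blast
  define t where "t = dev (F undefined) - L (dev undefined)"
  have "(\<lambda>q. (dev \<circ> F) q - L (dev q)) p = (\<lambda>q. (dev \<circ> F) q - L (dev q)) undefined" for p
  proof (rule der_zero_constant[OF conn])
    have sL: "smooth_near A p (\<lambda>q. L (dev q))" for p by (rule smooth_near_linear[OF bL smooth_near_D])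
    show "smooth_near A p (\<lambda>q. (dev \<circ> F) q - L (dev q))" for p
      by (rule smooth_near_diff[OF F.smooth sL])
    show "der p u (\<lambda>q. (dev \<circ> F) q - L (dev q)) = 0" for p u
      using der_diff[OF F.smooth sL, of p u] dL[of p u] by (simp add: der_linear_comp[OF bL smooth_near_D])
  qed
  then have "dev (F p) = L (dev p) + t" for p by (simp add: t_def algebra_simps)
  moreover have "gram (F p) (L u) (L v) = gram p u v" for p u v
  proof -
    have "g (F p) (pushforward A F p (tv p u)) (pushforward A F p (tv p v)) = g p (tv p u) (tv p v)"
      using F unfolding affine_isometry_def preserves_metric_def by simp
    then show ?thesis by (simp add: F.pushforward_tv dL gram_def)
  qed
  ultimately have "affine_iso F L t"
    using b F.continuous I.continuous L \<open>bij L\<close> by (simp add: affine_iso_def)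
  then show thesis by (rule that)
qed

text \<open>The image of \<open>dev\<close> has interior points, so an affine map is determined on it.\<close>

lemma induced_affine_action_eq:
  assumes "affine_iso F L t"
  shows "induced_affine_action dev (\<lambda>a. a) F = (\<lambda>v. L v + t)"
  unfolding induced_affine_action_def
proof (rule the_equality)
  have a: "affine_map (\<lambda>v. L v + t)" using assms by (auto simp: affine_map_def affine_iso_def)
  then show "affine_map (\<lambda>v. L v + t) \<and> dev \<circ> F = (\<lambda>v. L v + t) \<circ> dev"
    using assms by (auto simp: affine_iso_def)
  fix f assume f: "affine_map f \<and> dev \<circ> F = f \<circ> dev"
  have "f (dev p) = L (dev p) + t" for p
    using f assms by (metis affine_iso_def comp_apply)
  moreover have "open (dev ` frame_dom undefined)"
    using smooth_chart_is_chart[OF frame_dom(2)[of undefined]] by (simp add: is_chart_def)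
  ultimately show "f = (\<lambda>v. L v + t)"
    using f a frame_dom(1)[of undefined]
    by (intro affine_map_eq_on_open[of _ _ "dev ` frame_dom undefined" "dev undefined"]) auto
qed

lemma linear_part_induced_affine_action:
  assumes "affine_iso F L t"
  shows "linear_part (induced_affine_action dev (\<lambda>a. a) F) = L"
  using assms by (auto simp: induced_affine_action_eq[OF assms] linear_part_def affine_iso_def linear_0)

section \<open>The lifted action on the tangent bundle\<close>

text \<open>In the frame the map is affine with translation \<open>(t, s)\<close>. The fibre
  translation \<open>s\<close> is independent of \<open>t\<close>, so that inverses and all elements
  of the semidirect product are covered.\<close>

lemma TM_affine_etale_map:
  fixes s :: 'e
  assumes F: "affine_iso F L t"
  defines "\<Phi> \<equiv> \<lambda>z. (F (fst z), L (snd z) + s)"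
  shows "etale_map (TM_atlas A dev) (\<lambda>z. (dev (fst z), snd z)) (TM_atlas A dev) (\<lambda>z. (dev (fst z), snd z)) \<Phi>"
    "TM.der q w ((\<lambda>z. (dev (fst z), snd z)) \<circ> \<Phi>) = (L (fst w), L (snd w))"
proof -
  have L: "bounded_linear L" using F by (simp add: affine_iso_def linear_conv_bounded_linear)
  let ?L = "\<lambda>w. (L (fst w), L (snd w))"
  have LL: "bounded_linear ?L"
    by (intro bounded_linear_Pair bounded_linear_compose[OF L] bounded_linear_fst bounded_linear_snd)
  have e: "(\<lambda>z. (dev (fst z), snd z)) \<circ> \<Phi> = (\<lambda>z. ?L (dev (fst z), snd z) + (t, s))"
    using F by (auto simp: affine_iso_def \<Phi>_def)
  have sL: "smooth_near (TM_atlas A dev) q (\<lambda>z. ?L (dev (fst z), snd z))" for q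
    by (rule TM.smooth_near_linear[OF LL TM.smooth_near_D])
  show "etale_map (TM_atlas A dev) (\<lambda>z. (dev (fst z), snd z)) (TM_atlas A dev) (\<lambda>z. (dev (fst z), snd z)) \<Phi>"
  proof
    have "continuous_on UNIV (\<lambda>z :: 'a \<times> 'e. F (fst z))"
      using F by (intro continuous_on_compose2[of UNIV F UNIV fst] continuous_on_fst continuous_on_id)
        (auto simp: affine_iso_def)
    then show "continuous_on UNIV \<Phi>"
      unfolding \<Phi>_def
      by (intro continuous_on_Pair continuous_on_add continuous_on_const
          bounded_linear.continuous_on[OF L] continuous_on_snd continuous_on_id)
    show "smooth_near (TM_atlas A dev) p ((\<lambda>z. (dev (fst z), snd z)) \<circ> \<Phi>)" for p
      unfolding e by (rule TM.smooth_near_add[OF sL TM.smooth_near_const])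
  qed
  show "TM.der q w ((\<lambda>z. (dev (fst z), snd z)) \<circ> \<Phi>) = (L (fst w), L (snd w))"
    unfolding e TM.der_add[OF sL TM.smooth_near_const] TM.der_linear_comp[OF LL TM.smooth_near_D]
    by simp
qed

lemma kaehler_automorphism_TM:
  fixes s :: 'e
  assumes F: "affine_iso F L t"
  defines "\<Phi> \<equiv> \<lambda>z. (F (fst z), L (snd z) + s)"
  shows "kaehler_automorphism (TM_atlas A dev) (TM_complex A dev) (TM_metric A dev g) \<Phi>"
  unfolding kaehler_automorphism_def
proof (intro conjI)
  note m = TM_affine_etale_map[OF F, where s = s, folded \<Phi>_def]
  note Fi = affine_iso_inv[OF F]
  have b: "bij F" "bij L" "linear L" and Li: "linear (inv_into UNIV L)" using F Fi by (auto simp: affine_iso_def)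
  have c: "F (inv_into UNIV F p) = p" "inv_into UNIV F (F p) = p" "L (inv_into UNIV L u) = u" "inv_into UNIV L (L u) = u" for p u
    using b by (simp_all add: bij_is_surj surj_f_inv_f bij_is_inj)
  \<comment> \<open>The inverse has the same form, as a lift of \<open>inv F\<close>; its
    translation solves \<open>L v + s = w\<close> for \<open>v\<close>.\<close>
  let ?\<Psi> = "\<lambda>z. (inv_into UNIV F (fst z), inv_into UNIV L (snd z) + (- inv_into UNIV L s))"
  have fst: "fst (\<Phi> z) = F (fst z)" for z by (simp add: \<Phi>_def)
  have inv: "?\<Psi> (\<Phi> z) = z" "\<Phi> (?\<Psi> z) = z" for z
    by (simp_all add: \<Phi>_def c linear_add[OF Li] linear_diff[OF b(3)])
  then have bij: "bij \<Phi>" by (intro o_bij[of ?\<Psi>]) (auto simp: fun_eq_iff)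
  have "inv_into UNIV \<Phi> = ?\<Psi>" by (rule inv_equality) (rule inv)+
  then show "diffeomorphism (TM_atlas A dev) \<Phi>"
    using bij etale_map.smooth_map[OF m(1)] etale_map.smooth_map[OF TM_affine_etale_map(1)[OF Fi, where s = "- inv_into UNIV L s"]]
    by (simp add: diffeomorphism_def)
  have push: "pushforward (TM_atlas A dev) \<Phi> q (TM.tv q w) = TM.tv (\<Phi> q) (L (fst w), L (snd w))" for q w
    by (simp add: etale_map.pushforward_tv[OF m(1)] m(2))
  show "preserves_complex_structure (TM_atlas A dev) (TM_complex A dev) \<Phi>"
    by (auto simp: preserves_complex_structure_def TM.tangent_space_eq TM_complex_tv push linear_neg[OF b(3)])
  show "preserves_metric (TM_atlas A dev) (TM_metric A dev g) \<Phi>"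
    using F fst by (auto simp: preserves_metric_def TM.tangent_space_eq push TM_metric_tv affine_iso_def)
qed

end

section \<open>The semidirect product group and its action\<close>

locale connected_hessian_mfd = developed_hessian_mfd A nab g dev
  for A :: "('a::{t2_space,second_countable_topology}, 'e::euclidean_space) chart set" and nab g dev +
  assumes connected_space: "connected (UNIV :: 'a set)"
begin

abbreviation G :: "('a \<Rightarrow> 'a) monoid" where "G \<equiv> affine_isometry_group A nab g"
abbreviation \<theta> :: "('a \<Rightarrow> 'a) \<Rightarrow> 'e \<Rightarrow> 'e" where "\<theta> \<equiv> induced_affine_action dev (\<lambda>a. a)"
abbreviation H :: "(('a \<Rightarrow> 'a) \<times> 'e) monoid" where "H \<equiv> affine_semidirect G \<theta>"
abbreviation \<psi> :: "('a \<Rightarrow> 'a) \<times> 'e \<Rightarrow> 'a \<times> 'e \<Rightarrow> 'a \<times> 'e" where "\<psi> \<equiv> TM_action (\<lambda>a. a) \<theta>"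

lemma affine_isometry_iff: "affine_isometry A nab g F \<longleftrightarrow> (\<exists>L t. affine_iso F L t)"
  using affine_isometry_imp_affine_iso[OF connected_space] affine_iso_imp_affine_isometry by metis

lemma G_carrier: "F \<in> carrier G \<longleftrightarrow> (\<exists>L t. affine_iso F L t)"
  by (simp add: affine_isometry_group_def affine_isometry_iff)

lemma H_carrier: "(F, u) \<in> carrier H \<longleftrightarrow> (\<exists>L t. affine_iso F L t)"
  by (simp add: affine_semidirect_def G_carrier)

lemma H_mult: "affine_iso F L t \<Longrightarrow> (F, u) \<otimes>\<^bsub>H\<^esub> (K, w) = (F \<circ> K, u + L w)"
  by (simp add: affine_semidirect_def linear_part_induced_affine_action affine_isometry_group_def)

lemma H_one: "\<one>\<^bsub>H\<^esub> = (id, 0)"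
  by (simp add: affine_semidirect_def affine_isometry_group_def)

lemma group_H: "group H"
proof (rule groupI)
  fix x y assume "x \<in> carrier H" "y \<in> carrier H"
  then obtain F u K w L t M s where x: "x = (F, u)" "affine_iso F L t" and y: "y = (K, w)" "affine_iso K M s"
    by (cases x; cases y) (auto simp: H_carrier)
  note FK = affine_iso_comp[OF x(2) y(2)]
  show "x \<otimes>\<^bsub>H\<^esub> y \<in> carrier H"
    unfolding x(1) y(1) H_mult[OF x(2)] H_carrier using FK by blast
  fix z assume "z \<in> carrier H"
  obtain P v where z: "z = (P, v)" by (cases z)
  have "linear L" using x(2) by (simp add: affine_iso_def)
  then show "x \<otimes>\<^bsub>H\<^esub> y \<otimes>\<^bsub>H\<^esub> z = x \<otimes>\<^bsub>H\<^esub> (y \<otimes>\<^bsub>H\<^esub> z)"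
    by (simp add: x(1) y(1) z H_mult[OF x(2)] H_mult[OF y(2)] H_mult[OF FK] linear_add o_assoc)
next
  show "\<one>\<^bsub>H\<^esub> \<in> carrier H" unfolding H_one H_carrier using affine_iso_id by blast
next
  fix x assume "x \<in> carrier H"
  then obtain F u L t where x: "x = (F, u)" "affine_iso F L t" by (cases x) (auto simp: H_carrier)
  note Fi = affine_iso_inv[OF x(2)]
  show "\<one>\<^bsub>H\<^esub> \<otimes>\<^bsub>H\<^esub> x = x" unfolding H_one x(1) H_mult[OF affine_iso_id] by simp
  show "\<exists>y\<in>carrier H. y \<otimes>\<^bsub>H\<^esub> x = \<one>\<^bsub>H\<^esub>"
  \<comment> \<open>The linear part of the inverse is \<open>inv L\<close>, so the second component
    of the product is \<open>- inv L u + inv L u = 0\<close>.\<close>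
  proof (rule bexI[of _ "(inv_into UNIV F, - inv_into UNIV L u)"])
    show "(inv_into UNIV F, - inv_into UNIV L u) \<in> carrier H" unfolding H_carrier using Fi by blast
    show "(inv_into UNIV F, - inv_into UNIV L u) \<otimes>\<^bsub>H\<^esub> x = \<one>\<^bsub>H\<^esub>"
      unfolding x(1) H_mult[OF Fi] H_one using x(2) by (simp add: affine_iso_def bij_is_inj)
  qed
qed

lemma \<psi>_eq: "affine_iso F L t \<Longrightarrow> \<psi> (F, u) = (\<lambda>z. (F (fst z), L (snd z) + (t + u)))"
  by (auto simp: TM_action_def induced_affine_action_eq)

lemma kaehler_automorphism_\<psi>:
  assumes "s \<in> carrier H"
  shows "kaehler_automorphism (TM_atlas A dev) (TM_complex A dev) (TM_metric A dev g) (\<psi> s)"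
proof -
  obtain F u L t where s: "s = (F, u)" "affine_iso F L t" using assms by (cases s) (auto simp: H_carrier)
  show ?thesis unfolding s(1) \<psi>_eq[OF s(2)] by (rule kaehler_automorphism_TM[OF s(2)])
qed

lemma group_action_\<psi>: "group_action H UNIV \<psi>"
proof -
  have bij: "\<psi> s \<in> Bij UNIV" if "s \<in> carrier H" for s
    using kaehler_automorphism_\<psi>[OF that] by (simp add: Bij_def kaehler_automorphism_def diffeomorphism_def)
  have "\<psi> (x \<otimes>\<^bsub>H\<^esub> y) = compose UNIV (\<psi> x) (\<psi> y)"
    if xy: "x \<in> carrier H" "y \<in> carrier H" for x y
  proof -
    obtain F u K w L t M s where x: "x = (F, u)" "affine_iso F L t" and y: "y = (K, w)" "affine_iso K M s"
      using xy by (cases x; cases y) (auto simp: H_carrier)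
    have "linear L" using x(2) by (simp add: affine_iso_def)
    \<comment> \<open>Both sides send the fibre component \<open>v\<close> to
      \<open>L (M v) + (L s + t) + (u + L w)\<close>.\<close>
    then show ?thesis
      unfolding x(1) y(1) H_mult[OF x(2)] \<psi>_eq[OF x(2)] \<psi>_eq[OF y(2)] \<psi>_eq[OF affine_iso_comp[OF x(2) y(2)]]
      by (auto simp: compose_def linear_add)
  qed
  then have "\<psi> \<in> hom H (BijGroup UNIV)"
    using bij by (auto simp: hom_def BijGroup_def)
  then show ?thesis
    by (intro group_action.intro group_hom.intro group_hom_axioms.intro group_H group_BijGroup)
qed

text \<open>An isometry matches the base points, and a translation of the fibre corrects the
  rest.\<close>

lemma transitive_action_\<psi>:
  assumes "transitive_action G UNIV (\<lambda>a. a)"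
  shows "transitive_action H UNIV \<psi>"
proof (intro transitive_action.intro group_action_\<psi> transitive_action_axioms.intro)
  fix z z' :: "'a \<times> 'e"
  obtain F where F: "F \<in> carrier G" "F (fst z) = fst z'"
    using transitive_action.unique_orbit[OF assms, of "fst z" "fst z'"] by auto
  then obtain L t where Lt: "affine_iso F L t" unfolding G_carrier by blast
  show "\<exists>s\<in>carrier H. \<psi> s z = z'"
  \<comment> \<open>The translation is the solution \<open>u\<close> of
    \<open>L (snd z) + (t + u) = snd z'\<close>.\<close>
  proof (rule bexI[of _ "(F, snd z' - (L (snd z) + t))"])
    show "\<psi> (F, snd z' - (L (snd z) + t)) z = z'"
      unfolding \<psi>_eq[OF Lt] using F(2) by (simp add: prod_eq_iff)
    show "(F, snd z' - (L (snd z) + t)) \<in> carrier H" unfolding H_carrier using Lt by blast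
  qed
qed

end

theorem theorem3p3:
  fixes A :: "('a::{t2_space,second_countable_topology}, real ^ 'n) chart set"
    and nab :: "'a field \<Rightarrow> 'a field \<Rightarrow> 'a field"
    and g :: "'a metric"
    and dev :: "'a \<Rightarrow> real ^ 'n"
  assumes "simply_connected (UNIV :: 'a set)"
    and "hessian_manifold A nab g"
    and "development_map A nab dev"
  shows "let G = affine_isometry_group A nab g;
             \<phi> = (\<lambda>a. a);
             \<theta> = induced_affine_action dev \<phi>;
             H = affine_semidirect G \<theta>;
             \<psi> = TM_action \<phi> \<theta>;
             TM = TM_atlas A dev;
             I = TM_complex A dev;
             g_r = TM_metric A dev g
         in kaehler_manifold TM I g_r \<and>
            group_action H UNIV \<psi> \<and>
            (\<forall>s\<in>carrier H. kaehler_automorphism TM I g_r (\<psi> s)) \<and>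
            (homogeneous_hessian_manifold A nab g G \<phi> \<longrightarrow>
             homogeneous_kaehler_manifold TM I g_r H \<psi>)"
proof -
  interpret connected_hessian_mfd A nab g dev
    using assms simply_connected_imp_connected_space by unfold_locales auto
  show ?thesis
    unfolding Let_def homogeneous_hessian_manifold_def homogeneous_kaehler_manifold_def
    using kaehler_TM group_action_\<psi> kaehler_automorphism_\<psi> transitive_action_\<psi> by blast
qed

end
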